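(* There is an algorithm that, given a planar straight-line graph $G$ with $n$ vertices, no three of which are collinear, computes the number of convex polygons in $G$ in $O(n^2)$ time. Moreover, the convex polygons in $G$ can be enumerated in an additional $O(1)$ time per edge (that is, using additional time proportional to the total number of edges of the reported polygons).
   Context: A planar straight-line graph is a graph whose vertices are points in $\mathbb{R}^2$ and whose edges are straight-line segments between vertices, such that no two edges cross. A convex polygon in $G$ is a cycle of $G$ (as a subgraph) whose interior, i.e. the bounded region it encloses, is convex. Running times are in the usual model of computational geometry (real RAM), where each arithmetic operation or comparison on numbers, including the counts being computed, takes unit time. *)

theory Defs
  imports "HOL-Analysis.Analysis" "HOL-Library.Landau_Symbols"
begin

section \<open>Planar straight-line graphs and their convex polygons\<close>

type_synonym point = "real \<times> real"

text \<open>An edge is the set of its two endpoints; it is drawn as the segment \<open>convex hull e\<close>.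
  Two edges do not cross if they meet only in a common endpoint.\<close>

definition pslg :: "point set \<Rightarrow> point set set \<Rightarrow> bool" where
  "pslg V E \<longleftrightarrow>
     finite V \<and>
     (\<forall>e\<in>E. e \<subseteq> V \<and> card e = 2) \<and>
     (\<forall>e\<in>E. \<forall>f\<in>E. e \<noteq> f \<longrightarrow> convex hull e \<inter> convex hull f \<subseteq> e \<inter> f)"

definition no_three_collinear :: "point set \<Rightarrow> bool" where
  "no_three_collinear V \<longleftrightarrow>
     (\<forall>a\<in>V. \<forall>b\<in>V. \<forall>c\<in>V. distinct [a, b, c] \<longrightarrow> \<not> collinear {a, b, c})"

definition cycle_edges :: "point list \<Rightarrow> point set set" where
  "cycle_edges vs = {{vs ! i, vs ! (Suc i mod length vs)} | i. i < length vs}"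

definition cycle_in :: "point set set \<Rightarrow> point list \<Rightarrow> bool" where
  "cycle_in E vs \<longleftrightarrow> length vs \<ge> 3 \<and> distinct vs \<and> cycle_edges vs \<subseteq> E"

text \<open>A polygon is a cycle as a subgraph, that is, its set of edges: the starting vertex and the
  direction of traversal do not matter. The region it encloses is the \<^const>\<open>inside\<close> of the
  closed curve that its edges form.\<close>

definition convex_polygons :: "point set set \<Rightarrow> point set set set" where
  "convex_polygons E =
     {P. (\<exists>vs. cycle_in E vs \<and> P = cycle_edges vs) \<and> convex (inside (\<Union>e\<in>P. convex hull e))}"


section \<open>The real RAM\<close>

text \<open>The machine has a memory for natural numbers (indices and counts) and a memory for real
  numbers. Each is divided into named arrays of unbounded length, of which a program can mention
  only finitely many; a scalar variable is cell 0 of an array. Array subscripts are computed, which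
  gives indirect addressing. There is neither a rounding operation nor any other way to turn a real
  number into a natural number, other than by branching on comparisons, and the only numeric
  constants in a program are natural numbers. Naturals of any size are stored in a single cell.
  Results are appended to a write-only output.\<close>

type_synonym array_name = string

record state =
  nat_mem :: "array_name \<Rightarrow> nat \<Rightarrow> nat"
  real_mem :: "array_name \<Rightarrow> nat \<Rightarrow> real"
  out :: "nat list"

datatype nexp =
    NConst nat
  | NRead array_name nexp
  | NAdd nexp nexp
  | NSub nexp nexp
  | NMul nexp nexp

datatype rexp =
    RConst nat
  | RRead array_name nexp
  | RAdd rexp rexp
  | RSub rexp rexp
  | RMul rexp rexp
  | RDiv rexp rexp

datatype bexp =
    NLess nexp nexp
  | NEq nexp nexp
  | RLess rexp rexp
  | REq rexp rexp
  | BNot bexp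
  | BAnd bexp bexp

datatype com =
    Skip
  | NWrite array_name nexp nexp
  | RWrite array_name nexp rexp
  | Output nexp
  | Seq com com
  | Cond bexp com com
  | While bexp com

text \<open>Subtraction of naturals is truncated, and division by the real number 0 yields 0.\<close>

fun nval :: "nexp \<Rightarrow> state \<Rightarrow> nat" where
  "nval (NConst k) s = k"
| "nval (NRead a i) s = nat_mem s a (nval i s)"
| "nval (NAdd e f) s = nval e s + nval f s"
| "nval (NSub e f) s = nval e s - nval f s"
| "nval (NMul e f) s = nval e s * nval f s"

fun rval :: "rexp \<Rightarrow> state \<Rightarrow> real" where
  "rval (RConst k) s = real k"
| "rval (RRead a i) s = real_mem s a (nval i s)"
| "rval (RAdd e f) s = rval e s + rval f s"
| "rval (RSub e f) s = rval e s - rval f s"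
| "rval (RMul e f) s = rval e s * rval f s"
| "rval (RDiv e f) s = rval e s / rval f s"

fun bval :: "bexp \<Rightarrow> state \<Rightarrow> bool" where
  "bval (NLess e f) s \<longleftrightarrow> nval e s < nval f s"
| "bval (NEq e f) s \<longleftrightarrow> nval e s = nval f s"
| "bval (RLess e f) s \<longleftrightarrow> rval e s < rval f s"
| "bval (REq e f) s \<longleftrightarrow> rval e s = rval f s"
| "bval (BNot b) s \<longleftrightarrow> \<not> bval b s"
| "bval (BAnd b c) s \<longleftrightarrow> bval b s \<and> bval c s"

text \<open>Every constant, memory access, arithmetic operation, comparison and connective costs one
  unit of time; there is no short-circuit evaluation.\<close>

fun ncost :: "nexp \<Rightarrow> nat" where
  "ncost (NConst k) = 1"
| "ncost (NRead a i) = 1 + ncost i"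
| "ncost (NAdd e f) = 1 + ncost e + ncost f"
| "ncost (NSub e f) = 1 + ncost e + ncost f"
| "ncost (NMul e f) = 1 + ncost e + ncost f"

fun rcost :: "rexp \<Rightarrow> nat" where
  "rcost (RConst k) = 1"
| "rcost (RRead a i) = 1 + ncost i"
| "rcost (RAdd e f) = 1 + rcost e + rcost f"
| "rcost (RSub e f) = 1 + rcost e + rcost f"
| "rcost (RMul e f) = 1 + rcost e + rcost f"
| "rcost (RDiv e f) = 1 + rcost e + rcost f"

fun bcost :: "bexp \<Rightarrow> nat" where
  "bcost (NLess e f) = 1 + ncost e + ncost f"
| "bcost (NEq e f) = 1 + ncost e + ncost f"
| "bcost (RLess e f) = 1 + rcost e + rcost f"
| "bcost (REq e f) = 1 + rcost e + rcost f"
| "bcost (BNot b) = 1 + bcost b"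
| "bcost (BAnd b c) = 1 + bcost b + bcost c"

definition nwrite :: "array_name \<Rightarrow> nat \<Rightarrow> nat \<Rightarrow> state \<Rightarrow> state" where
  "nwrite a i v s = s\<lparr>nat_mem := (nat_mem s)(a := (nat_mem s a)(i := v))\<rparr>"

definition rwrite :: "array_name \<Rightarrow> nat \<Rightarrow> real \<Rightarrow> state \<Rightarrow> state" where
  "rwrite a i v s = s\<lparr>real_mem := (real_mem s)(a := (real_mem s a)(i := v))\<rparr>"

definition emit :: "nat \<Rightarrow> state \<Rightarrow> state" where
  "emit v s = s\<lparr>out := out s @ [v]\<rparr>"

text \<open>\<open>exec c s k t\<close>: started in state \<open>s\<close>, the program \<open>c\<close> terminates in state \<open>t\<close> after exactly
  \<open>k\<close> units of time.\<close>

inductive exec :: "com \<Rightarrow> state \<Rightarrow> nat \<Rightarrow> state \<Rightarrow> bool" where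
  Skip: "exec Skip s 1 s"
| NWrite: "exec (NWrite a i e) s (1 + ncost i + ncost e) (nwrite a (nval i s) (nval e s) s)"
| RWrite: "exec (RWrite a i e) s (1 + ncost i + rcost e) (rwrite a (nval i s) (rval e s) s)"
| Output: "exec (Output e) s (1 + ncost e) (emit (nval e s) s)"
| Seq: "exec c s k s' \<Longrightarrow> exec d s' l t \<Longrightarrow> exec (Seq c d) s (k + l) t"
| CondTrue: "bval b s \<Longrightarrow> exec c s k t \<Longrightarrow> exec (Cond b c d) s (1 + bcost b + k) t"
| CondFalse: "\<not> bval b s \<Longrightarrow> exec d s k t \<Longrightarrow> exec (Cond b c d) s (1 + bcost b + k) t"
| WhileFalse: "\<not> bval b s \<Longrightarrow> exec (While b c) s (1 + bcost b) s"
| WhileTrue: "bval b s \<Longrightarrow> exec c s k s' \<Longrightarrow> exec (While b c) s' l t \<Longrightarrow>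
    exec (While b c) s (1 + bcost b + k + l) t"

inductive_cases exec_SkipE: "exec Skip s k t"
inductive_cases exec_NWriteE: "exec (NWrite a i e) s k t"
inductive_cases exec_RWriteE: "exec (RWrite a i e) s k t"
inductive_cases exec_OutputE: "exec (Output e) s k t"
inductive_cases exec_SeqE: "exec (Seq c d) s k t"
inductive_cases exec_CondE: "exec (Cond b c d) s k t"
inductive_cases exec_WhileE: "exec (While b c) s k t"

lemma exec_deterministic:
  "exec c s k t \<Longrightarrow> exec c s k' t' \<Longrightarrow> k' = k \<and> t' = t"
proof (induction arbitrary: k' t' rule: exec.induct)
  case (Seq c s k s' d l t)
  show ?case
    using Seq.prems by (rule exec_SeqE) (metis Seq.IH)
next
  case (CondTrue b s c k t d)
  show ?case
    using CondTrue.prems by (rule exec_CondE) (auto simp: CondTrue.hyps dest: CondTrue.IH)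
next
  case (CondFalse b s d k t c)
  show ?case
    using CondFalse.prems by (rule exec_CondE) (auto simp: CondFalse.hyps dest: CondFalse.IH)
next
  case (WhileTrue b s c k s' l t)
  show ?case
    using WhileTrue.prems by (rule exec_WhileE) (auto simp: WhileTrue.hyps dest: WhileTrue.IH)
next
  case (WhileFalse b s c)
  show ?case
    using WhileFalse.prems by (rule exec_WhileE) (use WhileFalse.hyps in simp_all)
qed (elim exec_SkipE exec_NWriteE exec_RWriteE exec_OutputE; simp)+


section \<open>Input and output\<close>

text \<open>A graph is given by the list of its vertices, in any order, and the list of its edges, in any
  order, each edge being listed once as a pair of positions in the list of vertices.\<close>

definition represents ::
  "point list \<Rightarrow> (nat \<times> nat) list \<Rightarrow> point set \<Rightarrow> point set set \<Rightarrow> bool" where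
  "represents ps es V E \<longleftrightarrow>
     distinct ps \<and> set ps = V \<and>
     (\<forall>(i, j) \<in> set es. i < length ps \<and> j < length ps) \<and>
     distinct (map (\<lambda>(i, j). {ps ! i, ps ! j}) es) \<and>
     set (map (\<lambda>(i, j). {ps ! i, ps ! j}) es) = E"

definition array_of :: "'a::zero list \<Rightarrow> nat \<Rightarrow> 'a" where
  "array_of xs i = (if i < length xs then xs ! i else 0)"

definition input_state :: "point list \<Rightarrow> (nat \<times> nat) list \<Rightarrow> state" where
  "input_state ps es =
     \<lparr>nat_mem = (\<lambda>_ _. 0)
        (''n'' := array_of [length ps],
         ''m'' := array_of [length es],
         ''src'' := array_of (map fst es),
         ''dst'' := array_of (map snd es)),
      real_mem = (\<lambda>_ _. 0)
        (''x'' := array_of (map fst ps),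
         ''y'' := array_of (map snd ps)),
      out = []\<rparr>"

text \<open>A polygon with \<open>k\<close> vertices is reported by writing \<open>k\<close>, followed by the positions of its
  vertices in cyclic order. Each convex polygon must be reported exactly once.\<close>

definition enumerates_convex_polygons ::
  "point list \<Rightarrow> point set set \<Rightarrow> nat list \<Rightarrow> bool" where
  "enumerates_convex_polygons ps E xs \<longleftrightarrow>
     (\<exists>cs. xs = concat (map (\<lambda>c. length c # c) cs) \<and>
        (\<forall>c\<in>set cs. set c \<subseteq> {..<length ps} \<and> cycle_in E (map ((!) ps) c)) \<and>
        distinct (map (\<lambda>c. cycle_edges (map ((!) ps) c)) cs) \<and>
        set (map (\<lambda>c. cycle_edges (map ((!) ps) c)) cs) = convex_polygons E)"

end

(*
A convex polygon, traversed counterclockwise from its lowest vertex, is a closed walk whose edges have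
strictly increasing directions in [0, 2 pi), and every such walk with at least three edges is a convex
polygon. So sort the 2m directed edges by direction; for each start vertex, a single backward pass over
the sorted edges counts the monotone closed walks. The walks with two edges go back and forth along one
edge, so exactly m of them have to be subtracted. As a plane graph has at most 3n edges, both the
sorting (by counting ranks) and the n passes take time O(n^2). For the enumeration, the same pass links
every edge that can be completed to a closed walk to its possible successors; a depth-first search
along these links never runs into a dead end.

That a cycle encloses a convex region iff all its vertices lie on one side of each of its edges follows
from the Jordan curve theorem: the curve is the frontier of its inside, which has a supporting line at
the midpoint of each edge; conversely, the inside then fills the interior of the convex hull.
*)

theory Submission
  imports Defs "HOL-Library.Sublist"
begin

section \<open>Directions and orientation\<close>

text \<open>No test for simplicity is needed. In a closed walk whose directions increase within one
  turn, the height over the line of a fixed edge rises after that edge and then falls back to zero.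
  This alone puts all other vertices strictly to the left of the edge, so they are distinct and the
  polygon is convex. Sorting yields only a weak order, since parallel arcs tie. Consecutive arcs of
  a walk are never parallel when no three vertices are collinear, so walks increase strictly and
  ties may be broken in any way. The lexicographically lowest vertex and the counterclockwise sense
  select one walk per polygon. The bound of \<open>3 * n\<close> edges comes from a charging
  argument without faces: one edge per vertex for the topmost edge leaving it to the right, and two
  per vertex for the others. Constant time per reported edge rests on shared lists. The backward
  pass only prepends to successor lists, so a list head saved with an arc keeps denoting exactly the
  usable arcs later in the order. As each saved list is nonempty, every node of the search lies on
  some walk that pays for it.\<close>

definition cross :: "point \<Rightarrow> point \<Rightarrow> real" where
  "cross a b = fst a * snd b - snd a * fst b"

definition orient :: "point \<Rightarrow> point \<Rightarrow> point \<Rightarrow> real" where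
  "orient a b c = cross (b - a) (c - a)"

text \<open>The polar angles in [0, pi). The same predicate is an order on points:
  \<open>upper (b - a)\<close> says that \<open>b\<close> is lexicographically above
  \<open>a\<close>, second coordinate first. It defines the lowest vertex.\<close>

definition upper :: "point \<Rightarrow> bool" where
  "upper d \<longleftrightarrow> snd d > 0 \<or> snd d = 0 \<and> fst d > 0"

text \<open>A substitute for the polar angle in \<open>[0, 2\<pi>)\<close> that can be computed without square roots;
  it ranges over \<open>[0, 4)\<close>.\<close>

definition ang :: "point \<Rightarrow> real" where
  "ang d = (if upper d then 1 - fst d / (\<bar>fst d\<bar> + \<bar>snd d\<bar>) else 3 + fst d / (\<bar>fst d\<bar> + \<bar>snd d\<bar>))"

lemma cross_simps:
  "cross a (b + c) = cross a b + cross a c" "cross a (b - c) = cross a b - cross a c"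
  "cross (- a) b = - cross a b" "cross a (- b) = - cross a b" "cross a a = 0" "cross a 0 = 0"
  by (simp_all add: cross_def algebra_simps)

lemma cross_swap: "cross a b = - cross b a"
  by (simp add: cross_def)

lemma orient_rotate: "orient b c a = orient a b c"
  by (simp add: orient_def cross_def algebra_simps)

lemma orient_swap: "orient b a c = - orient a b c"
  by (simp add: orient_def cross_def algebra_simps)

lemma orient_refl [simp]: "orient a b a = 0" "orient a b b = 0" "orient a a b = 0"
  by (simp_all add: orient_def cross_def)

lemma upper_uminus: "d \<noteq> 0 \<Longrightarrow> upper (- d) \<longleftrightarrow> \<not> upper d"
  by (cases d) (auto simp: upper_def zero_prod_def)

lemma ang_uminus: "upper d \<Longrightarrow> ang (- d) = ang d + 2"
  using upper_uminus[of d] by (auto simp: ang_def upper_def)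

lemma ang_upper_bounds:
  assumes "upper d" shows "0 \<le> ang d" "ang d < 2"
proof -
  have "0 < \<bar>fst d\<bar> + \<bar>snd d\<bar>" using assms by (auto simp: upper_def)
  moreover have "- (\<bar>fst d\<bar> + \<bar>snd d\<bar>) < fst d" "fst d \<le> \<bar>fst d\<bar> + \<bar>snd d\<bar>"
    using assms by (auto simp: upper_def)
  ultimately show "0 \<le> ang d" "ang d < 2"
    using assms by (auto simp: ang_def field_simps)
qed

lemma ang_lower_bounds:
  assumes "\<not> upper d" "d \<noteq> 0" shows "2 \<le> ang d" "ang d < 4"
proof -
  have u: "upper (- d)" using assms upper_uminus by blast
  then show "2 \<le> ang d" "ang d < 4"
    using ang_upper_bounds[OF u] ang_uminus[OF u] by auto
qed

lemma ang_less_upper: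
  assumes "upper a" "upper b"
  shows "ang a < ang b \<longleftrightarrow> 0 < cross a b"
proof -
  obtain x1 y1 x2 y2 where ab: "a = (x1, y1)" "b = (x2, y2)" by fastforce
  have y: "y1 \<ge> 0" "y2 \<ge> 0" using assms by (auto simp: upper_def ab)
  have s: "0 < \<bar>x1\<bar> + y1" "0 < \<bar>x2\<bar> + y2" using assms by (auto simp: upper_def ab)
  have "ang a < ang b \<longleftrightarrow> x2 / (\<bar>x2\<bar> + y2) < x1 / (\<bar>x1\<bar> + y1)"
    using assms y by (simp add: ang_def ab)
  also have "\<dots> \<longleftrightarrow> x2 * (\<bar>x1\<bar> + y1) < x1 * (\<bar>x2\<bar> + y2)"
    using s by (simp add: divide_less_eq less_divide_eq field_simps)
  also have "\<dots> \<longleftrightarrow> 0 < x1 * y2 - y1 * x2"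
  \<comment> \<open>For equal signs \<open>x2 * \<bar>x1\<bar>\<close> and
    \<open>x1 * \<bar>x2\<bar>\<close> cancel, and the cross product remains. For opposite signs
    both inequalities are decided by the signs alone.\<close>
  proof (cases "x1 \<ge> 0 \<longleftrightarrow> x2 \<ge> 0")
    case True
    then have "x2 * \<bar>x1\<bar> = x1 * \<bar>x2\<bar>" by (auto simp: abs_if)
    then show ?thesis by (simp add: algebra_simps)
  next
    case False
    show ?thesis
    proof (cases "x1 \<ge> 0")
      case True
      then have "x2 < 0" using False by auto
      have "x1 * y2 \<ge> 0" "y1 * x2 \<le> 0" "x2 * \<bar>x1\<bar> \<le> 0" "0 \<le> x1 * \<bar>x2\<bar>"
        using True \<open>x2 < 0\<close> y by (auto simp: mult_nonneg_nonpos mult_nonpos_nonneg)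
      moreover have "x1 * y2 - y1 * x2 \<noteq> 0"
      proof
        assume eq: "x1 * y2 - y1 * x2 = 0"
        have "y2 > 0" using assms \<open>x2 < 0\<close> by (auto simp: upper_def ab)
        have "x1 * y2 = 0" "y1 * x2 = 0" using eq \<open>x1 * y2 \<ge> 0\<close> \<open>y1 * x2 \<le> 0\<close> by auto
        then have "x1 = 0" "y1 = 0" using \<open>x2 < 0\<close> \<open>y2 > 0\<close> by auto
        then show False using s by simp
      qed
      ultimately have "0 < x1 * y2 - y1 * x2" by linarith
      moreover have "x2 * (\<bar>x1\<bar> + y1) < 0" using s(1) \<open>x2 < 0\<close> by (simp add: mult_neg_pos)
      moreover have "0 \<le> x1 * (\<bar>x2\<bar> + y2)" using True s(2) by simp
      ultimately show ?thesis by linarith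
    next
      case nn: False
      then have "x2 \<ge> 0" "x1 < 0" using False by auto
      have "x1 * y2 \<le> 0" "y1 * x2 \<ge> 0"
        using \<open>x2 \<ge> 0\<close> \<open>x1 < 0\<close> y by (auto simp: mult_nonneg_nonpos mult_nonpos_nonneg)
      moreover have "x1 * (\<bar>x2\<bar> + y2) < 0" using s(2) \<open>x1 < 0\<close> by (simp add: mult_neg_pos)
      moreover have "0 \<le> x2 * (\<bar>x1\<bar> + y1)" using \<open>x2 \<ge> 0\<close> s(1) by simp
      ultimately show ?thesis by linarith
    qed
  qed
  also have "\<dots> \<longleftrightarrow> 0 < cross a b" by (simp add: cross_def ab)
  finally show ?thesis .
qed

lemma ang_less_lower:
  assumes "\<not> upper a" "\<not> upper b" "a \<noteq> 0" "b \<noteq> 0"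
  shows "ang a < ang b \<longleftrightarrow> 0 < cross a b"
proof -
  have u: "upper (- a)" "upper (- b)" using assms upper_uminus by blast+
  show ?thesis
    using ang_less_upper[OF u] ang_uminus[OF u(1)] ang_uminus[OF u(2)] by (simp add: cross_simps)
qed

lemma ang_less_mixed:
  assumes "upper a" "\<not> upper b" "b \<noteq> 0"
  shows "ang a < ang b"
  using ang_upper_bounds[OF assms(1)] ang_lower_bounds[OF assms(2,3)] by simp

lemma ang_eq_iff:
  assumes "ang a = ang b" "a \<noteq> 0" "b \<noteq> 0" shows "cross a b = 0"
proof -
  have "upper a \<longleftrightarrow> upper b"
    using ang_less_mixed[of a b] ang_less_mixed[of b a] assms by auto
  then have "\<not> 0 < cross a b" "\<not> 0 < cross b a"
    using ang_less_upper[of a b] ang_less_upper[of b a] ang_less_lower[of a b] ang_less_lower[of b a] assms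
    by auto
  then show ?thesis using cross_swap[of a b] by linarith
qed

section \<open>Closed chains with increasing directions\<close>

lemma step_mono_on:
  fixes f :: "nat \<Rightarrow> real"
  assumes "\<And>j. a \<le> j \<Longrightarrow> j < b \<Longrightarrow> f j < f (Suc j)" "a \<le> b"
  shows "f a \<le> f b \<and> (a < b \<longrightarrow> f a < f b)"
  using assms(2,1)
proof (induction b rule: dec_induct)
  case base then show ?case by simp
next
  case (step n)
  then have "f n < f (Suc n)" by simp
  moreover have "f a \<le> f n" using step by simp
  ultimately show ?case by simp
qed

text \<open>The height \<open>f\<close> over the line of edge \<open>i\<close> changes by
  \<open>s j\<close> at step \<open>j\<close>. Directions less than half a turn past
  \<open>d i\<close> raise it, the later ones lower it. So \<open>f\<close> rises from 0 at
  \<open>Suc i\<close> and falls to 0 at \<open>i\<close>, cyclically, and is positive in between.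
  The two cases place the cut between \<open>k\<close> and \<open>0\<close> in the falling or in the
  rising part.\<close>

lemma sorted_closed_chain_left:
  fixes p :: "nat \<Rightarrow> point"
  defines "d \<equiv> \<lambda>j. p (Suc j) - p j"
  assumes closed: "p k = p 0"
    and nz: "\<And>j. j < k \<Longrightarrow> d j \<noteq> 0"
    and sorted: "\<And>i j. i < j \<Longrightarrow> j < k \<Longrightarrow> ang (d i) < ang (d j)"
    and i: "i < k" and j: "j < k" "j \<noteq> i" "j \<noteq> Suc i mod k"
  shows "0 < orient (p i) (p (Suc i)) (p j)"
proof -
  define f where "f j = cross (d i) (p j - p i)" for j
  define s where "s j = cross (d i) (d j)" for j
  have step: "f (Suc j) = f j + s j" for j
    by (simp add: f_def s_def d_def cross_def algebra_simps)
  have fi: "f i = 0" "f (Suc i) = 0"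
    by (simp_all add: f_def d_def cross_simps)
  have fk: "f k = f 0" by (simp add: f_def closed)
  have up: "(\<And>l. a \<le> l \<Longrightarrow> l < b \<Longrightarrow> 0 < s l) \<Longrightarrow> a \<le> b \<Longrightarrow> f a \<le> f b \<and> (a < b \<longrightarrow> f a < f b)" for a b
    by (rule step_mono_on) (auto simp: step)
  have down: "(\<And>l. a \<le> l \<Longrightarrow> l < b \<Longrightarrow> s l < 0) \<Longrightarrow> a \<le> b \<Longrightarrow> f b \<le> f a \<and> (a < b \<longrightarrow> f b < f a)" for a b
    using step_mono_on[of a b "\<lambda>j. - f j"] by (auto simp: step)
  have succ: "Suc i mod k = (if Suc i = k then 0 else Suc i)" using i by auto
  have "0 < f j"
  proof (cases "upper (d i)")
    case U: True
    have before: "s l < 0" if "l < i" for l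
    proof -
      have lt: "ang (d l) < ang (d i)" using sorted[of l i] that i by simp
      then have "upper (d l)" using ang_less_mixed[of "d i" "d l"] U nz[of l] that i by auto
      then show ?thesis using lt ang_less_upper[of "d l" "d i"] U by (simp add: s_def cross_swap[of "d i"])
    qed
    \<comment> \<open>A direction exactly opposite to \<open>d i\<close> has \<open>s l = 0\<close>.
      Hence the claim starts from a non-positive increment and yields strictly negative later
      ones.\<close>
    have after: "s l' < 0" if "i < l" "l < l'" "l' < k" "s l \<le> 0" for l l'
    proof -
      have nzl: "d l \<noteq> 0" "d l' \<noteq> 0" using nz that by auto
      have "ang (d i) < ang (d l)" using sorted that by auto
      then have L: "\<not> upper (d l)" using ang_less_upper[of "d i" "d l"] U that(4) by (auto simp: s_def)
      then have L': "\<not> upper (d l')"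
        using sorted[of l l'] that ang_less_mixed[of "d l'" "d l"] nzl by fastforce
      have u: "upper (- d l)" "upper (- d l')" using L L' nzl upper_uminus by auto
      have "ang (- d l) < ang (- d l')"
        using sorted[of l l'] that ang_uminus[OF u(1)] ang_uminus[OF u(2)] by simp
      moreover have "\<not> ang (- d l) < ang (d i)"
        using ang_less_upper[OF u(1) U] that(4) cross_swap[of "d l" "d i"] by (simp add: s_def cross_simps)
      ultimately have "ang (d i) < ang (- d l')" by simp
      then show ?thesis using ang_less_upper[OF U u(2)] by (simp add: s_def cross_simps)
    qed
    have f0: "0 \<le> f 0" using down[of 0 i] before fi by auto
    consider "j < i" | "Suc i < j" using j i succ by (metis linorder_neqE_nat not_less_eq Suc_lessI)
    then show ?thesis
    proof cases
      case 1
      then show ?thesis using down[of j i] before fi by auto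
    next
      case 2
      show ?thesis
      proof (cases "\<forall>l. Suc i \<le> l \<and> l < j \<longrightarrow> 0 < s l")
        case True
        then show ?thesis using up[of "Suc i" j] fi 2 by auto
      next
        case False
        then obtain l where "Suc i \<le> l" "l < j" "s l \<le> 0" by force
        then have "f k < f j" using down[of j k] after[of l] j by fastforce
        then show ?thesis using f0 fk by simp
      qed
    qed
  next
    case L: False
    have nzi: "d i \<noteq> 0" using nz i by simp
    have u: "upper (- d i)" using L nzi upper_uminus by auto
    have after: "0 < s l" if "i < l" "l < k" for l
    proof -
      have lt: "ang (d i) < ang (d l)" using sorted that by auto
      then have "\<not> upper (d l)" using ang_less_mixed[of "d l" "d i"] L nzi by auto
      then show ?thesis using lt ang_less_lower[of "d i" "d l"] L nzi nz that by (simp add: s_def)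
    qed
    \<comment> \<open>The mirror image: read backwards from \<open>i\<close>, increments that are
      once non-negative are positive before that.\<close>
    have before: "0 < s l'" if "l' < l" "l < i" "0 \<le> s l" for l l'
    proof -
      have nzl: "d l \<noteq> 0" "d l' \<noteq> 0" using nz that i by auto
      have lt: "ang (d l') < ang (d l)" "ang (d l) < ang (d i)" using sorted that i by auto
      then have U: "upper (d l)"
        using ang_less_lower[of "d l" "d i"] L nzl nzi that(3) cross_swap[of "d i" "d l"] by (auto simp: s_def)
      then have U': "upper (d l')"
        using lt ang_less_mixed[of "d l" "d l'"] nzl by fastforce
      have "\<not> ang (- d i) < ang (d l)"
        using ang_less_upper[OF u U] that(3) by (simp add: s_def cross_simps)
      then have "ang (d l') < ang (- d i)" using lt by simp
      then show ?thesis using ang_less_upper[OF U' u] cross_swap[of "d l'" "d i"] by (simp add: s_def cross_simps)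
    qed
    have f0: "0 \<le> f 0" "Suc i < k \<Longrightarrow> 0 < f 0" using up[of "Suc i" k] after fi fk i by auto
    consider "j < i" | "Suc i < j" using j i succ by (metis linorder_neqE_nat not_less_eq Suc_lessI)
    then show ?thesis
    proof cases
      case 2
      then show ?thesis using up[of "Suc i" j] after fi j by auto
    next
      case 1
      show ?thesis
      proof (cases "\<forall>l. j \<le> l \<and> l < i \<longrightarrow> s l < 0")
        case True
        then show ?thesis using down[of j i] fi 1 by auto
      next
        case False
        then obtain l where l: "j \<le> l" "l < i" "0 \<le> s l" by force
        then have "f 0 \<le> f j \<and> (0 < j \<longrightarrow> f 0 < f j)" using up[of 0 j] before[of _ l] by fastforce
        \<comment> \<open>For \<open>j = 0\<close> no increment precedes \<open>j\<close>, and
          strictness comes from the rise between \<open>Suc i\<close> and \<open>k\<close>, which is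
          nonempty because \<open>j\<close> is not the successor of \<open>i\<close>.\<close>
        then show ?thesis using f0 j succ i by (cases "j = 0") (auto split: if_splits)
      qed
    qed
  qed
  then show ?thesis by (simp add: f_def orient_def d_def)
qed

lemma collinear_iff_orient: "collinear {a, b, c} \<longleftrightarrow> orient a b c = 0"
proof -
  have "collinear {a, b, c} \<longleftrightarrow> collinear {0, b - a, c - a}"
    using collinear_3[of b a c] by (simp add: insert_commute)
  also have "\<dots> \<longleftrightarrow> cross (b - a) (c - a) = 0"
  proof -
    obtain x1 y1 x2 y2 where e: "b - a = (x1, y1)" "c - a = (x2, y2)" by fastforce
    show ?thesis
    proof
      assume "collinear {0, b - a, c - a}"
      then show "cross (b - a) (c - a) = 0"
        unfolding collinear_lemma e by (auto simp: cross_def zero_prod_def)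
    next
      assume c: "cross (b - a) (c - a) = 0"
      show "collinear {0, b - a, c - a}"
      proof (cases "x1 = 0")
        case False
        then have "c - a = (x2 / x1) *\<^sub>R (b - a)"
          using c by (simp add: e cross_def field_simps)
        then show ?thesis by (metis collinear_lemma)
      next
        case x: True
        show ?thesis
        proof (cases "y1 = 0")
          case True
          then show ?thesis using x e by (simp add: collinear_lemma zero_prod_def)
        next
          case False
          then have "c - a = (y2 / y1) *\<^sub>R (b - a)"
            using c x by (simp add: e cross_def field_simps)
          then show ?thesis by (metis collinear_lemma)
        qed
      qed
    qed
  qed
  finally show ?thesis by (simp add: orient_def)
qed

text \<open>All vertices are compared with each edge, not just the next one: a pentagram turns left
  at every corner but fails this test.\<close>

definition ccw :: "point list \<Rightarrow> bool" where
  "ccw vs \<longleftrightarrow> (\<forall>i<length vs. \<forall>j<length vs. j \<noteq> i \<longrightarrow> j \<noteq> Suc i mod length vs \<longrightarrow>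
     0 < orient (vs ! i) (vs ! (Suc i mod length vs)) (vs ! j))"

text \<open>The only place where the angle could drop along a counterclockwise polygon is a local
  minimum in the lexicographic order, and the polygon has only one of those.\<close>

lemma ccw_sorted:
  assumes ccw: "ccw vs" and k: "length vs \<ge> 3" and dist: "distinct vs"
    and low: "\<And>j. 0 < j \<Longrightarrow> j < length vs \<Longrightarrow> upper (vs ! j - vs ! 0)"
    and i: "Suc i < length vs"
  shows "ang (vs ! Suc i - vs ! i) < ang (vs ! (Suc (Suc i) mod length vs) - vs ! Suc i)"
proof -
  let ?k = "length vs"
  define c where "c = Suc (Suc i) mod ?k"
  have c: "c = (if Suc (Suc i) = ?k then 0 else Suc (Suc i))" "c < ?k"
    using i k unfolding c_def by (cases "Suc (Suc i) = length vs"; force)+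
  define a where "a = vs ! Suc i - vs ! i"
  define b where "b = vs ! c - vs ! Suc i"
  have ci: "c \<noteq> i" "c \<noteq> Suc i" using c i k by auto
  have k0: "0 < ?k" using k by linarith
  have a0: "a \<noteq> 0" unfolding a_def using dist i by (simp add: nth_eq_iff_index_eq)
  have b0: "b \<noteq> 0" unfolding b_def using dist i c ci by (simp add: nth_eq_iff_index_eq)
  have left: "0 < orient (vs ! i) (vs ! Suc i) (vs ! j)" if "j < ?k" "j \<noteq> i" "j \<noteq> Suc i" for j
    using ccw[unfolded ccw_def, rule_format, of i j] that i by simp
  have left': "0 < orient (vs ! Suc i) (vs ! c) (vs ! j)" if "j < ?k" "j \<noteq> Suc i" "j \<noteq> c" for j
    using ccw[unfolded ccw_def, rule_format, of "Suc i" j] that i by (simp add: c_def)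
  have ab: "0 < cross a b"
    using left[of c] c ci unfolding a_def b_def orient_def by (simp add: cross_def algebra_simps)
  have "\<not> (\<not> upper a \<and> upper b)"
  proof
    \<comment> \<open>With \<open>w\<close> pointing from the lowest vertex to the corner, the
      vectors \<open>- a\<close>, \<open>w\<close>, \<open>b\<close> all lie in the upper
      half-plane, and orientations give the cycle
      \<open>ang (- a) < ang w < ang b < ang (- a)\<close>.\<close>
    assume lu: "\<not> upper a \<and> upper b"
    have ua: "upper (- a)" using lu a0 upper_uminus by auto
    define w where "w = vs ! Suc i - vs ! 0"
    have uw: "upper w" using low[of "Suc i"] i by (simp add: w_def)
    have i0: "i \<noteq> 0"
    proof
      assume "i = 0"
      then have "upper a" using low[of 1] i by (simp add: a_def)
      then show False using lu by simp
    qed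
    have c0: "c \<noteq> 0"
    proof
      assume "c = 0"
      then have "b = - w" by (simp add: b_def w_def)
      moreover have "w \<noteq> 0" using uw by (auto simp: upper_def)
      ultimately show False using uw lu upper_uminus by auto
    qed
    have "0 < cross (- a) w"
      using left[of 0] k0 i0 unfolding a_def w_def orient_def by (simp add: cross_def algebra_simps)
    then have 1: "ang (- a) < ang w" using ang_less_upper[OF ua uw] by simp
    have "0 < cross w b"
      using left'[of 0] k0 c0 unfolding b_def w_def orient_def by (simp add: cross_def algebra_simps)
    then have 2: "ang w < ang b" using ang_less_upper[OF uw] lu by simp
    have "0 < cross b (- a)" using ab cross_swap[of a b] by (simp add: cross_simps)
    then have "ang b < ang (- a)" using ang_less_upper ua lu by simp
    then show False using 1 2 by simp
  qed
  then have "ang a < ang b"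
    using ang_less_mixed[of a b] ang_less_upper[of a b] ang_less_lower[of a b] a0 b0 ab by blast
  then show ?thesis by (simp add: a_def b_def c_def)
qed

section \<open>Convex cycles\<close>

lemma cycle_edges_conv: "cycle_edges vs = (\<lambda>i. {vs ! i, vs ! (Suc i mod length vs)}) ` {..<length vs}"
  by (auto simp: cycle_edges_def)

section \<open>The Jordan curve theorem for pairs of reals\<close>

lemma connected_component_set_inj_image:
  fixes h :: "'a::topological_space \<Rightarrow> 'b::topological_space"
  assumes "continuous_on UNIV h" "continuous_on UNIV g" "\<And>x. g (h x) = x" "\<And>y. h (g y) = y"
  shows "connected_component_set (- h ` S) (h x) = h ` connected_component_set (- S) x"
proof
  \<comment> \<open>Stated for any map with an inverse, so that it also applies to \<open>g\<close>,
    which gives the other inclusion.\<close>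
  have *: "h ` connected_component_set (- T) x \<subseteq> connected_component_set (- h ` T) (h x)"
    if "continuous_on UNIV h" "\<And>x. g (h x) = x" "\<And>y. h (g y) = y"
    for h :: "'c::topological_space \<Rightarrow> 'd::topological_space" and g T x
  proof
    fix y assume "y \<in> h ` connected_component_set (- T) x"
    then obtain z U where U: "y = h z" "connected U" "U \<subseteq> - T" "x \<in> U" "z \<in> U"
      by (auto simp: connected_component_def)
    have "inj h" using that by (metis injI)
    then have "h ` U \<subseteq> - h ` T" using U by (auto simp: inj_image_mem_iff inj_eq)
    moreover have "connected (h ` U)"
      using U that(1) connected_continuous_image continuous_on_subset by blast
    ultimately show "y \<in> connected_component_set (- h ` T) (h x)"
      using U by (auto simp: connected_component_def)
  qed
  show "h ` connected_component_set (- S) x \<subseteq> connected_component_set (- h ` S) (h x)"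
    using assms by (intro *)
  have "g ` connected_component_set (- h ` S) (h x) \<subseteq> connected_component_set (- g ` h ` S) (g (h x))"
    using assms by (intro *)
  then have "h ` g ` connected_component_set (- h ` S) (h x) \<subseteq> h ` connected_component_set (- S) x"
    using assms(3) by (intro image_mono) (simp add: image_image)
  then show "connected_component_set (- h ` S) (h x) \<subseteq> h ` connected_component_set (- S) x"
    using assms(4) by (simp add: image_image)
qed

text \<open>\<open>Jordan_inside_outside\<close> speaks of curves in the complex plane; the linear
  bijection \<open>h\<close> carries boundedness, insides and frontiers over.\<close>

lemma Jordan_inside_prod:
  fixes c :: "real \<Rightarrow> point"
  assumes "simple_path c" "pathfinish c = pathstart c"
  shows "inside (path_image c) \<noteq> {}" "frontier (inside (path_image c)) = path_image c"
proof -
  define h where "h = (\<lambda>p::point. Complex (fst p) (snd p))"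
  define g where "g = (\<lambda>z. (Re z, Im z))"
  have hg: "h (g z) = z" and gh: "g (h p) = p" for z p by (simp_all add: h_def g_def)
  have lin: "linear h" "linear g"
    by (auto intro!: linearI simp: h_def g_def complex_eq_iff)
  have cont: "continuous_on UNIV h" "continuous_on UNIV g"
    using lin linear_continuous_on linear_conv_bounded_linear by blast+
  have inj: "inj h" by (metis gh injI)
  have bij: "bij h" by (metis gh hg bijI')
  have bdd: "bounded (h ` X) \<longleftrightarrow> bounded X" for X
  proof
    assume "bounded (h ` X)"
    then have "bounded (g ` h ` X)" using lin bounded_linear_image linear_conv_bounded_linear by blast
    then show "bounded X" by (simp add: image_image gh)
  qed (use lin bounded_linear_image linear_conv_bounded_linear in blast)
  have "inside (h ` S) = h ` inside S" for S
  proof -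
    have "h x \<in> inside (h ` S) \<longleftrightarrow> x \<in> inside S" for x
      unfolding inside_def
      using connected_component_set_inj_image[OF cont gh hg, of S x] inj
      by (simp add: bdd inj_image_mem_iff)
    then have "y \<in> inside (h ` S) \<longleftrightarrow> y \<in> h ` inside S" for y
      using inj_image_mem_iff[OF inj, of "g y" "inside S"] by (metis hg)
    then show ?thesis by blast
  qed
  note inside = this
  have J: "inside (path_image (h \<circ> c)) \<noteq> {}"
    "frontier (inside (path_image (h \<circ> c))) = path_image (h \<circ> c)"
    using Jordan_inside_outside[of "h \<circ> c"] assms
      simple_path_linear_image_eq[OF lin(1) inj] by (auto simp: pathstart_compose pathfinish_compose)
  show "inside (path_image c) \<noteq> {}"
    using J(1) by (simp add: path_image_compose inside)
  have fr: "frontier (h ` X) = h ` frontier X" for X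
    unfolding frontier_closures
    by (simp add: closure_injective_linear_image[OF lin(1) inj] bij_image_Compl_eq[OF bij, symmetric]
      image_Int[OF inj])
  show "frontier (inside (path_image c)) = path_image c"
    using J(2) by (simp add: path_image_compose inside fr inj_image_eq_iff[OF inj])
qed

section \<open>The boundary of a cycle as a simple closed curve\<close>

fun polyline :: "point list \<Rightarrow> real \<Rightarrow> point" where
  "polyline (a # b # c # r) = linepath a b +++ polyline (b # c # r)"
| "polyline [a, b] = linepath a b"
| "polyline [a] = linepath a a"
| "polyline [] = linepath 0 0"

lemma polyline_ends:
  "vs \<noteq> [] \<Longrightarrow> pathstart (polyline vs) = hd vs" "vs \<noteq> [] \<Longrightarrow> pathfinish (polyline vs) = last vs"
  by (induction vs rule: polyline.induct) auto

lemma path_image_polyline: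
  "length vs \<ge> 2 \<Longrightarrow> path_image (polyline vs) = (\<Union>i<length vs - 1. closed_segment (vs ! i) (vs ! Suc i))"
proof (induction vs rule: polyline.induct)
  case (1 a b c r)
  have "{..<length (a # b # c # r) - 1} = insert 0 (Suc ` {..<length (b # c # r) - 1})"
    by (simp add: lessThan_Suc_eq_insert_0)
  then have "(\<Union>i<length (a # b # c # r) - 1. closed_segment ((a # b # c # r) ! i) ((a # b # c # r) ! Suc i))
     = closed_segment a b \<union> (\<Union>i<length (b # c # r) - 1. closed_segment ((b # c # r) ! i) ((b # c # r) ! Suc i))"
    by simp
  then show ?case using 1 by (simp add: path_image_join polyline_ends)
qed auto

lemma pslg_inter:
  assumes "pslg V E" "{a, b} \<in> E" "{c, d} \<in> E" "{a, b} \<noteq> {c, d}"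
  shows "closed_segment a b \<inter> closed_segment c d \<subseteq> {a, b} \<inter> {c, d}"
proof -
  have "\<forall>e\<in>E. \<forall>f\<in>E. e \<noteq> f \<longrightarrow> convex hull e \<inter> convex hull f \<subseteq> e \<inter> f"
    using assms(1) by (simp add: pslg_def)
  from this[rule_format, OF assms(2-4)] show ?thesis by (simp only: segment_convex_hull)
qed

lemma arc_polyline:
  assumes "pslg V E" "length vs \<ge> 2" "distinct vs"
    "\<And>i. Suc i < length vs \<Longrightarrow> {vs ! i, vs ! Suc i} \<in> E"
  shows "arc (polyline vs)"
  using assms(2-)
proof (induction vs rule: polyline.induct)
  case (1 a b c r)
  let ?vs = "b # c # r"
  have E: "{?vs ! i, ?vs ! Suc i} \<in> E" if "Suc i < length ?vs" for i
    using 1(4)[of "Suc i"] that by simp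
  have ab: "{a, b} \<in> E" using 1(4)[of 0] by simp
  have arc: "arc (polyline ?vs)" using 1 E by simp
  \<comment> \<open>No later edge has the endpoint \<open>a\<close>, so each is a different edge
    from \<open>{a, b}\<close> and can share only \<open>b\<close> with it.\<close>
  have "closed_segment a b \<inter> closed_segment (?vs ! i) (?vs ! Suc i) \<subseteq> {b}" if "Suc i < length ?vs" for i
  proof -
    have "?vs ! i \<in> set ?vs" "?vs ! Suc i \<in> set ?vs" using that nth_mem by (metis Suc_lessD, blast)
    then have "a \<noteq> ?vs ! i" "a \<noteq> ?vs ! Suc i" using 1(3) by auto
    then show ?thesis
      using pslg_inter[OF assms(1) ab E[OF that]] by blast
  qed
  then have "path_image (linepath a b) \<inter> path_image (polyline ?vs) \<subseteq> {b}"
    using path_image_polyline[of ?vs] by auto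
  then show ?case using arc 1(3) by (auto intro!: arc_join simp: polyline_ends)
qed auto

definition boundary :: "point list \<Rightarrow> point set" where
  "boundary vs = (\<Union>e\<in>cycle_edges vs. convex hull e)"

lemma boundary_conv:
  "boundary vs = (\<Union>i<length vs. closed_segment (vs ! i) (vs ! (Suc i mod length vs)))"
  by (simp add: boundary_def cycle_edges_conv segment_convex_hull)

lemma cycle_in_edge: "cycle_in E vs \<Longrightarrow> i < length vs \<Longrightarrow> {vs ! i, vs ! (Suc i mod length vs)} \<in> E"
  by (auto simp: cycle_in_def cycle_edges_def)

lemma boundary_simple_path:
  assumes "pslg V E" "cycle_in E vs"
  obtains c where "simple_path c" "pathfinish c = pathstart c" "path_image c = boundary vs"
proof -
  let ?k = "length vs"
  have k: "?k \<ge> 3" and dist: "distinct vs" using assms by (auto simp: cycle_in_def)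
  have ne: "vs \<noteq> []" using k by auto
  have hl: "hd vs = vs ! 0" "last vs = vs ! (?k - 1)" using ne by (auto simp: hd_conv_nth last_conv_nth)
  have E: "{vs ! i, vs ! Suc i} \<in> E" if "Suc i < ?k" for i
    using cycle_in_edge[OF assms(2), of i] that by simp
  have El: "{last vs, hd vs} \<in> E"
    using cycle_in_edge[OF assms(2), of "?k - 1"] k hl ne by simp
  have arc: "arc (polyline vs)" using arc_polyline[OF assms(1) _ dist E] k by simp
  have neq: "last vs \<noteq> hd vs" using hl k ne dist by (simp add: nth_eq_iff_index_eq)
  have "closed_segment (vs ! i) (vs ! Suc i) \<inter> closed_segment (last vs) (hd vs) \<subseteq> {hd vs, last vs}"
    if "i < ?k - 1" for i
  proof -
    have i: "Suc i < ?k" using that by simp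
    \<comment> \<open>Here three vertices are needed: in a list of two, the closing edge would be
      the edge already drawn.\<close>
    have "{vs ! i, vs ! Suc i} \<noteq> {last vs, hd vs}"
      unfolding hl using i k dist ne by (auto simp: doubleton_eq_iff nth_eq_iff_index_eq)
    then show ?thesis using pslg_inter[OF assms(1) E[OF i] El] by blast
  qed
  then have "path_image (polyline vs) \<inter> path_image (linepath (last vs) (hd vs)) \<subseteq> {hd vs, last vs}"
    using path_image_polyline[of vs] k by (auto simp del: One_nat_def)
  then have "simple_path (polyline vs +++ linepath (last vs) (hd vs))"
    using arc neq ne by (intro simple_path_join_loop) (auto simp: polyline_ends)
  moreover have "path_image (polyline vs +++ linepath (last vs) (hd vs)) = boundary vs"
  proof -
    have "{..<?k} = insert (?k - 1) {..<?k - 1}" using k by auto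
    then have "boundary vs = closed_segment (vs ! (?k - 1)) (vs ! (Suc (?k - 1) mod ?k)) \<union>
        (\<Union>i<?k - 1. closed_segment (vs ! i) (vs ! (Suc i mod ?k)))"
      unfolding boundary_conv by simp
    also have "\<dots> = closed_segment (last vs) (hd vs) \<union> path_image (polyline vs)"
      using k ne by (simp add: path_image_polyline hl)
    finally show ?thesis using ne by (simp add: path_image_join polyline_ends Un_commute)
  qed
  ultimately show ?thesis using that ne by (simp add: polyline_ends)
qed

text \<open>The interior of the hull is connected and avoids \<open>S\<close>, hence lies in one
  component of the complement. The open set \<open>inside S\<close> is contained in it, so that
  component is bounded and the two sets coincide.\<close>

lemma convex_inside_if_supporting:
  assumes ne: "inside S \<noteq> {}" and cl: "closed S" and disj: "interior (convex hull S) \<inter> S = {}"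
  shows "convex (inside (S :: point set))"
proof -
  let ?H = "convex hull S"
  have sub: "inside S \<subseteq> ?H"
    using outside_subset_convex[of ?H S] hull_subset[of S convex] inside_Int_outside[of S]
      convex_convex_hull[of S] by blast
  have "open (inside S)" using cl by (rule open_inside)
  then have sub': "inside S \<subseteq> interior ?H" using sub by (simp add: interior_maximal)
  moreover have "interior ?H \<subseteq> inside S"
  proof
    fix y assume y: "y \<in> interior ?H"
    obtain x where x: "x \<in> inside S" using ne by auto
    have "connected (interior ?H)" by (simp add: convex_connected)
    moreover have "interior ?H \<subseteq> - S" using disj by auto
    ultimately have "connected_component (- S) x y"
      unfolding connected_component_def using x y sub' by blast
    then show "y \<in> inside S" using x by (rule inside_same_component)
  qed
  ultimately show ?thesis by (metis convex_convex_hull convex_interior subset_antisym)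
qed

lemma convex_orient: "convex {x. 0 \<le> orient a b x}" "convex {x. orient a b x = 0}"
  unfolding orient_def cross_def convex_alt
  subgoal
  proof (clarsimp, goal_cases)
    case (1 a1 b1 a2 b2 u)
    have "0 \<le> (1 - u) * ((fst b - fst a) * (b1 - snd a) - (snd b - snd a) * (a1 - fst a)) +
       u * ((fst b - fst a) * (b2 - snd a) - (snd b - snd a) * (a2 - fst a))"
      using 1 by (intro add_nonneg_nonneg mult_nonneg_nonneg) auto
    then show ?case by (simp add: algebra_simps)
  qed
  subgoal
  proof (clarsimp, goal_cases)
    case (1 a1 b1 a2 b2 u)
    have "(1 - u) * ((fst b - fst a) * (b1 - snd a) - (snd b - snd a) * (a1 - fst a)) +
       u * ((fst b - fst a) * (b2 - snd a) - (snd b - snd a) * (a2 - fst a)) = 0"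
      using 1 by simp
    then show ?case by (simp add: algebra_simps)
  qed
  done

lemma convex_inside_if_ccw:
  assumes "pslg V E" "cycle_in E vs" "ccw vs"
  shows "convex (inside (boundary vs))"
proof -
  let ?k = "length vs"
  obtain c where c: "simple_path c" "pathfinish c = pathstart c" "path_image c = boundary vs"
    using boundary_simple_path assms by blast
  have k: "?k \<ge> 3" and dist: "distinct vs" using assms by (auto simp: cycle_in_def)
  have cl: "closed (boundary vs)"
    using c closed_path_image simple_path_imp_path by metis
  have ne: "inside (boundary vs) \<noteq> {}" using Jordan_inside_prod(1)[OF c(1,2)] c(3) by simp
  have "interior (convex hull (boundary vs)) \<inter> boundary vs = {}"
  proof (rule ccontr)
    assume "interior (convex hull boundary vs) \<inter> boundary vs \<noteq> {}"
    then obtain z i where z: "z \<in> interior (convex hull boundary vs)" and i: "i < ?k"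
      and zi: "z \<in> closed_segment (vs ! i) (vs ! (Suc i mod ?k))" by (auto simp: boundary_conv)
    define a where "a = vs ! i"
    define b where "b = vs ! (Suc i mod ?k)"
    have i': "Suc i mod ?k < ?k" "Suc i mod ?k \<noteq> i" using i k by (cases "Suc i = ?k"; force)+
    have ab: "a \<noteq> b" using i i' dist by (simp add: a_def b_def nth_eq_iff_index_eq)
    have pos: "0 \<le> orient a b (vs ! j)" if "j < ?k" for j
    proof (cases "j = i \<or> j = Suc i mod ?k")
      case True
      then show ?thesis by (auto simp: a_def b_def)
    next
      case False
      then have "0 < orient (vs ! i) (vs ! (Suc i mod ?k)) (vs ! j)"
        using assms(3) i that unfolding ccw_def by blast
      then show ?thesis by (simp add: a_def b_def)
    qed
    have "boundary vs \<subseteq> {x. 0 \<le> orient a b x}"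
      unfolding boundary_conv
    proof (rule UN_least)
      fix j assume "j \<in> {..<?k}"
      then have "j < ?k" "Suc j mod ?k < ?k" using k by (simp, intro mod_less_divisor) linarith
      then show "closed_segment (vs ! j) (vs ! (Suc j mod ?k)) \<subseteq> {x. 0 \<le> orient a b x}"
        using pos convex_orient(1) by (intro closed_segment_subset) auto
    qed
    then have H: "convex hull (boundary vs) \<subseteq> {x. 0 \<le> orient a b x}"
      using convex_orient(1) by (rule hull_minimal)
    have z0: "orient a b z = 0"
      using zi closed_segment_subset[of a "{x. orient a b x = 0}" b] convex_orient(2)[of a b]
      by (auto simp: a_def b_def)
    obtain e where e: "e > 0" "ball z e \<subseteq> convex hull (boundary vs)"
      using z unfolding mem_interior by blast
    \<comment> \<open>The normal pointing to the right of the edge. A step of length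
      \<open>e / 2\<close> along it stays in the ball but leaves the half-plane that contains the
      hull.\<close>
    define n where "n = (snd (b - a), - fst (b - a))"
    have n0: "n \<noteq> 0" using ab by (cases a; cases b) (auto simp: n_def zero_prod_def)
    define t where "t = e / (2 * norm n)"
    have t: "t > 0" using e n0 by (simp add: t_def)
    define y where "y = z + t *\<^sub>R n"
    have "y \<in> ball z e" using e n0 by (simp add: y_def dist_norm t_def)
    then have "0 \<le> orient a b y" using e H by auto
    moreover have "orient a b y = - t * ((snd (b - a))\<^sup>2 + (fst (b - a))\<^sup>2)"
      using z0 by (simp add: y_def n_def orient_def cross_def algebra_simps power2_eq_square)
    moreover have "(snd (b - a))\<^sup>2 + (fst (b - a))\<^sup>2 > 0"
      using n0 by (auto simp: n_def zero_prod_def sum_power2_gt_zero_iff)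
    ultimately have "orient a b y < 0" using t by (simp add: mult_neg_pos)
    then show False using \<open>0 \<le> orient a b y\<close> by simp
  qed
  then show ?thesis by (rule convex_inside_if_supporting[OF ne cl])
qed

text \<open>The vectors orthogonal to \<open>b - a\<close> form a line, so the functional of
  \<open>w\<close> is proportional to the orientation. The sign of \<open>\<mu>\<close> is left
  open, since a supporting line has no preferred side.\<close>

lemma orient_halfplane:
  assumes "a \<noteq> b" "w \<bullet> (b - a) = 0" "w \<noteq> (0::point)"
  obtains \<mu> where "\<mu> \<noteq> 0" "\<And>q. w \<bullet> (q - a) = \<mu> * orient a b q"
proof -
  define d where "d = b - a"
  define D where "D = (fst d)\<^sup>2 + (snd d)\<^sup>2"
  have D: "D > 0" using assms(1) unfolding D_def d_def
    by (cases a; cases b) (auto simp: sum_power2_gt_zero_iff)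
  have wd: "fst w * fst d + snd w * snd d = 0" using assms(2) by (simp add: inner_prod_def d_def)
  define \<nu> where "\<nu> = snd w * fst d - fst w * snd d"
  have "D * fst w = - \<nu> * snd d" "D * snd w = \<nu> * fst d"
    using wd unfolding D_def \<nu>_def by algebra+
  then have w: "fst w = - (\<nu> / D) * snd d" "snd w = (\<nu> / D) * fst d"
    using D by (simp_all add: field_simps)
  show ?thesis
  proof
    show "\<nu> / D \<noteq> 0" using w assms(3) by (auto simp: prod_eq_iff)
    show "w \<bullet> (q - a) = (\<nu> / D) * orient a b q" for q
      using D by (simp add: inner_prod_def w orient_def cross_def d_def[symmetric] field_simps)
  qed
qed

text \<open>Edge \<open>i\<close> of a reversed cycle is the edge with index
  \<open>k - 1 - Suc i mod k\<close> of the original one, traversed backwards.\<close>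

lemma cycle_index_rev:
  assumes "i < k" shows "k - 1 - Suc i mod k < k" "Suc (k - 1 - Suc i mod k) mod k = k - 1 - i"
  using assms by (cases "Suc i = k"; simp)+

text \<open>Supporting lines give a side for each edge separately; that the side never changes needs
  a further argument. If it is the right side throughout, the reversed list is
  counterclockwise.\<close>

lemma ccw_or_rev_if_convex:
  assumes G: "pslg V E" "no_three_collinear V" and cyc: "cycle_in E vs"
    and conv: "convex (inside (boundary vs))"
  shows "ccw vs \<or> ccw (rev vs)"
proof -
  let ?k = "length vs" and ?I = "inside (boundary vs)"
  let ?n = "\<lambda>i. Suc i mod ?k"
  obtain c where c: "simple_path c" "pathfinish c = pathstart c" "path_image c = boundary vs"
    using boundary_simple_path G cyc by blast
  have k: "?k \<ge> 3" and dist: "distinct vs" using cyc by (auto simp: cycle_in_def)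
  have ni: "?n i < ?k" "?n i \<noteq> i" if "i < ?k" for i using that k by (cases "Suc i = ?k"; force)+
  have "closed (boundary vs)" using c closed_path_image simple_path_imp_path by metis
  then have op: "open ?I" by (rule open_inside)
  have ne: "?I \<noteq> {}" and fr: "frontier ?I = boundary vs" using Jordan_inside_prod[OF c(1,2)] c(3) by auto
  have V: "vs ! i \<in> V" if "i < ?k" for i
    using cycle_in_edge[OF cyc that] G by (auto simp: pslg_def)
  have nc: "orient (vs ! i) (vs ! ?n i) (vs ! j) \<noteq> 0" if "i < ?k" "j < ?k" "j \<noteq> i" "j \<noteq> ?n i" for i j
  proof -
    have "distinct [vs ! i, vs ! ?n i, vs ! j]"
      using that ni[of i] dist by (simp add: nth_eq_iff_index_eq)
    then show ?thesis
      using G(2) V that ni[of i] collinear_iff_orient unfolding no_three_collinear_def by metis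
  qed
  define pos where "pos s i \<longleftrightarrow> (\<forall>j<?k. j \<noteq> i \<longrightarrow> j \<noteq> ?n i \<longrightarrow> 0 < s * orient (vs ! i) (vs ! ?n i) (vs ! j))"
    for s :: real and i
  have one_side: "pos 1 i \<or> pos (-1) i" if i: "i < ?k" for i
  proof -
    define a where "a = vs ! i"
    define b where "b = vs ! ?n i"
    define m where "m = midpoint a b"
    have ab: "a \<noteq> b" using i ni[OF i] dist by (simp add: a_def b_def nth_eq_iff_index_eq)
    have "m \<in> closed_segment a b" by (simp add: m_def midpoint_in_closed_segment)
    then have "m \<in> boundary vs" using i unfolding boundary_conv a_def b_def by auto
    then have "m \<notin> ?I" using op fr by (metis DiffE frontier_def interior_open)
    then obtain w \<beta> where w: "w \<noteq> 0" "w \<bullet> m \<le> \<beta>" "\<And>x. x \<in> ?I \<Longrightarrow> \<beta> \<le> w \<bullet> x"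
      using separating_hyperplane_sets[of "{m}" ?I] conv ne by auto
    have "closure ?I \<subseteq> {x. w \<bullet> m \<le> w \<bullet> x}"
      using w by (intro closure_minimal closed_halfspace_ge[of "w \<bullet> m" w, unfolded]) force+
    then have bd: "w \<bullet> m \<le> w \<bullet> x" if "x \<in> boundary vs" for x
      using that fr by (auto simp: frontier_def)
    have vb: "vs ! j \<in> boundary vs" if "j < ?k" for j
      using that unfolding boundary_conv by auto
    \<comment> \<open>The functional is minimal at \<open>m\<close>, the mean of both ends, so it is
      constant along the edge: the supporting line at the midpoint must be the line of the
      edge.\<close>
    have "w \<bullet> m \<le> w \<bullet> a" "w \<bullet> m \<le> w \<bullet> b" using bd vb i ni by (simp_all add: a_def b_def)
    moreover have "2 * (w \<bullet> m) = w \<bullet> a + w \<bullet> b"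
      by (simp add: m_def midpoint_def inner_right_distrib)
    ultimately have e: "w \<bullet> a = w \<bullet> m" "w \<bullet> b = w \<bullet> m" by linarith+
    obtain \<mu> where \<mu>: "\<mu> \<noteq> 0" "\<And>q. w \<bullet> (q - a) = \<mu> * orient a b q"
      using orient_halfplane[OF ab _ w(1)] e by (auto simp: inner_diff_right)
    have ge: "0 \<le> \<mu> * orient a b (vs ! j)" if "j < ?k" for j
      using \<mu>(2)[of "vs ! j"] bd[OF vb[OF that]] e by (simp add: inner_diff_right)
    have "0 < sgn \<mu> * orient a b (vs ! j)" if "j < ?k" "j \<noteq> i" "j \<noteq> ?n i" for j
    proof -
      have "orient a b (vs ! j) \<noteq> 0" using nc[OF i] that by (simp add: a_def b_def)
      then show ?thesis using ge[OF that(1)] \<mu>(1)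
        by (auto simp: sgn_if zero_le_mult_iff)
    qed
    then have "pos (sgn \<mu>) i" by (simp add: pos_def a_def b_def)
    then show ?thesis using \<mu>(1) by (auto simp: sgn_if split: if_splits)
  qed
  \<comment> \<open>The triangle of three consecutive vertices tests both edges at its middle
    vertex, and its orientation is invariant under rotation.\<close>
  have next_side: "pos s (Suc i)" if "s = 1 \<or> s = -1" "pos s i" "Suc i < ?k" for s i
  proof -
    let ?l = "?n (Suc i)"
    have l: "?l < ?k" "?l \<noteq> i" "?l \<noteq> Suc i" using that(3) k by (cases "Suc (Suc i) = ?k"; force)+
    have "0 < s * orient (vs ! i) (vs ! Suc i) (vs ! ?l)"
      using that l unfolding pos_def by auto
    then have 0: "0 < s * orient (vs ! Suc i) (vs ! ?l) (vs ! i)" by (simp add: orient_rotate)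
    have "\<not> pos (- s) (Suc i)"
    proof
      assume "pos (- s) (Suc i)"
      then have "0 < - s * orient (vs ! Suc i) (vs ! ?l) (vs ! i)"
        using l(2) that(3) unfolding pos_def by auto
      then show False using 0 by simp
    qed
    then show ?thesis using one_side[OF that(3)] that(1) by auto
  qed
  have all: "pos s i" if "s = 1 \<or> s = -1" "pos s 0" "i < ?k" for s i
    using that(3) by (induction i) (use that next_side in auto)
  have "0 < ?k" using k by linarith
  then consider "pos 1 0" | "pos (-1) 0" using one_side by blast
  then show ?thesis
  proof cases
    case 1
    then show ?thesis using all[of 1] unfolding ccw_def pos_def by auto
  next
    case 2
    have "ccw (rev vs)"
      unfolding ccw_def length_rev
    proof (intro allI impI)
      fix i j assume ij: "i < ?k" "j < ?k" "j \<noteq> i" "j \<noteq> ?n i"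
      let ?l = "?k - 1 - ?n i" and ?j = "?k - 1 - j"
      have l: "?l < ?k" "?n ?l = ?k - 1 - i" using cycle_index_rev[OF ij(1)] by auto
      have "?j < ?k" "?j \<noteq> ?l" "?j \<noteq> ?k - 1 - i" using ij ni[of i] by auto
      then have "orient (vs ! ?l) (vs ! (?k - 1 - i)) (vs ! ?j) < 0"
        using all[OF _ 2 l(1)] l unfolding pos_def by auto
      then show "0 < orient (rev vs ! i) (rev vs ! ?n i) (rev vs ! j)"
        using ij ni[of i] orient_swap[of "vs ! ?l" "vs ! (?k - 1 - i)"] by (simp add: rev_nth)
    qed
    then show ?thesis by simp
  qed
qed

section \<open>Reversal and rotation of cycles\<close>

lemma cycle_edges_rev: "cycle_edges (rev vs) = cycle_edges vs"
proof -
  have "cycle_edges (rev vs) \<subseteq> cycle_edges vs" for vs :: "point list"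
  proof
    fix e assume "e \<in> cycle_edges (rev vs)"
    then obtain i where i: "i < length vs" "e = {rev vs ! i, rev vs ! (Suc i mod length vs)}"
      by (auto simp: cycle_edges_def)
    let ?k = "length vs" let ?l = "?k - 1 - Suc i mod ?k"
    have l: "?l < ?k" "Suc ?l mod ?k = ?k - 1 - i" using cycle_index_rev[OF i(1)] by auto
    have "Suc i mod ?k < ?k" using i(1) by (intro mod_less_divisor) linarith
    then have "e = {vs ! ?l, vs ! (Suc ?l mod ?k)}"
      unfolding l(2) using i by (simp add: rev_nth insert_commute)
    then show "e \<in> cycle_edges vs" using l(1) by (auto simp: cycle_edges_def)
  qed
  from this[of vs] this[of "rev vs"] show ?thesis by auto
qed

lemma nth_rotate_Suc_mod:
  assumes "i < length vs"
  shows "rotate m vs ! (Suc i mod length vs) = vs ! (Suc ((m + i) mod length vs) mod length vs)"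
proof -
  have "Suc i mod length vs < length vs" using assms by (intro mod_less_divisor) linarith
  then show ?thesis by (simp add: nth_rotate mod_simps)
qed

lemma cycle_edges_rotate: "cycle_edges (rotate m vs) = cycle_edges vs"
proof -
  have sub: "cycle_edges (rotate m vs) \<subseteq> cycle_edges vs" for m and vs :: "point list"
  proof
    fix e assume "e \<in> cycle_edges (rotate m vs)"
    then obtain i where i: "i < length vs" "e = {rotate m vs ! i, rotate m vs ! (Suc i mod length vs)}"
      by (auto simp: cycle_edges_def)
    then have "e = {vs ! ((m + i) mod length vs), vs ! (Suc ((m + i) mod length vs) mod length vs)}"
      by (simp only: nth_rotate_Suc_mod nth_rotate)
    moreover have "(m + i) mod length vs < length vs" using i(1) by (intro mod_less_divisor) linarith
    ultimately show "e \<in> cycle_edges vs" by (auto simp: cycle_edges_def)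
  qed
  show ?thesis
  proof (cases "vs = []")
    case False
    have "m mod length vs < length vs" using False by simp
    then have "length vs - m mod length vs + m = length vs + m div length vs * length vs"
      using div_mult_mod_eq[of m "length vs"] by linarith
    then have "rotate (length vs - m mod length vs) (rotate m vs) = vs"
      unfolding rotate_rotate by (intro rotate_id) simp
    then show ?thesis using sub[of m vs] sub[of "length vs - m mod length vs" "rotate m vs"] by auto
  qed simp
qed

lemma ccw_rotate:
  assumes "ccw vs" "distinct vs" shows "ccw (rotate m vs)"
  unfolding ccw_def length_rotate
proof (intro allI impI)
  let ?k = "length vs"
  fix i j assume ij: "i < ?k" "j < ?k" "j \<noteq> i" "j \<noteq> Suc i mod ?k"
  have s: "Suc i mod ?k < ?k" using ij by (intro mod_less_divisor) linarith
  let ?i = "(m + i) mod ?k" and ?j = "(m + j) mod ?k"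
  have lt: "?i < ?k" "?j < ?k" using ij by (auto intro!: mod_less_divisor)
  have "rotate m vs ! j \<noteq> rotate m vs ! i" "rotate m vs ! j \<noteq> rotate m vs ! (Suc i mod ?k)"
    using ij s assms(2) by (simp_all add: nth_eq_iff_index_eq)
  then have "?j \<noteq> ?i" "?j \<noteq> Suc ?i mod ?k"
    using ij by (auto simp only: nth_rotate nth_rotate_Suc_mod)
  then have "0 < orient (vs ! ?i) (vs ! (Suc ?i mod ?k)) (vs ! ?j)"
    using assms(1) lt unfolding ccw_def by blast
  then show "0 < orient (rotate m vs ! i) (rotate m vs ! (Suc i mod ?k)) (rotate m vs ! j)"
    using ij by (simp only: nth_rotate nth_rotate_Suc_mod)
qed

text \<open>The last edge is not compared with the first one. Thus at most one rotation of a polygon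
  qualifies, the one that starts at its lowest vertex.\<close>

definition angle_sorted :: "point list \<Rightarrow> bool" where
  "angle_sorted vs \<longleftrightarrow> (\<forall>i j. i < j \<longrightarrow> j < length vs \<longrightarrow>
     ang (vs ! (Suc i mod length vs) - vs ! i) < ang (vs ! (Suc j mod length vs) - vs ! j))"

text \<open>Simplicity comes with convexity: two vertices are either joined by a nonzero edge, or
  one lies strictly to the left of an edge that starts at the other.\<close>

lemma angle_sorted_imp:
  assumes k: "length vs \<ge> 3" and s: "angle_sorted vs"
    and nz: "\<And>i. i < length vs \<Longrightarrow> vs ! i \<noteq> vs ! (Suc i mod length vs)"
  shows "ccw vs" "distinct vs"
proof -
  let ?k = "length vs"
  define p where "p j = vs ! (j mod ?k)" for j
  have pn: "p i = vs ! i" "p (Suc i) = vs ! (Suc i mod ?k)" if "i < ?k" for i using that by (auto simp: p_def)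
  have left: "0 < orient (p i) (p (Suc i)) (p j)" if "i < ?k" "j < ?k" "j \<noteq> i" "j \<noteq> Suc i mod ?k" for i j
  proof (rule sorted_closed_chain_left[of p ?k])
    show "p ?k = p 0" by (simp add: p_def)
    show "p (Suc j) - p j \<noteq> 0" if "j < ?k" for j using nz[OF that] pn[OF that] by simp
    show "ang (p (Suc i) - p i) < ang (p (Suc j) - p j)" if "i < j" "j < ?k" for i j
      using s that pn unfolding angle_sorted_def by simp
  qed (use that in auto)
  then show "ccw vs" by (simp add: ccw_def pn)
  show "distinct vs"
    unfolding distinct_conv_nth
  proof (intro allI impI)
    fix i j assume ij: "i < ?k" "j < ?k" "i \<noteq> j"
    show "vs ! i \<noteq> vs ! j"
    proof (cases "j = Suc i mod ?k")
      case True then show ?thesis using nz ij by simp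
    next
      case False then show ?thesis using left[of i j] ij pn by auto
    qed
  qed
qed

section \<open>The lowest vertex as starting point\<close>

lemma upper_total: "a \<noteq> b \<Longrightarrow> upper (b - a) \<or> upper (a - b)"
  using upper_uminus[of "b - a"] by auto

lemma upper_trans: "upper (b - a) \<Longrightarrow> upper (c - b) \<Longrightarrow> upper (c - a)"
  by (auto simp: upper_def)

lemma exists_lowest:
  assumes "finite S" "S \<noteq> {}"
  shows "\<exists>a\<in>S. \<forall>b\<in>S. b \<noteq> a \<longrightarrow> upper (b - a)"
  using assms
proof (induction rule: finite_ne_induct)
  case (insert x S)
  then obtain a where a: "a \<in> S" "\<forall>b\<in>S. b \<noteq> a \<longrightarrow> upper (b - a)" by auto
  have "x \<noteq> a" using a insert by auto
  then consider "upper (a - x)" | "upper (x - a)" using upper_total by blast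
  then show ?case
  proof cases
    case 1
    then have "upper (b - x)" if "b \<in> S" for b using a that upper_trans[of a x b] by (cases "b = a") auto
    then have "\<forall>b\<in>insert x S. b \<noteq> x \<longrightarrow> upper (b - x)" by blast
    then show ?thesis by blast
  qed (use a in auto)
qed simp

lemma angle_sorted_rotation:
  assumes "ccw vs" "distinct vs" "length vs \<ge> 3"
  shows "\<exists>m. angle_sorted (rotate m vs)"
proof -
  let ?k = "length vs"
  have "set vs \<noteq> {}" using assms by auto
  then obtain a where a: "a \<in> set vs" "\<forall>b\<in>set vs. b \<noteq> a \<longrightarrow> upper (b - a)"
    using exists_lowest[of "set vs"] by auto
  then obtain m where m: "m < ?k" "vs ! m = a" by (auto simp: in_set_conv_nth)
  define ws where "ws = rotate m vs"
  have ws: "ccw ws" "distinct ws" "length ws = ?k" "set ws = set vs"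
    using assms ccw_rotate by (auto simp: ws_def)
  have "0 < ?k" using assms(3) by linarith
  then have w0: "ws ! 0 = a" using m by (simp add: ws_def nth_rotate)
  have low: "upper (ws ! j - ws ! 0)" if "0 < j" "j < length ws" for j
  proof -
    have "ws ! j \<in> set vs" using that ws nth_mem by metis
    moreover have "ws ! j \<noteq> ws ! 0" using that ws(2) nth_eq_iff_index_eq[of ws j 0] \<open>0 < ?k\<close> ws(3) by simp
    ultimately show ?thesis using a w0 by auto
  qed
  have step: "ang (ws ! (Suc i mod ?k) - ws ! i) < ang (ws ! (Suc (Suc i) mod ?k) - ws ! Suc i)"
    if "Suc i < ?k" for i
    using ccw_sorted[of ws i] ws low assms(3) that by simp
  have "ang (ws ! (Suc i mod ?k) - ws ! i) < ang (ws ! (Suc j mod ?k) - ws ! j)" if "i < j" "j < ?k" for i j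
    using that
  proof (induction j)
    case (Suc j)
    then show ?case using step[of j] by (cases "i = j") force+
  qed simp
  then have "angle_sorted ws" unfolding angle_sorted_def using ws(3) by simp
  then show ?thesis unfolding ws_def by blast
qed

text \<open>From here on the topology is gone: a convex polygon is a cycle in sorted normal form,
  and only orders of directions matter.\<close>

lemma convex_polygons_iff:
  assumes "pslg V E" "no_three_collinear V"
  shows "P \<in> convex_polygons E \<longleftrightarrow> (\<exists>vs. cycle_in E vs \<and> angle_sorted vs \<and> P = cycle_edges vs)"
proof
  assume "P \<in> convex_polygons E"
  then obtain vs where vs: "cycle_in E vs" "P = cycle_edges vs" "convex (inside (boundary vs))"
    by (auto simp: convex_polygons_def boundary_def)
  obtain ws where ws: "cycle_in E ws" "P = cycle_edges ws" "ccw ws"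
  proof (cases "ccw vs")
    case False
    then have "ccw (rev vs)" using ccw_or_rev_if_convex assms vs by blast
    then show ?thesis using that[of "rev vs"] vs by (simp add: cycle_in_def cycle_edges_rev)
  qed (use that vs in blast)
  then obtain m where "angle_sorted (rotate m ws)"
    using angle_sorted_rotation by (auto simp: cycle_in_def)
  then show "\<exists>vs. cycle_in E vs \<and> angle_sorted vs \<and> P = cycle_edges vs"
    using ws by (intro exI[of _ "rotate m ws"]) (simp add: cycle_in_def cycle_edges_rotate)
next
  assume "\<exists>vs. cycle_in E vs \<and> angle_sorted vs \<and> P = cycle_edges vs"
  then obtain vs where vs: "cycle_in E vs" "angle_sorted vs" "P = cycle_edges vs" by blast
  let ?k = "length vs"
  have k: "?k \<ge> 3" "distinct vs" using vs by (auto simp: cycle_in_def)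
  have "vs ! i \<noteq> vs ! (Suc i mod ?k)" if "i < ?k" for i
  proof -
    have "Suc i mod ?k < ?k" "Suc i mod ?k \<noteq> i" using that k by (cases "Suc i = ?k"; force)+
    then show ?thesis using k that by (simp add: nth_eq_iff_index_eq)
  qed
  then have "ccw vs" using angle_sorted_imp vs k by blast
  then show "P \<in> convex_polygons E"
    using convex_inside_if_ccw[OF assms(1)] vs by (auto simp: convex_polygons_def boundary_def)
qed

section \<open>Directed edges of a cycle\<close>

definition arcs :: "point list \<Rightarrow> (point \<times> point) set" where
  "arcs vs = (\<lambda>i. (vs ! i, vs ! (Suc i mod length vs))) ` {..<length vs}"

lemma cycle_edges_arcs: "cycle_edges vs = (\<lambda>(a, b). {a, b}) ` arcs vs"
  by (auto simp: arcs_def cycle_edges_conv)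

lemma Union_cycle_edges: "\<Union> (cycle_edges vs) = set vs"
proof -
  have "Suc i mod length vs < length vs" if "i < length vs" for i
    using that by (intro mod_less_divisor) linarith
  then show ?thesis by (force simp: cycle_edges_conv in_set_conv_nth)
qed

text \<open>If an edge were traversed in opposite senses, a third common vertex would lie strictly
  to the left of both, which is impossible. So the undirected edges determine the directed
  ones.\<close>

lemma ccw_arcs_unique:
  assumes "ccw vs" "ccw ws" "length vs \<ge> 3" "distinct vs" "cycle_edges vs = cycle_edges ws"
  shows "arcs vs \<subseteq> arcs ws"
proof
  fix e assume "e \<in> arcs vs"
  let ?k = "length vs"
  obtain i where i: "i < ?k" "e = (vs ! i, vs ! (Suc i mod ?k))" using \<open>e \<in> arcs vs\<close> by (auto simp: arcs_def)
  let ?a = "vs ! i" and ?b = "vs ! (Suc i mod ?k)"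
  have s: "Suc i mod ?k < ?k" using i by (intro mod_less_divisor) linarith
  have "card {i, Suc i mod ?k} < card {..<?k}"
    using assms(3) by (intro le_less_trans[OF card_insert_le_m1[of 2]]) auto
  then obtain j where "j \<in> {..<?k} - {i, Suc i mod ?k}"
    using card_mono[of "{i, Suc i mod ?k}" "{..<?k}"] by fastforce
  then have j: "j < ?k" "j \<noteq> i" "j \<noteq> Suc i mod ?k" by auto
  have o: "0 < orient ?a ?b (vs ! j)" using assms(1) i j unfolding ccw_def by blast
  have "{?a, ?b} \<in> cycle_edges ws" using assms(5) i by (auto simp: cycle_edges_conv)
  then consider "(?a, ?b) \<in> arcs ws" | "(?b, ?a) \<in> arcs ws"
    by (auto simp: cycle_edges_arcs doubleton_eq_iff)
  then show "e \<in> arcs ws"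
  proof cases
    case 2
    then obtain i' where i': "i' < length ws" "ws ! i' = ?b" "ws ! (Suc i' mod length ws) = ?a"
      by (auto simp: arcs_def)
    have "vs ! j \<in> set ws" using Union_cycle_edges assms(5) j nth_mem by metis
    then obtain j' where j': "j' < length ws" "ws ! j' = vs ! j" by (auto simp: in_set_conv_nth)
    have "vs ! j \<noteq> ?a" "vs ! j \<noteq> ?b" using j s i assms(4) by (auto simp: nth_eq_iff_index_eq)
    then have "j' \<noteq> i'" "j' \<noteq> Suc i' mod length ws" using i' j' by auto
    then have "0 < orient ?b ?a (vs ! j)" using assms(2) i' j' unfolding ccw_def by metis
    then show ?thesis using o orient_swap[of ?a ?b] by simp
  qed (use i in simp)
qed

section \<open>The number of edges of a plane graph\<close>

definition slope :: "point \<times> point \<Rightarrow> real" where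
  "slope e = (snd (snd e) - snd (fst e)) / (fst (snd e) - fst (fst e))"

definition height :: "point \<times> point \<Rightarrow> real \<Rightarrow> real" where
  "height e t = snd (fst e) + (t - fst (fst e)) * slope e"

lemma height_ends [simp]:
  "height e (fst (fst e)) = snd (fst e)"
  "fst (fst e) < fst (snd e) \<Longrightarrow> height e (fst (snd e)) = snd (snd e)"
  by (auto simp: height_def slope_def)

lemma height_in_segment:
  assumes "fst (fst e) < fst (snd e)" "fst (fst e) \<le> t" "t \<le> fst (snd e)"
  shows "(t, height e t) \<in> closed_segment (fst e) (snd e)"
proof -
  define u where "u = (t - fst (fst e)) / (fst (snd e) - fst (fst e))"
  have "0 \<le> u" "u \<le> 1" using assms by (auto simp: u_def)
  moreover have "t = fst (fst e) + u * (fst (snd e) - fst (fst e))"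
    and "height e t = snd (fst e) + u * (snd (snd e) - snd (fst e))"
    using assms by (simp_all add: u_def height_def slope_def)
  then have "(t, height e t) = (1 - u) *\<^sub>R fst e + u *\<^sub>R snd e"
    by (simp add: prod_eq_iff algebra_simps)
  ultimately show ?thesis unfolding in_segment by blast
qed

lemma height_compare:
  assumes "fst e = fst f" "fst (fst e) < t"
  shows "height e t < height f t \<longleftrightarrow> slope e < slope f" "height e t \<le> height f t \<longleftrightarrow> slope e \<le> slope f"
  using assms by (auto simp: height_def)

lemma height_eq_orient:
  assumes "fst u < fst v"
  shows "snd w = height (u, v) (fst w) \<longleftrightarrow> orient u v w = 0"
  using assms by (auto simp: height_def slope_def orient_def cross_def field_simps)

text \<open>Distinct first coordinates exclude vertical edges, so each edge is a graph over an
  interval and edges can be ordered by height. A shear later removes this assumption.\<close>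

locale generic_planar =
  fixes V :: "point set" and E :: "point set set"
  assumes pslg: "pslg V E" and nocol: "no_three_collinear V" and inj: "inj_on fst V"
begin

definition F :: "(point \<times> point) set" where
  "F = {e. {fst e, snd e} \<in> E \<and> fst (fst e) < fst (snd e)}"

lemma F_V: "e \<in> F \<Longrightarrow> fst e \<in> V" "e \<in> F \<Longrightarrow> snd e \<in> V"
  using pslg by (auto simp: pslg_def F_def)

lemma F_less: "e \<in> F \<Longrightarrow> fst (fst e) < fst (snd e)"
  by (simp add: F_def)

lemma finite_F: "finite F"
proof (rule finite_subset)
  show "F \<subseteq> V \<times> V" using F_V by (auto simp: mem_Times_iff)
  show "finite (V \<times> V)" using pslg by (simp add: pslg_def)
qed

lemma common_point:
  assumes "e \<in> F" "g \<in> F" "e \<noteq> g" "height e t = height g t"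
    "fst (fst e) \<le> t" "t \<le> fst (snd e)" "fst (fst g) \<le> t" "t \<le> fst (snd g)"
  shows "(t, height e t) \<in> {fst e, snd e} \<inter> {fst g, snd g}"
proof -
  have "{fst e, snd e} \<noteq> {fst g, snd g}"
    using assms(1-3) by (auto simp: F_def doubleton_eq_iff prod_eq_iff)
  then have "closed_segment (fst e) (snd e) \<inter> closed_segment (fst g) (snd g) \<subseteq> {fst e, snd e} \<inter> {fst g, snd g}"
    using assms by (intro pslg_inter[OF pslg]) (auto simp: F_def)
  moreover have "(t, height e t) \<in> closed_segment (fst e) (snd e)"
    using assms by (intro height_in_segment F_less)
  moreover have "(t, height e t) \<in> closed_segment (fst g) (snd g)"
    unfolding assms(4) using assms by (intro height_in_segment F_less)
  ultimately show ?thesis by blast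
qed

text \<open>A change of order to the left of \<open>x\<close> would, by the intermediate value
  theorem, be a common point strictly inside \<open>f\<close>. Only a weak inequality results, as
  the edges may meet at \<open>s\<close>.\<close>

lemma order_backwards:
  assumes f: "f \<in> F" and g: "g \<in> F" and s: "s = max (fst (fst g)) (fst (fst f))"
    and x: "s < x" "x \<le> fst (snd f)" "x \<le> fst (snd g)" and less: "height g x < height f x"
  shows "height g s \<le> height f s"
proof (rule ccontr)
  assume n: "\<not> height g s \<le> height f s"
  have "continuous_on {s..x} (\<lambda>t. height f t - height g t)"
    unfolding height_def by (intro continuous_intros)
  then obtain z where z: "s \<le> z" "z \<le> x" "height f z - height g z = 0"
    using IVT'[of "\<lambda>t. height f t - height g t" s 0 x] n less x by auto
  then have z': "z \<noteq> s" "z \<noteq> x" using n less by auto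
  have "f \<noteq> g" using less by auto
  then have "(z, height f z) \<in> {fst f, snd f}"
    using common_point[OF f g, of z] z x s by auto
  then have "z = fst (fst f) \<or> z = fst (snd f)" by (metis fst_conv insertE singletonD)
  then show False using z z' s x by auto
qed

text \<open>An edge that is not the topmost one at its left endpoint is charged to the first vertex in the
  wedge between it and the next edge above it, and to whether this vertex ends the upper edge. The
  wedge is empty to the left of that vertex, hence no two edges receive the same charge.\<close>

definition next_edge :: "point \<times> point \<Rightarrow> point \<times> point \<Rightarrow> bool" where
  "next_edge e f \<longleftrightarrow> e \<in> F \<and> f \<in> F \<and> fst e = fst f \<and> slope e < slope f \<and>
     (\<forall>g\<in>F. fst g = fst e \<longrightarrow> \<not> (slope e < slope g \<and> slope g < slope f))"

text \<open>The wedge ends with the shorter edge and includes its two sides. Hence the right end of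
  the shorter edge always belongs to it, and a first vertex exists.\<close>

definition in_wedge :: "point \<times> point \<Rightarrow> point \<times> point \<Rightarrow> point \<Rightarrow> bool" where
  "in_wedge e f w \<longleftrightarrow> w \<in> V \<and> fst (fst e) < fst w \<and> fst w \<le> fst (snd e) \<and> fst w \<le> fst (snd f) \<and>
     height e (fst w) \<le> snd w \<and> snd w \<le> height f (fst w)"

definition first_in_wedge :: "point \<times> point \<Rightarrow> point \<times> point \<Rightarrow> point \<Rightarrow> bool" where
  "first_in_wedge e f w \<longleftrightarrow> in_wedge e f w \<and> (\<forall>z. in_wedge e f z \<longrightarrow> fst w \<le> fst z)"

text \<open>An edge strictly between the sides at \<open>w\<close> is followed to the left. Either
  it starts inside the wedge, at a vertex before \<open>w\<close>, or it reaches the apex, must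
  start there, and then has a slope between two adjacent ones.\<close>

lemma empty_wedge:
  assumes nxt: "next_edge e f" and w: "first_in_wedge e f w" and g: "g \<in> F"
    and x: "fst (fst g) < fst w" "fst w \<le> fst (snd g)"
    and between: "height e (fst w) < height g (fst w)" "height g (fst w) < height f (fst w)"
  shows False
proof -
  define s where "s = max (fst (fst g)) (fst (fst e))"
  have ef: "e \<in> F" "f \<in> F" "fst e = fst f" using nxt by (auto simp: next_edge_def)
  have w': "fst (fst e) < fst w" "fst w \<le> fst (snd e)" "fst w \<le> fst (snd f)"
    using w by (auto simp: first_in_wedge_def in_wedge_def)
  have sx: "s < fst w" using w' x by (simp add: s_def)
  have 1: "height g s \<le> height f s"
    using order_backwards[OF ef(2) g, of s "fst w"] sx w' x between ef by (simp add: s_def)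
  have 2: "height e s \<le> height g s"
    using order_backwards[OF g ef(1), of s "fst w"] sx w' x between by (simp add: s_def max.commute)
  show False
  proof (cases "fst (fst e) < fst (fst g)")
    case True
    then have s: "s = fst (fst g)" by (simp add: s_def)
    then have "in_wedge e f (fst g)"
      using 1 2 True w' x F_V[OF g] by (simp add: in_wedge_def)
    then have "fst w \<le> fst (fst g)" using w unfolding first_in_wedge_def by blast
    then show False using x by simp
  next
    case False
    then have s: "s = fst (fst e)" by (simp add: s_def)
    then have "height e s = height f s" using ef(3) by (simp add: height_def)
    then have eq: "height e s = height g s" using 1 2 by linarith
    have "e \<noteq> g" using between by auto
    then have "(s, height e s) \<in> {fst e, snd e} \<inter> {fst g, snd g}"
      using False s w' x sx by (intro common_point[OF ef(1) g _ eq]) auto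
    then have "fst e \<in> {fst g, snd g}" by (simp add: s)
    then have "fst g = fst e" using x w' by auto
    then have "slope e < slope g" "slope g < slope f"
      using between height_compare(1)[of e g] height_compare(1)[of g f] ef w' by auto
    then show False using nxt g \<open>fst g = fst e\<close> by (auto simp: next_edge_def)
  qed
qed

lemma slope_inj:
  assumes "e \<in> F" "f \<in> F" "fst e = fst f" "slope e = slope f" shows "e = f"
proof (rule ccontr)
  assume "e \<noteq> f"
  then have ne: "snd e \<noteq> snd f" using assms(3) by (auto simp: prod_eq_iff)
  have "height e (fst (snd f)) = snd (snd f)"
    using assms height_ends(2)[of f] F_less[of f] by (simp add: height_def)
  then have "orient (fst e) (snd e) (snd f) = 0"
    using height_eq_orient[of "fst e" "snd e" "snd f"] F_less[OF assms(1)] by simp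
  then have "collinear {fst e, snd e, snd f}" by (simp add: collinear_iff_orient)
  moreover have "distinct [fst e, snd e, snd f]" using ne F_less[OF assms(1)] F_less[OF assms(2)] assms(3) by auto
  ultimately show False using nocol F_V assms unfolding no_three_collinear_def by blast
qed

lemma not_on_edge:
  assumes "e \<in> F" "w \<in> V" "w \<noteq> snd e" "fst (fst e) < fst w"
  shows "snd w \<noteq> height e (fst w)"
proof
  assume "snd w = height e (fst w)"
  then have "orient (fst e) (snd e) w = 0"
    using height_eq_orient[of "fst e" "snd e" w] F_less[OF assms(1)] by simp
  then have "collinear {fst e, snd e, w}" by (simp add: collinear_iff_orient)
  moreover have "distinct [fst e, snd e, w]" using assms F_less[OF assms(1)] by auto
  ultimately show False using nocol F_V assms unfolding no_three_collinear_def by blast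
qed

lemma exists_first_in_wedge:
  assumes "next_edge e f" shows "\<exists>w. first_in_wedge e f w"
proof -
  have ef: "e \<in> F" "f \<in> F" "fst e = fst f" "slope e < slope f" using assms by (auto simp: next_edge_def)
  note less = F_less[OF ef(1)] F_less[OF ef(2)]
  have "in_wedge e f (snd e) \<or> in_wedge e f (snd f)"
  proof (cases "fst (snd e) \<le> fst (snd f)")
    case True
    then have "in_wedge e f (snd e)"
      using ef less F_V height_compare(2)[of e f "fst (snd e)"] by (simp add: in_wedge_def)
    then show ?thesis ..
  next
    case False
    then have "in_wedge e f (snd f)"
      using ef less F_V height_compare(2)[of e f "fst (snd f)"] by (simp add: in_wedge_def)
    then show ?thesis ..
  qed
  then have ne: "{w. in_wedge e f w} \<noteq> {}" by blast
  have "finite {w. in_wedge e f w}"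
    by (rule finite_subset[of _ V]) (use pslg in \<open>auto simp: in_wedge_def pslg_def\<close>)
  from ex_min_if_finite[OF finite_imageI[OF this, of fst]] ne
  obtain w where "in_wedge e f w" "\<not> (\<exists>y\<in>fst ` {w. in_wedge e f w}. y < fst w)" by auto
  then show ?thesis unfolding first_in_wedge_def by (metis imageI linorder_not_le mem_Collect_eq)
qed

definition topmost :: "point \<times> point \<Rightarrow> bool" where
  "topmost e \<longleftrightarrow> (\<forall>g\<in>F. fst g = fst e \<longrightarrow> slope g \<le> slope e)"

lemma exists_next_edge:
  assumes "e \<in> F" "\<not> topmost e" shows "\<exists>f. next_edge e f"
proof -
  let ?S = "{g\<in>F. fst g = fst e \<and> slope e < slope g}"
  have "finite ?S" using finite_F by simp
  moreover obtain g where "g \<in> F" "fst g = fst e" "slope e < slope g"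
    using assms unfolding topmost_def not_le[symmetric] by blast
  then have "slope ` ?S \<noteq> {}" by blast
  ultimately obtain y where "y \<in> slope ` ?S" "\<not> (\<exists>z\<in>slope ` ?S. z < y)"
    using ex_min_if_finite[of "slope ` ?S"] by blast
  then obtain f where "f \<in> ?S" "\<And>z. z \<in> ?S \<Longrightarrow> \<not> slope z < slope f" by blast
  then have "next_edge e f" using assms by (auto simp: next_edge_def)
  then show ?thesis ..
qed

text \<open>If \<open>w\<close> does not end the upper edge, that edge is the lowest one strictly
  above \<open>w\<close>, and the lower edge is its neighbour in slope. If \<open>w\<close> ends the
  upper edge, the lower edge is the highest one strictly below \<open>w\<close>. Hence the charge
  determines the charged edge.\<close>

lemma charge_unique:
  assumes n: "next_edge e1 f1" "next_edge e2 f2"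
    and w: "first_in_wedge e1 f1 w" "first_in_wedge e2 f2 w"
    and flag: "w = snd f1 \<longleftrightarrow> w = snd f2"
  shows "e1 = e2"
proof -
  have F: "e1 \<in> F" "f1 \<in> F" "fst e1 = fst f1" "slope e1 < slope f1"
     "e2 \<in> F" "f2 \<in> F" "fst e2 = fst f2" "slope e2 < slope f2"
    using n by (auto simp: next_edge_def)
  have W: "w \<in> V" "fst (fst e1) < fst w" "fst w \<le> fst (snd e1)" "fst w \<le> fst (snd f1)"
     "height e1 (fst w) \<le> snd w" "snd w \<le> height f1 (fst w)"
     "fst (fst e2) < fst w" "fst w \<le> fst (snd e2)" "fst w \<le> fst (snd f2)"
     "height e2 (fst w) \<le> snd w" "snd w \<le> height f2 (fst w)"
    using w by (auto simp: first_in_wedge_def in_wedge_def)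
  have same: "g1 = g2" if "g1 \<in> F" "g2 \<in> F" "height g1 (fst w) = height g2 (fst w)"
    "fst (fst g1) < fst w" "fst w \<le> fst (snd g1)" "fst (fst g2) < fst w" "fst w \<le> fst (snd g2)"
    "w \<noteq> snd g1" for g1 g2
  proof (rule ccontr)
    assume "g1 \<noteq> g2"
    then have "(fst w, height g1 (fst w)) \<in> {fst g1, snd g1}"
      using common_point[of g1 g2 "fst w"] that by auto
    then have "fst w = fst (snd g1)" using that(4) by (metis fst_conv insertE singletonD less_irrefl)
    then have "w = snd g1" using inj W(1) F_V[OF that(1)] by (auto dest: inj_onD)
    then show False using that by simp
  qed
  show ?thesis
  proof (cases "w = snd f1")
    case False
    then have ne: "w \<noteq> snd f1" "w \<noteq> snd f2" using flag by auto
    have lt: "snd w < height f1 (fst w)" "snd w < height f2 (fst w)"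
      using not_on_edge[OF F(2) W(1) ne(1)] not_on_edge[OF F(6) W(1) ne(2)] W F by auto
    have "f1 = f2"
    proof (cases "height f1 (fst w)" "height f2 (fst w)" rule: linorder_cases)
      case less
      then show ?thesis using empty_wedge[OF n(2) w(2) F(2)] W F lt by auto
    next
      case equal
      then show ?thesis using same[OF F(2) F(6)] W F ne by auto
    next
      case greater
      then show ?thesis using empty_wedge[OF n(1) w(1) F(6)] W F lt by auto
    qed
    then have "\<not> slope e1 < slope e2" "\<not> slope e2 < slope e1"
      using n F unfolding next_edge_def by auto
    then show ?thesis using slope_inj[OF F(1) F(5)] F \<open>f1 = f2\<close> by auto
  next
    case True
    then have wf: "w = snd f1" "w = snd f2" using flag by auto
    have ne: "w \<noteq> snd e1" "w \<noteq> snd e2" using wf F by (auto simp: prod_eq_iff slope_def)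
    have lt: "height e1 (fst w) < snd w" "height e2 (fst w) < snd w"
      using not_on_edge[OF F(1) W(1) ne(1)] not_on_edge[OF F(5) W(1) ne(2)] W by auto
    have eq: "height f1 (fst w) = snd w" "height f2 (fst w) = snd w"
      using wf F_less[OF F(2)] F_less[OF F(6)] height_ends(2)[of f1] height_ends(2)[of f2] by simp_all
    show ?thesis
    proof (cases "height e1 (fst w)" "height e2 (fst w)" rule: linorder_cases)
      case less
      then show ?thesis using empty_wedge[OF n(1) w(1) F(5)] W F lt eq by auto
    next
      case equal
      then show ?thesis using same[OF F(1) F(5)] W F ne by auto
    next
      case greater
      then show ?thesis using empty_wedge[OF n(2) w(2) F(1)] W F lt eq by auto
    qed
  qed
qed

text \<open>The factor 3 is 1 + 2: a left endpoint has at most one topmost edge, and the other edges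
  inject into pairs of a vertex and a truth value.\<close>

lemma card_edges: "card E \<le> 3 * card V"
proof -
  have finV: "finite V" using pslg by (simp add: pslg_def)
  have "E \<subseteq> (\<lambda>e. {fst e, snd e}) ` F"
  proof
    fix e assume "e \<in> E"
    then obtain a b where ab: "e = {a, b}" "a \<noteq> b" "a \<in> V" "b \<in> V"
      using pslg unfolding pslg_def by (metis card_2_iff insert_subset)
    then have "fst a \<noteq> fst b" using inj by (auto dest: inj_onD)
    then have "(a, b) \<in> F \<or> (b, a) \<in> F" using ab \<open>e \<in> E\<close> by (auto simp: F_def insert_commute)
    then show "e \<in> (\<lambda>e. {fst e, snd e}) ` F" using ab by (force simp: insert_commute)
  qed
  then have 1: "card E \<le> card F" using finite_F surj_card_le by blast
  have "inj_on fst {e\<in>F. topmost e}"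
    by (intro inj_onI slope_inj antisym) (auto simp: topmost_def)
  then have 2: "card {e\<in>F. topmost e} \<le> card V"
    using F_V finV by (intro card_inj_on_le[of fst]) auto
  have "\<forall>e\<in>{e\<in>F. \<not> topmost e}. \<exists>f w. next_edge e f \<and> first_in_wedge e f w"
    using exists_next_edge exists_first_in_wedge by blast
  then obtain nx ap where c: "\<And>e. e \<in> F \<Longrightarrow> \<not> topmost e \<Longrightarrow> next_edge e (nx e) \<and> first_in_wedge e (nx e) (ap e)"
    by (metis (mono_tags, lifting) mem_Collect_eq)
  have "inj_on (\<lambda>e. (ap e, ap e = snd (nx e))) {e\<in>F. \<not> topmost e}"
  proof (rule inj_onI)
    fix e e' assume "e \<in> {e\<in>F. \<not> topmost e}" "e' \<in> {e\<in>F. \<not> topmost e}"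
      and eq: "(ap e, ap e = snd (nx e)) = (ap e', ap e' = snd (nx e'))"
    then show "e = e'"
      using charge_unique[of e "nx e" e' "nx e'" "ap e"] c[of e] c[of e'] by auto
  qed
  moreover have "(\<lambda>e. (ap e, ap e = snd (nx e))) ` {e\<in>F. \<not> topmost e} \<subseteq> V \<times> UNIV"
    using c by (auto simp: first_in_wedge_def in_wedge_def)
  ultimately have "card {e\<in>F. \<not> topmost e} \<le> card (V \<times> (UNIV :: bool set))"
    using finV by (intro card_inj_on_le) auto
  moreover have "card F = card {e\<in>F. topmost e} + card {e\<in>F. \<not> topmost e}"
    using finite_F by (subst card_Un_disjoint[symmetric]) (auto intro!: arg_cong[of _ _ card])
  ultimately show ?thesis using 1 2 by (simp add: card_cartesian_product)
qed

end

text \<open>A generic shear makes the first coordinates distinct. It is linear and injective and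
  preserves orientations, so crossings and collinearity are unaffected.\<close>

lemma pslg_card_edges:
  assumes "pslg V E" "no_three_collinear V" shows "card E \<le> 3 * card V"
proof -
  have finV: "finite V" using assms by (simp add: pslg_def)
  \<comment> \<open>The shear factors that align two vertices of different second coordinate. Other
    pairs contribute \<open>0\<close>, by division by zero; this only forbids one more
    value.\<close>
  let ?B = "(\<lambda>(p, q). - (fst p - fst q) / (snd p - snd q)) ` (V \<times> V)"
  have "finite ?B" using finV by blast
  then obtain \<epsilon> where \<epsilon>: "\<epsilon> \<notin> ?B" using ex_new_if_finite infinite_UNIV_char_0 by blast
  define L :: "point \<Rightarrow> point" where "L p = (fst p + \<epsilon> * snd p, snd p)" for p
  have lin: "linear L" by (rule linearI) (auto simp: L_def algebra_simps)
  have injL: "inj L" by (rule injI) (auto simp: L_def prod_eq_iff)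
  have or: "orient (L a) (L b) (L c) = orient a b c" for a b c
    by (simp add: L_def orient_def cross_def algebra_simps)
  have hull: "convex hull (L ` e) = L ` (convex hull e)" for e
    using convex_hull_linear_image[OF lin] by metis
  interpret generic_planar "L ` V" "(`) L ` E"
  proof
    show "pslg (L ` V) ((`) L ` E)"
      unfolding pslg_def
    proof (intro conjI ballI impI)
      fix e f assume "e \<in> (`) L ` E" "f \<in> (`) L ` E" "e \<noteq> f"
      then obtain e' f' where e: "e = L ` e'" "f = L ` f'" "e' \<in> E" "f' \<in> E" "e' \<noteq> f'" by auto
      then have "convex hull e' \<inter> convex hull f' \<subseteq> e' \<inter> f'" using assms(1) by (simp add: pslg_def)
      then show "convex hull e \<inter> convex hull f \<subseteq> e \<inter> f"
        unfolding e(1,2) hull by (simp add: image_Int[OF injL, symmetric] image_mono)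
    qed (use assms(1) finV in \<open>auto simp: pslg_def card_image inj_on_subset[OF injL]\<close>)
    show "no_three_collinear (L ` V)"
      unfolding no_three_collinear_def collinear_iff_orient
    proof (intro ballI impI)
      fix a b c assume "a \<in> L ` V" "b \<in> L ` V" "c \<in> L ` V" "distinct [a, b, c]"
      then obtain a' b' c' where abc: "a = L a'" "b = L b'" "c = L c'"
        and V: "a' \<in> V" "b' \<in> V" "c' \<in> V" by blast
      then have "distinct [a', b', c']" using \<open>distinct [a, b, c]\<close> by auto
      with V have "orient a' b' c' \<noteq> 0"
        using assms(2) unfolding no_three_collinear_def collinear_iff_orient by blast
      then show "orient a b c \<noteq> 0" by (simp add: abc or)
    qed
    show "inj_on fst (L ` V)"
    proof (rule inj_onI)
      fix a b assume "a \<in> L ` V" "b \<in> L ` V" "fst a = fst b"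
      then obtain p q where pq: "a = L p" "b = L q" "p \<in> V" "q \<in> V" "fst (L p) = fst (L q)" by auto
      have "snd p = snd q"
      proof (rule ccontr)
        assume ne: "snd p \<noteq> snd q"
        then have "\<epsilon> = - (fst p - fst q) / (snd p - snd q)"
          using pq(5) by (simp add: L_def field_simps)
        then have "\<epsilon> \<in> ?B" using pq(3,4) by (intro image_eqI[of _ _ "(p, q)"]) auto
        then show False using \<epsilon> by simp
      qed
      then show "a = b" using pq by (simp add: L_def)
    qed
  qed
  have "inj_on ((`) L) E" using injL by (intro inj_onI) (simp add: inj_image_eq_iff)
  then show ?thesis using card_edges injL by (simp add: card_image inj_on_subset[OF injL])
qed

section \<open>Angularly monotone walks\<close>

text \<open>Walks from \<open>u\<close> that use arcs in the order of \<open>D\<close> and stop at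
  the first arrival at \<open>v\<close>. The recursion is the backward pass itself: for a list
  \<open>e # D\<close> only the values for \<open>D\<close> are consulted.\<close>

fun walks :: "nat \<Rightarrow> (nat \<times> nat) list \<Rightarrow> nat \<Rightarrow> (nat \<times> nat) list list" where
  "walks v [] u = []"
| "walks v (e # D) u =
     (if fst e = u then (if snd e = v then [[e]] else map ((#) e) (walks v D (snd e))) else []) @ walks v D u"

fun is_walk :: "nat \<Rightarrow> nat \<Rightarrow> (nat \<times> nat) list \<Rightarrow> bool" where
  "is_walk v u [] \<longleftrightarrow> False"
| "is_walk v u (e # w) \<longleftrightarrow> fst e = u \<and> (if snd e = v then w = [] else is_walk v (snd e) w)"

lemma set_walks: "set (walks v D u) = {w. subseq w D \<and> is_walk v u w}"
proof (induction D arbitrary: u)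
  case Nil
  then show ?case by (auto dest: list_emb_Nil2)
next
  case (Cons e D)
  have "w \<in> set (walks v (e # D) u) \<longleftrightarrow> subseq w (e # D) \<and> is_walk v u w" for w
  proof (cases w)
    case Nil
    then show ?thesis using Cons by auto
  next
    case w: (Cons f w')
    show ?thesis
    proof (cases "f = e")
      case True
      have sub: "subseq (e # w') D \<Longrightarrow> subseq w' D" by (rule subseq_Cons')
      show ?thesis unfolding w True using sub by (auto simp: Cons)
    next
      case False
      then show ?thesis unfolding w using Cons by (auto simp: subseq_Cons2_neq)
    qed
  qed
  then show ?case by blast
qed

lemma distinct_walks: "distinct D \<Longrightarrow> distinct (walks v D u)"
proof (induction D arbitrary: u)
  case (Cons e D)
  have "e # w \<notin> set (walks v D u)" for w
    using Cons.prems by (auto simp: set_walks dest: list_emb_set)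
  then show ?case using Cons by (auto simp: distinct_map)
qed simp

lemma All_nat_iff: "(\<forall>i. P i) \<longleftrightarrow> P 0 \<and> (\<forall>i. P (Suc i))"
  by (metis nat.exhaust)

lemma is_walk_iff:
  "is_walk v u w \<longleftrightarrow> w \<noteq> [] \<and> fst (w ! 0) = u \<and> snd (w ! (length w - 1)) = v \<and>
     (\<forall>i. Suc i < length w \<longrightarrow> snd (w ! i) = fst (w ! Suc i) \<and> snd (w ! i) \<noteq> v)"
proof (induction w arbitrary: u)
  case (Cons e w)
  show ?case
  proof (cases "w = []")
    case False
    have "(\<forall>i. Suc i < length (e # w) \<longrightarrow> snd ((e # w) ! i) = fst ((e # w) ! Suc i) \<and> snd ((e # w) ! i) \<noteq> v)
      \<longleftrightarrow> snd e = fst (w ! 0) \<and> snd e \<noteq> v \<and>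
        (\<forall>i. Suc i < length w \<longrightarrow> snd (w ! i) = fst (w ! Suc i) \<and> snd (w ! i) \<noteq> v)"
      using False by (intro trans[OF All_nat_iff]) simp
    then show ?thesis using False Cons[of "snd e"] by auto
  qed auto
qed simp

text \<open>The order is inherited from \<open>D\<close>, so a walk is determined by its set of
  arcs. This is used for injectivity.\<close>

lemma subseq_eq_filter:
  "subseq w D \<Longrightarrow> distinct D \<Longrightarrow> w = filter (\<lambda>x. x \<in> set w) D"
proof (induction D arbitrary: w)
  case (Cons e D)
  show ?case
  proof (cases w)
    case w: (Cons f w')
    show ?thesis
    proof (cases "f = e")
      case True
      then have sub: "subseq w' D" using Cons.prems(1) w by simp
      then have "w' = filter (\<lambda>x. x \<in> set w') D" using Cons by simp
      moreover have "filter (\<lambda>x. x \<in> set (e # w')) D = filter (\<lambda>x. x \<in> set w') D"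
        using Cons.prems(2) by (intro filter_cong) auto
      ultimately show ?thesis unfolding w True by simp
    next
      case False
      then have sub: "subseq w D" using Cons.prems(1) w by (simp add: subseq_Cons2_neq)
      then have "e \<notin> set w" using Cons.prems(2) by (auto dest: list_emb_set)
      then show ?thesis using Cons.IH[OF sub] Cons.prems(2) by simp
    qed
  qed simp
qed simp

lemma set_subseq: "subseq w D \<Longrightarrow> set w \<subseteq> set D"
  by (induction rule: list_emb.induct) auto

lemma sorted_wrt_subseq: "subseq w D \<Longrightarrow> sorted_wrt R D \<Longrightarrow> sorted_wrt R w"
proof (induction D arbitrary: w)
  case (Cons e D)
  show ?case
  proof (cases w)
    case w: (Cons f w')
    show ?thesis
    proof (cases "f = e")
      case True
      then have sub: "subseq w' D" using Cons.prems(1) w by simp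
      then show ?thesis using Cons.IH[OF sub] Cons.prems(2) w True set_subseq[OF sub] by auto
    next
      case False
      then have "subseq w D" using Cons.prems(1) w by (simp add: subseq_Cons2_neq)
      then show ?thesis using Cons.IH Cons.prems(2) by simp
    qed
  qed simp
qed (auto dest: list_emb_Nil2)

text \<open>The order of ties in \<open>D\<close> is arbitrary. It does not matter, because the
  strictly sorted \<open>w\<close> takes at most one element of each value of
  \<open>f\<close>.\<close>

lemma sorted_subseqI:
  fixes f :: "'a \<Rightarrow> real"
  assumes "sorted_wrt (\<lambda>x y. f x \<le> f y) D" "sorted_wrt (\<lambda>x y. f x < f y) w" "set w \<subseteq> set D"
  shows "subseq w D"
  using assms
proof (induction D arbitrary: w)
  case (Cons e D)
  show ?case
  proof (cases w)
    case w: (Cons g w')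
    show ?thesis
    proof (cases "g = e")
      case True
      then have "set w' \<subseteq> set D" using Cons.prems w by force
      then show ?thesis using Cons w True by simp
    next
      case False
      then have "g \<in> set D" using Cons.prems w by auto
      then have "f e \<le> f g" using Cons.prems by simp
      then have "e \<notin> set w" using Cons.prems(2) w False by fastforce
      then have "subseq w D" using Cons by auto
      then show ?thesis by (metis list_emb_Cons)
    qed
  qed simp
qed simp

lemma distinct_concat_map:
  assumes "distinct xs" "\<And>x. x \<in> set xs \<Longrightarrow> distinct (f x)"
    "\<And>x y. x \<in> set xs \<Longrightarrow> y \<in> set xs \<Longrightarrow> x \<noteq> y \<Longrightarrow> set (f x) \<inter> set (f y) = {}"
  shows "distinct (concat (map f xs))"
  using assms by (induction xs) force+

text \<open>Independent of the sorting method: any list of both orientations of the edges in weakly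
  increasing direction will do.\<close>

locale sorted_graph =
  fixes ps :: "point list" and es :: "(nat \<times> nat) list" and V E
    and D :: "(nat \<times> nat) list"
  assumes pslg: "pslg V E" and nocol: "no_three_collinear V" and rep: "represents ps es V E"
    and distinct_D: "distinct D" and set_D: "set D = set es \<union> prod.swap ` set es"
    and sorted_D: "sorted_wrt (\<lambda>e f. ang (ps ! snd e - ps ! fst e) \<le> ang (ps ! snd f - ps ! fst f)) D"
begin

section \<open>Arcs as pairs of vertex indices\<close>

definition vec :: "nat \<times> nat \<Rightarrow> point" where
  "vec e = ps ! snd e - ps ! fst e"

lemma dist_ps: "distinct ps" and set_ps: "set ps = V"
  using rep by (auto simp: represents_def)

lemma E_image: "E = (\<lambda>e. {ps ! fst e, ps ! snd e}) ` set es"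
  using rep by (auto simp: represents_def case_prod_beta)

lemma es_bound: "e \<in> set es \<Longrightarrow> fst e < length ps" "e \<in> set es \<Longrightarrow> snd e < length ps"
  using rep by (auto simp: represents_def)

lemma endpoints_eq:
  assumes "fst e < length ps" "snd e < length ps" "fst f < length ps" "snd f < length ps"
    and "{ps ! fst e, ps ! snd e} = {ps ! fst f, ps ! snd f}"
  shows "f = e \<or> f = prod.swap e"
proof -
  have "fst e = fst f \<and> snd e = snd f \<or> fst e = snd f \<and> snd e = fst f"
    using assms nth_eq_iff_index_eq[OF dist_ps] unfolding doubleton_eq_iff by auto
  then show ?thesis by (auto intro: prod_eqI)
qed

lemma D_iff: "e \<in> set D \<longleftrightarrow> fst e < length ps \<and> snd e < length ps \<and> {ps ! fst e, ps ! snd e} \<in> E"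
proof
  assume "e \<in> set D"
  then consider "e \<in> set es" | "prod.swap e \<in> set es" by (auto simp: set_D)
  then show "fst e < length ps \<and> snd e < length ps \<and> {ps ! fst e, ps ! snd e} \<in> E"
  proof cases
    case 2
    then have "{ps ! fst e, ps ! snd e} \<in> E"
      unfolding E_image by (intro image_eqI[of _ _ "prod.swap e"]) auto
    then show ?thesis using es_bound[OF 2] by simp
  qed (use es_bound in \<open>auto simp: E_image\<close>)
next
  assume a: "fst e < length ps \<and> snd e < length ps \<and> {ps ! fst e, ps ! snd e} \<in> E"
  then obtain f where f: "f \<in> set es" "{ps ! fst e, ps ! snd e} = {ps ! fst f, ps ! snd f}"
    by (auto simp: E_image)
  then have "f = e \<or> f = prod.swap e"
    using a es_bound[OF f(1)] by (intro endpoints_eq) auto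
  then show "e \<in> set D" using f(1) by (force simp: set_D)
qed

lemma D_ne: "e \<in> set D \<Longrightarrow> ps ! fst e \<noteq> ps ! snd e"
proof -
  assume "e \<in> set D"
  then have "{ps ! fst e, ps ! snd e} \<in> E" by (simp add: D_iff)
  then have "card {ps ! fst e, ps ! snd e} = 2" using pslg by (simp add: pslg_def)
  then show ?thesis by auto
qed

lemma D_bound: "e \<in> set D \<Longrightarrow> fst e < length ps" "e \<in> set D \<Longrightarrow> snd e < length ps"
  by (simp_all add: D_iff)

lemma D_V: "e \<in> set D \<Longrightarrow> ps ! fst e \<in> V" "e \<in> set D \<Longrightarrow> ps ! snd e \<in> V"
  using D_bound set_ps nth_mem by blast+

lemma vec_nonzero: "e \<in> set D \<Longrightarrow> vec e \<noteq> 0"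
  using D_ne[of e] by (auto simp: vec_def)

lemma card_E: "card E = length es"
proof -
  have "distinct (map (\<lambda>e. {ps ! fst e, ps ! snd e}) es)"
    "E = set (map (\<lambda>e. {ps ! fst e, ps ! snd e}) es)"
    using rep by (simp_all add: represents_def case_prod_unfold)
  then show ?thesis using distinct_card by fastforce
qed

definition all_walks :: "(nat \<times> nat) list list" where
  "all_walks = concat (map (\<lambda>v. walks v D v) [0..<length ps])"

definition corners :: "(nat \<times> nat) list \<Rightarrow> point list" where
  "corners w = map (\<lambda>e. ps ! fst e) w"

lemma set_all_walks: "set all_walks = {w. subseq w D \<and> (\<exists>v. is_walk v v w)}"
proof -
  have "v < length ps" if "subseq w D" "is_walk v v w" for v w
    using that D_bound(1)[of "hd w"] list_emb_set[OF that(1), of "hd w"]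
    by (cases w) auto
  then show ?thesis by (auto simp: all_walks_def set_walks) (metis atLeast0LessThan lessThan_iff)
qed

lemma distinct_all_walks: "distinct all_walks"
proof -
  have "v = v'" if "is_walk v v w" "is_walk v' v' w" for v v' w
    using that by (auto simp: is_walk_iff)
  then show ?thesis
    unfolding all_walks_def
    by (intro distinct_concat_map) (auto simp: distinct_walks[OF distinct_D] set_walks)
qed

lemma walk_corners:
  assumes "w \<in> set all_walks" "i < length w"
  shows "w ! i \<in> set D" "corners w ! i = ps ! fst (w ! i)"
    "corners w ! (Suc i mod length w) = ps ! snd (w ! i)"
proof -
  obtain v where w: "subseq w D" "is_walk v v w" using assms(1) by (auto simp: set_all_walks)
  show "w ! i \<in> set D" using set_subseq[OF w(1)] assms(2) nth_mem by blast
  show "corners w ! i = ps ! fst (w ! i)" using assms(2) by (simp add: corners_def)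
  have "fst (w ! (Suc i mod length w)) = snd (w ! i)"
  proof (cases "Suc i = length w")
    case True
    then have "i = length w - 1" by simp
    then show ?thesis using w(2) True by (simp add: is_walk_iff)
  next
    case False
    then show ?thesis using w(2) assms(2) by (simp add: is_walk_iff)
  qed
  moreover have "Suc i mod length w < length w" using assms(2) by (intro mod_less_divisor) linarith
  ultimately show "corners w ! (Suc i mod length w) = ps ! snd (w ! i)" by (simp add: corners_def)
qed

lemma length_corners [simp]: "length (corners w) = length w"
  by (simp add: corners_def)

lemma arcs_corners:
  "w \<in> set all_walks \<Longrightarrow> arcs (corners w) = (\<lambda>e. (ps ! fst e, ps ! snd e)) ` set w"
  by (force simp: arcs_def walk_corners in_set_conv_nth image_iff)

text \<open>Equal directions would make three vertices collinear, and going straight back changes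
  \<open>ang\<close> by 2. So the weak order of \<open>D\<close> becomes strict along a
  walk.\<close>

lemma ang_consecutive:
  assumes "e \<in> set D" "f \<in> set D" "snd e = fst f" "ang (vec e) \<le> ang (vec f)"
  shows "ang (vec e) < ang (vec f)"
proof (rule ccontr)
  assume "\<not> ang (vec e) < ang (vec f)"
  then have eq: "ang (vec e) = ang (vec f)" using assms by simp
  let ?a = "ps ! fst e" and ?b = "ps ! snd e" and ?c = "ps ! snd f"
  have "cross (vec e) (vec f) = 0"
    using ang_eq_iff[OF eq] vec_nonzero assms by blast
  then have "orient ?a ?b ?c = 0"
    using assms(3) by (simp add: vec_def orient_def cross_def algebra_simps)
  moreover have "?a \<noteq> ?b" "?b \<noteq> ?c" using D_ne[OF assms(1)] D_ne[OF assms(2)] assms(3) by auto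
  moreover have "?a \<noteq> ?c"
  proof
    assume "?a = ?c"
    then have vf: "vec f = - vec e" using assms(3) by (simp add: vec_def)
    then have "upper (vec e) \<longleftrightarrow> \<not> upper (vec f)"
      using upper_uminus[of "vec e"] vec_nonzero[OF assms(1)] by simp
    then show False
      using ang_uminus[of "vec e"] ang_uminus[of "vec f"] eq vf by auto
  qed
  ultimately have "collinear {?a, ?b, ?c}" "distinct [?a, ?b, ?c]" by (auto simp: collinear_iff_orient)
  moreover have "?a \<in> V" "?b \<in> V" "?c \<in> V" using D_V[OF assms(1)] D_V[OF assms(2)] by auto
  ultimately show False using nocol unfolding no_three_collinear_def by blast
qed

lemma walk_sorted:
  assumes w: "w \<in> set all_walks"
  shows "sorted_wrt (\<lambda>e f. ang (vec e) < ang (vec f)) w"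
proof -
  obtain v where v: "subseq w D" "is_walk v v w" using w by (auto simp: set_all_walks)
  have le: "sorted_wrt (\<lambda>e f. ang (vec e) \<le> ang (vec f)) w"
    using sorted_wrt_subseq[OF v(1) sorted_D] by (simp add: vec_def)
  have step: "ang (vec (w ! i)) < ang (vec (w ! Suc i))" if "Suc i < length w" for i
  proof (rule ang_consecutive)
    show "w ! i \<in> set D" "w ! Suc i \<in> set D" using walk_corners(1)[OF w] that by auto
    show "snd (w ! i) = fst (w ! Suc i)" using v(2) that by (simp add: is_walk_iff)
    show "ang (vec (w ! i)) \<le> ang (vec (w ! Suc i))"
      using le that by (simp add: sorted_wrt_iff_nth_less)
  qed
  show ?thesis
    unfolding sorted_wrt_iff_nth_less
  proof (intro allI impI)
    fix i j assume "i < j" "j < length w"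
    then show "ang (vec (w ! i)) < ang (vec (w ! j))"
    proof (induction j)
      case (Suc j)
      then show ?case using step[of j] by (cases "i = j") force+
    qed simp
  qed
qed

lemma walk_polygon:
  assumes w: "w \<in> set all_walks" and k: "3 \<le> length w"
  shows "angle_sorted (corners w)" "ccw (corners w)" "distinct (corners w)" "cycle_in E (corners w)"
proof -
  show s: "angle_sorted (corners w)"
    unfolding angle_sorted_def length_corners
  proof (intro allI impI)
    fix i j assume ij: "i < j" "j < length w"
    then have i: "i < length w" by simp
    have "ang (vec (w ! i)) < ang (vec (w ! j))"
      using walk_sorted[OF w] ij by (simp add: sorted_wrt_iff_nth_less)
    then show "ang (corners w ! (Suc i mod length w) - corners w ! i)
        < ang (corners w ! (Suc j mod length w) - corners w ! j)"
      unfolding walk_corners(2,3)[OF w i] walk_corners(2,3)[OF w ij(2)] vec_def .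
  qed
  have ne: "corners w ! i \<noteq> corners w ! (Suc i mod length (corners w))" if "i < length (corners w)" for i
    using D_ne walk_corners[OF w] that by simp
  show "ccw (corners w)" "distinct (corners w)"
    using angle_sorted_imp[OF _ s ne] k by auto
  moreover have "cycle_edges (corners w) \<subseteq> E"
    using walk_corners[OF w] D_iff by (auto simp: cycle_edges_def)
  ultimately show "cycle_in E (corners w)" using k by (simp add: cycle_in_def)
qed

text \<open>Equal edges force equal directed edges by counterclockwise orientation, hence equal sets
  of arcs, hence equal subsequences of \<open>D\<close>.\<close>

lemma cycle_edges_corners_inj:
  assumes "w \<in> set all_walks" "3 \<le> length w" "w' \<in> set all_walks" "3 \<le> length w'"
    and eq: "cycle_edges (corners w) = cycle_edges (corners w')"
  shows "w = w'"
proof -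
  have "arcs (corners w) = arcs (corners w')"
    using ccw_arcs_unique[of "corners w" "corners w'"] ccw_arcs_unique[of "corners w'" "corners w"]
      walk_polygon assms by auto
  then have "(\<lambda>e. (ps ! fst e, ps ! snd e)) ` set w = (\<lambda>e. (ps ! fst e, ps ! snd e)) ` set w'"
    using assms by (simp add: arcs_corners)
  moreover have "inj_on (\<lambda>e. (ps ! fst e, ps ! snd e)) (set D)"
    using D_bound nth_eq_iff_index_eq[OF dist_ps] by (intro inj_onI prod_eqI) auto
  moreover have sub: "subseq w D" "subseq w' D" using assms by (auto simp: set_all_walks)
  moreover have "set w \<subseteq> set D" "set w' \<subseteq> set D" using set_subseq sub by auto
  ultimately have "set w = set w'" by (simp add: inj_on_image_eq_iff)
  then show ?thesis using subseq_eq_filter[OF _ distinct_D] sub by metis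
qed

lemma polygon_walk:
  assumes cyc: "cycle_in E vs" and srt: "angle_sorted vs"
  obtains w where "w \<in> set all_walks" "corners w = vs"
proof -
  let ?k = "length vs"
  have k: "?k \<ge> 3" and dist: "distinct vs" using cyc by (auto simp: cycle_in_def)
  have edge: "{vs ! i, vs ! (Suc i mod ?k)} \<in> E" if "i < ?k" for i
    using cycle_in_edge[OF cyc that] .
  have "set vs \<subseteq> set ps"
  proof
    fix p assume "p \<in> set vs"
    then obtain i where "i < ?k" "vs ! i = p" by (auto simp: in_set_conv_nth)
    then have "p \<in> V" using edge[of i] pslg by (auto simp: pslg_def)
    then show "p \<in> set ps" by (simp add: set_ps)
  qed
  then have "\<forall>p\<in>set vs. \<exists>i<length ps. ps ! i = p" by (auto simp: in_set_conv_nth)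
  then obtain ix where ix: "\<And>p. p \<in> set vs \<Longrightarrow> ix p < length ps \<and> ps ! ix p = p" by metis
  define w where "w = map (\<lambda>i. (ix (vs ! i), ix (vs ! (Suc i mod ?k)))) [0..<?k]"
  have lw: "length w = ?k" by (simp add: w_def)
  have nx: "Suc i mod ?k < ?k" if "i < ?k" for i using that by (intro mod_less_divisor) linarith
  have wi: "w ! i = (ix (vs ! i), ix (vs ! (Suc i mod ?k)))" if "i < ?k" for i using that by (simp add: w_def)
  have wps: "ps ! fst (w ! i) = vs ! i" "ps ! snd (w ! i) = vs ! (Suc i mod ?k)" if "i < ?k" for i
    using wi[OF that] ix nx[OF that] that by auto
  have cw: "corners w = vs"
    by (rule nth_equalityI) (auto simp: lw corners_def wps)
  have sub: "set w \<subseteq> set D"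
  proof
    fix e assume "e \<in> set w"
    then obtain i where i: "i < ?k" "e = w ! i" by (auto simp: in_set_conv_nth lw)
    then show "e \<in> set D"
      unfolding D_iff using edge[OF i(1)] wps[OF i(1)] wi[OF i(1)] ix nx[OF i(1)] by auto
  qed
  have "sorted_wrt (\<lambda>e f. ang (vec e) < ang (vec f)) w"
    using srt unfolding angle_sorted_def sorted_wrt_iff_nth_less by (auto simp: vec_def wps lw)
  then have "subseq w D"
    using sorted_D sub by (intro sorted_subseqI[where f = "\<lambda>e. ang (vec e)"]) (simp_all add: vec_def)
  moreover have "is_walk (ix (vs ! 0)) (ix (vs ! 0)) w"
    unfolding is_walk_iff lw
  proof (intro conjI allI impI)
    have k0: "0 < ?k" using k by linarith
    show "w \<noteq> []" using lw k by auto
    show "fst (w ! 0) = ix (vs ! 0)" using wi[OF k0] by simp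
    show "snd (w ! (?k - 1)) = ix (vs ! 0)" using wi[of "?k - 1"] k0 by simp
    fix i assume i: "Suc i < ?k"
    show "snd (w ! i) = fst (w ! Suc i)" using i wi by simp
    \<comment> \<open>A walk stops at its first return; as the vertices are distinct, none occurs
      before the last arc.\<close>
    show "snd (w ! i) \<noteq> ix (vs ! 0)"
    proof
      assume "snd (w ! i) = ix (vs ! 0)"
      then have "ix (vs ! Suc i) = ix (vs ! 0)" using i wi[of i] by simp
      then have "vs ! Suc i = vs ! 0" using ix i k0 by (metis nth_mem)
      then show False using dist i k0 by (simp add: nth_eq_iff_index_eq)
    qed
  qed
  ultimately have "w \<in> set all_walks" by (auto simp: set_all_walks)
  then show ?thesis using cw that by blast
qed

definition long_walks :: "(nat \<times> nat) list list" where
  "long_walks = filter (\<lambda>w. 3 \<le> length w) all_walks"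

lemma cycle_edges_long_walks:
  "(\<lambda>w. cycle_edges (corners w)) ` set long_walks = convex_polygons E"
proof -
  have "P \<in> (\<lambda>w. cycle_edges (corners w)) ` set long_walks \<longleftrightarrow> P \<in> convex_polygons E" for P
    unfolding convex_polygons_iff[OF pslg nocol]
  proof
    assume "P \<in> (\<lambda>w. cycle_edges (corners w)) ` set long_walks"
    then show "\<exists>vs. cycle_in E vs \<and> angle_sorted vs \<and> P = cycle_edges vs"
      using walk_polygon(1,4) unfolding long_walks_def by fastforce
  next
    assume "\<exists>vs. cycle_in E vs \<and> angle_sorted vs \<and> P = cycle_edges vs"
    then obtain vs where vs: "cycle_in E vs" "angle_sorted vs" "P = cycle_edges vs" by blast
    from polygon_walk[OF vs(1,2)] obtain w where "w \<in> set all_walks" "corners w = vs" .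
    then show "P \<in> (\<lambda>w. cycle_edges (corners w)) ` set long_walks"
      using vs length_corners[of w] by (auto simp: long_walks_def cycle_in_def)
  qed
  then show ?thesis by blast
qed

lemma inj_long_walks: "inj_on (\<lambda>w. cycle_edges (corners w)) (set long_walks)"
  by (rule inj_onI) (auto simp: long_walks_def intro: cycle_edges_corners_inj)

lemma distinct_long_walks: "distinct long_walks"
  by (simp add: long_walks_def distinct_all_walks)

lemma card_convex_polygons: "card (convex_polygons E) = length long_walks"
  unfolding cycle_edges_long_walks[symmetric]
  by (simp add: card_image[OF inj_long_walks] distinct_card[OF distinct_long_walks])

lemma card_cycle_edges:
  assumes "distinct vs" "3 \<le> length vs" shows "card (cycle_edges vs) = length vs"
proof -
  let ?k = "length vs"
  have "inj_on (\<lambda>i. {vs ! i, vs ! (Suc i mod ?k)}) {..<?k}"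
  proof (rule inj_onI)
    fix i j assume ij: "i \<in> {..<?k}" "j \<in> {..<?k}"
      and eq: "{vs ! i, vs ! (Suc i mod ?k)} = {vs ! j, vs ! (Suc j mod ?k)}"
    have s: "Suc i mod ?k < ?k" "Suc j mod ?k < ?k" using ij by (auto intro!: mod_less_divisor)
    \<comment> \<open>The second alternative, two edges traversed in opposite senses, would need a
      cycle of length at most 2.\<close>
    have "i = j \<or> i = Suc j mod ?k \<and> Suc i mod ?k = j"
      using eq ij s assms(1) by (auto simp: doubleton_eq_iff nth_eq_iff_index_eq)
    then show "i = j"
      using ij assms(2) by (cases "Suc i = ?k"; cases "Suc j = ?k") auto
  qed
  then show ?thesis by (simp add: cycle_edges_conv card_image)
qed

lemma sum_card_convex_polygons:
  "(\<Sum>P\<in>convex_polygons E. card P) = (\<Sum>w\<leftarrow>long_walks. length w)"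
proof -
  have "(\<Sum>P\<in>convex_polygons E. card P) = (\<Sum>w\<in>set long_walks. card (cycle_edges (corners w)))"
    unfolding cycle_edges_long_walks[symmetric] by (simp add: sum.reindex[OF inj_long_walks])
  also have "\<dots> = (\<Sum>w\<in>set long_walks. length w)"
    by (intro sum.cong) (auto simp: long_walks_def card_cycle_edges walk_polygon)
  finally show ?thesis by (simp add: sum_list_distinct_conv_sum_set[OF distinct_long_walks])
qed

text \<open>An arc and its reverse have angles that differ by exactly 2, so the upward one comes
  first. Each undirected edge thus yields exactly one walk of two arcs.\<close>

lemma subseq_back_and_forth:
  assumes "e \<in> set D"
  shows "subseq [e, prod.swap e] D \<longleftrightarrow> upper (vec e)"
proof -
  have sw: "prod.swap e \<in> set D" using assms by (simp add: D_iff insert_commute)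
  have vsw: "vec (prod.swap e) = - vec e" by (simp add: vec_def)
  note up = upper_uminus[OF vec_nonzero[OF assms]]
  show ?thesis
  proof
    assume "subseq [e, prod.swap e] D"
    from sorted_wrt_subseq[OF this sorted_D] have "ang (vec e) \<le> ang (- vec e)"
      unfolding vsw[symmetric] by (simp add: vec_def)
    then show "upper (vec e)" using up ang_uminus[of "- vec e"] by fastforce
  next
    assume "upper (vec e)"
    then show "subseq [e, prod.swap e] D"
      using sorted_D assms sw ang_uminus
      by (intro sorted_subseqI[where f = "\<lambda>e. ang (vec e)"]) (simp_all add: vec_def[symmetric] vsw)
  qed
qed

text \<open>A closed walk of one arc would be a loop, and one of two arcs must return along the same
  edge. These are the only spurious walks.\<close>

lemma short_walks:
  "set (filter (\<lambda>w. length w < 3) all_walks) = (\<lambda>e. [e, prod.swap e]) ` {e \<in> set D. upper (vec e)}"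
proof -
  have "w \<in> (\<lambda>e. [e, prod.swap e]) ` {e \<in> set D. upper (vec e)}"
    if len: "length w < 3" and sub: "subseq w D" and walk: "is_walk v v w" for w v
  proof -
    consider "w = []" | e where "w = [e]" | e f where "w = [e, f]"
      using len by (cases w; cases "tl w"; auto)
    then show ?thesis
    proof cases
      case 2
      then have "e \<in> set D" "fst e = snd e" using sub walk by (auto simp: subseq_singleton_left split: if_splits)
      then show ?thesis using D_ne by fastforce
    next
      case 3
      then have "f = prod.swap e" using walk by (cases e; cases f) (auto split: if_splits)
      moreover have "e \<in> set D" using set_subseq[OF sub] 3 by simp
      ultimately show ?thesis using sub subseq_back_and_forth 3 by auto
    qed (use walk in simp)
  qed
  moreover have "is_walk (fst e) (fst e) [e, prod.swap e]" if "e \<in> set D" for e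
    using D_ne[OF that] by auto
  ultimately show ?thesis using subseq_back_and_forth by (fastforce simp: set_all_walks)
qed

lemma card_upper: "card {e \<in> set D. upper (vec e)} = length es"
proof -
  have inj: "inj_on (\<lambda>e. {ps ! fst e, ps ! snd e}) {e \<in> set D. upper (vec e)}"
  proof (rule inj_onI)
    fix e f assume e: "e \<in> {e \<in> set D. upper (vec e)}" and f: "f \<in> {e \<in> set D. upper (vec e)}"
      and eq: "{ps ! fst e, ps ! snd e} = {ps ! fst f, ps ! snd f}"
    have "f = e \<or> f = prod.swap e"
      using eq e f D_bound by (intro endpoints_eq) auto
    moreover have "vec (prod.swap e) = - vec e" by (simp add: vec_def)
    ultimately show "e = f" using e f upper_uminus[OF vec_nonzero[of e]] by auto
  qed
  have img: "(\<lambda>e. {ps ! fst e, ps ! snd e}) ` {e \<in> set D. upper (vec e)} = E"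
  proof
    show "(\<lambda>e. {ps ! fst e, ps ! snd e}) ` {e \<in> set D. upper (vec e)} \<subseteq> E" using D_iff by auto
    show "E \<subseteq> (\<lambda>e. {ps ! fst e, ps ! snd e}) ` {e \<in> set D. upper (vec e)}"
    proof
      fix x assume "x \<in> E"
      then obtain e where e: "e \<in> set es" "x = {ps ! fst e, ps ! snd e}" by (auto simp: E_image)
      then have D: "e \<in> set D" "prod.swap e \<in> set D" by (auto simp: set_D)
      have "vec (prod.swap e) = - vec e" by (simp add: vec_def)
      then consider "upper (vec e)" | "upper (vec (prod.swap e))"
        using upper_uminus vec_nonzero[OF D(1)] by metis
      then show "x \<in> (\<lambda>e. {ps ! fst e, ps ! snd e}) ` {e \<in> set D. upper (vec e)}"
      proof cases
        case 1
        then show ?thesis using D e by blast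
      next
        case 2
        then show ?thesis using D e by (intro image_eqI[of _ _ "prod.swap e"]) auto
      qed
    qed
  qed
  show ?thesis using card_image[OF inj] unfolding img card_E by simp
qed

lemma length_short_walks: "length (filter (\<lambda>w. length w < 3) all_walks) = length es"
proof -
  have "inj_on (\<lambda>e. [e, prod.swap e]) {e \<in> set D. upper (vec e)}" by (rule inj_onI) simp
  then have "card (set (filter (\<lambda>w. length w < 3) all_walks)) = length es"
    unfolding short_walks by (simp add: card_image card_upper)
  then show ?thesis using distinct_card[of "filter (\<lambda>w. length w < 3) all_walks"] distinct_all_walks by simp
qed

lemma length_all_walks: "length all_walks = card (convex_polygons E) + length es"
  unfolding card_convex_polygons long_walks_def length_short_walks[symmetric]
  using sum_length_filter_compl[of "\<lambda>w. 3 \<le> length w" all_walks] by (simp add: not_le)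

text \<open>The search also traverses the unreported walks of two arcs. Their total of
  \<open>2 * length es\<close> arcs is absorbed by the quadratic term.\<close>

lemma sum_length_all_walks:
  "(\<Sum>w\<leftarrow>all_walks. length w) \<le> (\<Sum>P\<in>convex_polygons E. card P) + 2 * length es"
proof -
  have "(\<Sum>w\<leftarrow>xs. length w) \<le> (\<Sum>w\<leftarrow>filter (\<lambda>w. 3 \<le> length w) xs. length w) +
      2 * length (filter (\<lambda>w. length w < 3) xs)" for xs :: "(nat \<times> nat) list list"
    by (induction xs) auto
  from this[of all_walks] show ?thesis
    by (simp add: sum_card_convex_polygons long_walks_def length_short_walks)
qed

lemma enumerates_long_walks:
  "enumerates_convex_polygons ps E (concat (map (\<lambda>w. length w # map fst w) long_walks))"
  unfolding enumerates_convex_polygons_def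
proof (intro exI[of _ "map (map fst) long_walks"] conjI ballI)
  have c: "map ((!) ps) (map fst w) = corners w" for w by (simp add: corners_def)
  have m: "map (\<lambda>c. cycle_edges (map ((!) ps) c)) (map (map fst) long_walks) =
      map (\<lambda>w. cycle_edges (corners w)) long_walks"
    by (simp add: corners_def comp_def)
  show "concat (map (\<lambda>w. length w # map fst w) long_walks) =
      concat (map (\<lambda>c. length c # c) (map (map fst) long_walks))" by (simp add: comp_def)
  show "distinct (map (\<lambda>c. cycle_edges (map ((!) ps) c)) (map (map fst) long_walks))"
    using inj_long_walks distinct_long_walks unfolding m by (simp add: distinct_map)
  show "set (map (\<lambda>c. cycle_edges (map ((!) ps) c)) (map (map fst) long_walks)) = convex_polygons E"
    using cycle_edges_long_walks unfolding m by simp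
  fix x assume "x \<in> set (map (map fst) long_walks)"
  then obtain w where w: "w \<in> set long_walks" "x = map fst w" by auto
  have aw: "w \<in> set all_walks" "3 \<le> length w" using w by (auto simp: long_walks_def)
  show "set x \<subseteq> {..<length ps}"
    using walk_corners(1)[OF aw(1)] D_bound w(2) by (auto simp: in_set_conv_nth) (metis fst_conv)
  show "cycle_in E (map ((!) ps) x)" using walk_polygon(4)[OF aw] w(2) by (simp add: c del: map_map)
qed

end

section \<open>Executions with a time bound\<close>

text \<open>\<open>exec\<close> has the exact time; a bound allows costs to be rounded up when
  programs are composed.\<close>

definition run :: "com \<Rightarrow> state \<Rightarrow> nat \<Rightarrow> (state \<Rightarrow> bool) \<Rightarrow> bool" where
  "run c s K Q \<longleftrightarrow> (\<exists>k t. exec c s k t \<and> k \<le> K \<and> Q t)"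

lemma run_weaken: "run c s K Q \<Longrightarrow> K \<le> K' \<Longrightarrow> (\<And>t. Q t \<Longrightarrow> Q' t) \<Longrightarrow> run c s K' Q'"
  unfolding run_def by (meson le_trans)

lemma run_seq: "run c s K (\<lambda>s'. run d s' L Q) \<Longrightarrow> run (Seq c d) s (K + L) Q"
  unfolding run_def by (meson exec.Seq add_mono)

lemma run_seqI: "run c s K R \<Longrightarrow> (\<And>s'. R s' \<Longrightarrow> run d s' L Q) \<Longrightarrow> run (Seq c d) s (K + L) Q"
  by (rule run_seq) (erule run_weaken, simp_all)

lemma run_cond:
  assumes "bval b s \<Longrightarrow> run c s K Q" "\<not> bval b s \<Longrightarrow> run d s K Q"
  shows "run (Cond b c d) s (1 + bcost b + K) Q"
proof (cases "bval b s")
  case True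
  then obtain k t where "exec c s k t" "k \<le> K" "Q t" using assms(1) by (auto simp: run_def)
  then have "exec (Cond b c d) s (1 + bcost b + k) t" using True exec.CondTrue by blast
  then show ?thesis using \<open>k \<le> K\<close> \<open>Q t\<close> unfolding run_def by fastforce
next
  case False
  then obtain k t where "exec d s k t" "k \<le> K" "Q t" using assms(2) by (auto simp: run_def)
  then have "exec (Cond b c d) s (1 + bcost b + k) t" using False exec.CondFalse by blast
  then show ?thesis using \<open>k \<le> K\<close> \<open>Q t\<close> unfolding run_def by fastforce
qed

lemma run_cond_True: "bval b s \<Longrightarrow> run c s K Q \<Longrightarrow> run (Cond b c d) s (1 + bcost b + K) Q"
  unfolding run_def by (metis add_left_mono exec.CondTrue)

lemma run_cond_False: "\<not> bval b s \<Longrightarrow> run d s K Q \<Longrightarrow> run (Cond b c d) s (1 + bcost b + K) Q"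
  unfolding run_def by (metis add_left_mono exec.CondFalse)

section \<open>Symbolic execution of programs without loops\<close>

fun loop_free :: "com \<Rightarrow> bool" where
  "loop_free (Seq c d) \<longleftrightarrow> loop_free c \<and> loop_free d"
| "loop_free (Cond b c d) \<longleftrightarrow> loop_free c \<and> loop_free d"
| "loop_free (While b c) \<longleftrightarrow> False"
| "loop_free _ \<longleftrightarrow> True"

fun result :: "com \<Rightarrow> state \<Rightarrow> state" where
  "result Skip s = s"
| "result (NWrite a i e) s = nwrite a (nval i s) (nval e s) s"
| "result (RWrite a i e) s = rwrite a (nval i s) (rval e s) s"
| "result (Output e) s = emit (nval e s) s"
| "result (Seq c d) s = result d (result c s)"
| "result (Cond b c d) s = (if bval b s then result c s else result d s)"
| "result (While b c) s = s"

fun max_time :: "com \<Rightarrow> nat" where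
  "max_time Skip = 1"
| "max_time (NWrite a i e) = 1 + ncost i + ncost e"
| "max_time (RWrite a i e) = 1 + ncost i + rcost e"
| "max_time (Output e) = 1 + ncost e"
| "max_time (Seq c d) = max_time c + max_time d"
| "max_time (Cond b c d) = 1 + bcost b + max (max_time c) (max_time d)"
| "max_time (While b c) = 0"

text \<open>Simplification of \<open>result\<close> replaces program logic for code without loops. A
  conditional is charged with its dearer branch, so the bound depends on the program only.\<close>

lemma run_result:
  "loop_free c \<Longrightarrow> Q (result c s) \<Longrightarrow> run c s (max_time c) Q"
proof (induction c arbitrary: s Q)
  case (Seq c d)
  then show ?case by (auto intro!: run_seq)
next
  case (Cond b c d)
  have "run (Cond b c d) s (1 + bcost b + max (max_time c) (max_time d)) Q"
  proof (rule run_cond)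
    assume "bval b s"
    then have "run c s (max_time c) Q" using Cond by simp
    then show "run c s (max (max_time c) (max_time d)) Q" by (rule run_weaken) auto
  next
    assume "\<not> bval b s"
    then have "run d s (max_time d) Q" using Cond by simp
    then show "run d s (max (max_time c) (max_time d)) Q" by (rule run_weaken) auto
  qed
  then show ?case by simp
qed (auto simp: run_def intro!: exI exec.intros)

text \<open>Unlike executions of a whole loop, sequences of iterations compose.\<close>

inductive iter :: "bexp \<Rightarrow> com \<Rightarrow> state \<Rightarrow> nat \<Rightarrow> state \<Rightarrow> bool" for b c where
  iter_refl: "iter b c s 0 s"
| iter_step: "bval b s \<Longrightarrow> exec c s k s' \<Longrightarrow> iter b c s' l t \<Longrightarrow> iter b c s (1 + bcost b + k + l) t"

lemma iter_trans: "iter b c s k t \<Longrightarrow> iter b c t l u \<Longrightarrow> iter b c s (k + l) u"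
proof (induction rule: iter.induct)
  case (iter_step s k s' l' t)
  then have "iter b c s (1 + bcost b + k + (l' + l)) u" by (intro iter.iter_step) auto
  then show ?case by (simp add: add.assoc)
qed simp

lemma iter_exec: "iter b c s k t \<Longrightarrow> \<not> bval b t \<Longrightarrow> exec (While b c) s (k + (1 + bcost b)) t"
proof (induction rule: iter.induct)
  case (iter_refl s)
  then show ?case using exec.WhileFalse by simp
next
  case (iter_step s k s' l t)
  then have "exec (While b c) s (1 + bcost b + k + (l + (1 + bcost b))) t" by (intro exec.WhileTrue) auto
  then show ?case by (simp add: add.assoc)
qed

definition iters :: "bexp \<Rightarrow> com \<Rightarrow> state \<Rightarrow> nat \<Rightarrow> (state \<Rightarrow> bool) \<Rightarrow> bool" where
  "iters b c s K Q \<longleftrightarrow> (\<exists>k t. iter b c s k t \<and> k \<le> K \<and> Q t)"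

lemma iters_refl: "Q s \<Longrightarrow> iters b c s K Q"
  unfolding iters_def using iter_refl by blast

lemma iters_step:
  assumes "bval b s" "run c s K (\<lambda>s'. iters b c s' L Q)"
  shows "iters b c s (1 + bcost b + K + L) Q"
proof -
  obtain k s' l t where "exec c s k s'" "k \<le> K" "iter b c s' l t" "l \<le> L" "Q t"
    using assms(2) by (auto simp: run_def iters_def)
  then have "iter b c s (1 + bcost b + k + l) t" using assms(1) iter_step by blast
  then show ?thesis unfolding iters_def using \<open>k \<le> K\<close> \<open>l \<le> L\<close> \<open>Q t\<close> by fastforce
qed

lemma iters_trans:
  assumes "iters b c s K R" "\<And>t. R t \<Longrightarrow> iters b c t L Q"
  shows "iters b c s (K + L) Q"
  using assms unfolding iters_def by (meson iter_trans add_mono)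

lemma iters_weaken: "iters b c s K Q \<Longrightarrow> K \<le> K' \<Longrightarrow> (\<And>t. Q t \<Longrightarrow> Q' t) \<Longrightarrow> iters b c s K' Q'"
  unfolding iters_def by (meson le_trans)

lemma run_while:
  assumes "iters b c s K Q" "\<And>t. Q t \<Longrightarrow> \<not> bval b t"
  shows "run (While b c) s (K + (1 + bcost b)) Q"
proof -
  obtain k t where "iter b c s k t" "k \<le> K" "Q t" using assms(1) by (auto simp: iters_def)
  then show ?thesis using iter_exec assms(2) unfolding run_def by (meson add_le_mono1)
qed

abbreviation "var x \<equiv> NRead x (NConst 0)"
abbreviation "setvar x e \<equiv> NWrite x (NConst 0) e"

definition For :: "array_name \<Rightarrow> nexp \<Rightarrow> com \<Rightarrow> com" where
  "For i e c = Seq (setvar i (NConst 0))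
     (While (NLess (var i) e) (Seq c (setvar i (NAdd (var i) (NConst 1)))))"

text \<open>Each iteration has its own budget \<open>K j\<close>, since the cost of the enumeration
  varies with the start vertex. The bound \<open>e\<close> is evaluated anew at every test, so the
  invariant has to preserve its value.\<close>

lemma run_for_sum:
  assumes init: "I 0 (nwrite i 0 0 s)"
    and inv: "\<And>j s. I j s \<Longrightarrow> nat_mem s i 0 = j \<and> nval e s = N"
    and body: "\<And>j s. j < N \<Longrightarrow> I j s \<Longrightarrow>
      run c s (K j) (\<lambda>t. nat_mem t i 0 = j \<and> I (Suc j) (nwrite i 0 (Suc j) t))"
  shows "run (For i e c) s ((\<Sum>j<N. K j + ncost e + 10) + ncost e + 10) (I N)"
proof -
  let ?b = "NLess (var i) e" and ?inc = "setvar i (NAdd (var i) (NConst 1))"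
  \<comment> \<open>The test costs \<open>4 + ncost e\<close> and the increment 6, which is the
    overhead \<open>ncost e + 10\<close> per iteration.\<close>
  let ?c = "Seq c ?inc" and ?k = "\<lambda>j. 1 + bcost (NLess (var i) e) + (K j + 6)"
  have "iters ?b ?c s (\<Sum>l=j..<N. ?k l) (I N)" if "I j s" "j \<le> N" for j s
    using that
  proof (induction "N - j" arbitrary: j s)
    case 0
    then show ?case by (auto intro: iters_refl)
  next
    case (Suc n)
    then have j: "j < N" by simp
    let ?rest = "\<lambda>s'. iters ?b ?c s' (\<Sum>l=Suc j..<N. ?k l) (I N)"
    have "iters ?b ?c s (1 + bcost ?b + (K j + 6) + (\<Sum>l=Suc j..<N. ?k l)) (I N)"
    proof (rule iters_step)
      show "bval ?b s" using inv[OF Suc.prems(1)] j by simp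
      show "run ?c s (K j + 6) ?rest"
      proof (rule run_seqI[OF body[OF j Suc.prems(1)]])
        fix s' assume s': "nat_mem s' i 0 = j \<and> I (Suc j) (nwrite i 0 (Suc j) s')"
        have "run ?inc s' (max_time ?inc) ?rest"
          using s' Suc(1)[of "Suc j" "nwrite i 0 (Suc j) s'"] Suc(2) j by (intro run_result) auto
        then show "run ?inc s' 6 ?rest" by (simp add: eval_nat_numeral)
      qed
    qed
    then show ?case by (simp only: sum.atLeast_Suc_lessThan[OF j])
  qed
  then have it: "iters ?b ?c (nwrite i 0 0 s) (\<Sum>l<N. ?k l) (I N)"
    using init unfolding lessThan_atLeast0 by blast
  have "run (While ?b ?c) (nwrite i 0 0 s) ((\<Sum>l<N. ?k l) + (1 + bcost ?b)) (I N)"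
    using it inv by (intro run_while) auto
  then have "run (For i e c) s (3 + ((\<Sum>l<N. ?k l) + (1 + bcost ?b))) (I N)"
    unfolding For_def
    by (intro run_seq run_weaken[OF run_result[of "setvar i (NConst 0)"]]) auto
  then show ?thesis
    by (rule run_weaken) (auto simp: sum.distrib)
qed

lemma run_for:
  assumes "I 0 (nwrite i 0 0 s)"
    and "\<And>j s. I j s \<Longrightarrow> nat_mem s i 0 = j \<and> nval e s = N"
    and "\<And>j s. j < N \<Longrightarrow> I j s \<Longrightarrow>
      run c s K (\<lambda>t. nat_mem t i 0 = j \<and> I (Suc j) (nwrite i 0 (Suc j) t))"
  shows "run (For i e c) s (N * (K + ncost e + 10) + ncost e + 10) (I N)"
  using run_for_sum[where I = I, OF assms] by simp

lemma ram_simps [simp]: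
  "nat_mem (nwrite a i v s) b j = (if a = b \<and> i = j then v else nat_mem s b j)"
  "real_mem (nwrite a i v s) = real_mem s"
  "nat_mem (rwrite a i w s) = nat_mem s"
  "real_mem (rwrite a i w s) b j = (if a = b \<and> i = j then w else real_mem s b j)"
  "out (nwrite a i v s) = out s" "out (rwrite a i w s) = out s"
  "nat_mem (emit v s) = nat_mem s" "real_mem (emit v s) = real_mem s" "out (emit v s) = out s @ [v]"
  by (auto simp: nwrite_def rwrite_def emit_def)

section \<open>The counting program\<close>

lemma nat_mem_nwrite_other [simp]: "a \<noteq> b \<Longrightarrow> nat_mem (nwrite a i v s) b = nat_mem s b"
  by (simp add: nwrite_def)

notation Seq (infixr \<open>;;\<close> 60)

abbreviation "rvar x \<equiv> RRead x (NConst 0)"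
abbreviation "setrvar x e \<equiv> RWrite x (NConst 0) e"
abbreviation "bor b c \<equiv> BNot (BAnd (BNot b) (BNot c))"

text \<open>The interface between the sorting phase and both main programs: \<open>S\<close> and
  \<open>T\<close> hold the sources and targets of the sorted arcs, \<open>M\<close> their
  number.\<close>

definition ready :: "nat \<Rightarrow> nat \<Rightarrow> (nat \<times> nat) list \<Rightarrow> state \<Rightarrow> bool" where
  "ready n m D s \<longleftrightarrow> nat_mem s ''n'' 0 = n \<and> nat_mem s ''m'' 0 = m \<and> nat_mem s ''M'' 0 = length D \<and>
     (\<forall>p<length D. nat_mem s ''S'' p = fst (D ! p) \<and> nat_mem s ''T'' p = snd (D ! p))"

lemma ready_nwrite [simp]:
  "a \<notin> {''n'', ''m'', ''M'', ''S'', ''T''} \<Longrightarrow> ready n m D (nwrite a i v s) = ready n m D s"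
  by (auto simp: ready_def)

lemma ready_emit [simp]: "ready n m D (emit v s) = ready n m D s"
  by (auto simp: ready_def)

text \<open>The loop counter runs upwards, but \<open>p\<close> runs backwards through the arcs.
  \<open>N u\<close> counts the walks from \<open>u\<close> in the suffix seen so far. An arc into
  \<open>v\<close> adds 1 instead of \<open>N v\<close>, since a walk ends there.\<close>

definition count_step :: com where
  "count_step =
     setvar ''p'' (NSub (var ''M'') (NAdd (var ''i'') (NConst 1))) ;;
     setvar ''a'' (NRead ''S'' (var ''p'')) ;;
     setvar ''b'' (NRead ''T'' (var ''p'')) ;;
     Cond (NEq (var ''b'') (var ''v''))
       (NWrite ''N'' (var ''a'') (NAdd (NRead ''N'' (var ''a'')) (NConst 1)))
       (NWrite ''N'' (var ''a'') (NAdd (NRead ''N'' (var ''a'')) (NRead ''N'' (var ''b''))))"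

definition count_vertex :: com where
  "count_vertex =
     For ''u'' (var ''n'') (NWrite ''N'' (var ''u'') (NConst 0)) ;;
     For ''i'' (var ''M'') count_step ;;
     setvar ''tot'' (NAdd (var ''tot'') (NRead ''N'' (var ''v'')))"

definition count_main :: com where
  "count_main = setvar ''tot'' (NConst 0) ;; For ''v'' (var ''n'') count_vertex ;;
     Output (NSub (var ''tot'') (var ''m''))"

lemma drop_last_step:
  assumes "i < length D"
  shows "drop (length D - Suc i) D = D ! (length D - Suc i) # drop (length D - i) D"
  using assms Cons_nth_drop_Suc[of "length D - Suc i" D] by (simp add: Suc_diff_Suc)

lemma run_fill:
  assumes "ready n m D s" "X \<notin> {''n'', ''m'', ''M'', ''S'', ''T'', ''u''}"
  shows "run (For ''u'' (var ''n'') (NWrite X (var ''u'') (NConst 0))) s (n * 20 + 20)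
    (\<lambda>t. ready n m D t \<and> (\<forall>u<n. nat_mem t X u = 0) \<and> out t = out s \<and>
       (\<forall>a. a \<noteq> X \<longrightarrow> a \<noteq> ''u'' \<longrightarrow> nat_mem t a = nat_mem s a))"
proof -
  let ?I = "\<lambda>i t. nat_mem t ''u'' 0 = i \<and> ready n m D t \<and> (\<forall>u<i. nat_mem t X u = 0) \<and> out t = out s \<and>
       (\<forall>a. a \<noteq> X \<longrightarrow> a \<noteq> ''u'' \<longrightarrow> nat_mem t a = nat_mem s a)"
  have "run (For ''u'' (var ''n'') (NWrite X (var ''u'') (NConst 0))) s
    (n * (max_time (NWrite X (var ''u'') (NConst 0)) + ncost (var ''n'') + 10) + ncost (var ''n'') + 10) (?I n)"
  proof (rule run_for[where I = ?I])
    show "?I 0 (nwrite ''u'' 0 0 s)" using assms by auto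
  next
    fix j t assume "?I j t"
    then show "nat_mem t ''u'' 0 = j \<and> nval (var ''n'') t = n" by (simp add: ready_def)
  next
    fix j t assume j: "j < n" and I: "?I j t"
    show "run (NWrite X (var ''u'') (NConst 0)) t (max_time (NWrite X (var ''u'') (NConst 0)))
      (\<lambda>t. nat_mem t ''u'' 0 = j \<and> ?I (Suc j) (nwrite ''u'' 0 (Suc j) t))"
      using I assms(2) by (intro run_result) (auto simp: less_Suc_eq)
  qed
  then show ?thesis by (rule run_weaken) auto
qed

definition in_range :: "nat \<Rightarrow> (nat \<times> nat) list \<Rightarrow> bool" where
  "in_range n D \<longleftrightarrow> (\<forall>e\<in>set D. fst e < n \<and> snd e < n)"

text \<open>The invariant says that \<open>N\<close> holds the lengths of \<open>walks\<close> for
  the processed suffix. The factors 20 and 80 are round numbers above the cost of an iteration of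
  either loop.\<close>

lemma run_count_vertex:
  assumes s: "ready n m D s" and v: "nat_mem s ''v'' 0 = v" "v < n" and D: "in_range n D"
  shows "run count_vertex s (n * 20 + length D * 80 + 80)
    (\<lambda>t. ready n m D t \<and> nat_mem t ''v'' 0 = v \<and> out t = out s \<and>
       nat_mem t ''tot'' 0 = nat_mem s ''tot'' 0 + length (walks v D v))"
proof -
  let ?I = "\<lambda>i t. nat_mem t ''i'' 0 = i \<and> ready n m D t \<and> nat_mem t ''v'' 0 = v \<and> out t = out s \<and>
       nat_mem t ''tot'' 0 = nat_mem s ''tot'' 0 \<and>
       (\<forall>u<n. nat_mem t ''N'' u = length (walks v (drop (length D - i) D) u))"
  have loop: "run (For ''i'' (var ''M'') count_step) t
      (length D * (max_time count_step + ncost (var ''M'') + 10) + ncost (var ''M'') + 10) (?I (length D))"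
    if t: "ready n m D t" "\<forall>u<n. nat_mem t ''N'' u = 0" "out t = out s" "nat_mem t ''v'' 0 = v"
      "nat_mem t ''tot'' 0 = nat_mem s ''tot'' 0" for t
  proof (rule run_for[where I = ?I])
    show "?I 0 (nwrite ''i'' 0 0 t)" using t by simp
  next
    fix j t assume "?I j t"
    then show "nat_mem t ''i'' 0 = j \<and> nval (var ''M'') t = length D" by (simp add: ready_def)
  next
    fix j t assume j: "j < length D" and I: "?I j t"
    let ?p = "length D - Suc j"
    have p: "?p < length D" using j by simp
    have e: "nat_mem t ''S'' ?p = fst (D ! ?p)" "nat_mem t ''T'' ?p = snd (D ! ?p)" "nat_mem t ''M'' 0 = length D"
      using I p by (auto simp: ready_def)
    have b: "fst (D ! ?p) < n" "snd (D ! ?p) < n" using D p by (auto simp: in_range_def)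
    show "run count_step t (max_time count_step)
      (\<lambda>t. nat_mem t ''i'' 0 = j \<and> ?I (Suc j) (nwrite ''i'' 0 (Suc j) t))"
    proof (rule run_result)
      show "loop_free count_step" by (simp add: count_step_def)
      show "nat_mem (result count_step t) ''i'' 0 = j \<and> ?I (Suc j) (nwrite ''i'' 0 (Suc j) (result count_step t))"
        using I b by (auto simp: count_step_def e drop_last_step[OF j])
    qed
  qed
  have "run count_vertex s ((n * 20 + 20) + ((length D * (max_time count_step + ncost (var ''M'') + 10) + ncost (var ''M'') + 10)
      + max_time (setvar ''tot'' (NAdd (var ''tot'') (NRead ''N'' (var ''v''))))))
    (\<lambda>t. ready n m D t \<and> nat_mem t ''v'' 0 = v \<and> out t = out s \<and>
       nat_mem t ''tot'' 0 = nat_mem s ''tot'' 0 + length (walks v D v))"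
    unfolding count_vertex_def
  proof (rule run_seqI[OF run_fill[OF s]])
    fix t assume t: "ready n m D t \<and> (\<forall>u<n. nat_mem t ''N'' u = 0) \<and> out t = out s \<and>
       (\<forall>a. a \<noteq> ''N'' \<longrightarrow> a \<noteq> ''u'' \<longrightarrow> nat_mem t a = nat_mem s a)"
    show "run (For ''i'' (var ''M'') count_step ;; setvar ''tot'' (NAdd (var ''tot'') (NRead ''N'' (var ''v''))))
      t ((length D * (max_time count_step + ncost (var ''M'') + 10) + ncost (var ''M'') + 10)
      + max_time (setvar ''tot'' (NAdd (var ''tot'') (NRead ''N'' (var ''v''))))) (\<lambda>t. ready n m D t \<and> nat_mem t ''v'' 0 = v \<and> out t = out s \<and>
       nat_mem t ''tot'' 0 = nat_mem s ''tot'' 0 + length (walks v D v))"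
      using t v by (intro run_seqI[OF loop] run_result) auto
  qed simp
  then show ?thesis by (rule run_weaken) (auto simp: count_step_def)
qed

lemma run_count_main:
  assumes s: "ready n m D s" and D: "in_range n D" and o: "out s = []"
  shows "run count_main s (n * (n * 20 + length D * 80 + 100) + 100)
    (\<lambda>t. out t = [(\<Sum>v<n. length (walks v D v)) - m])"
proof -
  let ?K = "n * 20 + length D * 80 + 80"
  let ?I = "\<lambda>v t. nat_mem t ''v'' 0 = v \<and> ready n m D t \<and> out t = [] \<and>
    nat_mem t ''tot'' 0 = (\<Sum>v<v. length (walks v D v))"
  have loop: "run (For ''v'' (var ''n'') count_vertex) t (n * (?K + ncost (var ''n'') + 10) + ncost (var ''n'') + 10) (?I n)"
    if t: "ready n m D t" "out t = []" "nat_mem t ''tot'' 0 = 0" for t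
  proof (rule run_for[where I = ?I])
    show "?I 0 (nwrite ''v'' 0 0 t)" using t by simp
  next
    fix j t assume "?I j t"
    then show "nat_mem t ''v'' 0 = j \<and> nval (var ''n'') t = n" by (simp add: ready_def)
  next
    fix j t assume j: "j < n" and I: "?I j t"
    show "run count_vertex t ?K (\<lambda>t. nat_mem t ''v'' 0 = j \<and> ?I (Suc j) (nwrite ''v'' 0 (Suc j) t))"
      by (rule run_weaken[OF run_count_vertex[of n m D t j]]) (use I j D in auto)
  qed
  have "run count_main s (max_time (setvar ''tot'' (NConst 0)) +
      ((n * (?K + ncost (var ''n'') + 10) + ncost (var ''n'') + 10) + max_time (Output (NSub (var ''tot'') (var ''m'')))))
    (\<lambda>t. out t = [(\<Sum>v<n. length (walks v D v)) - m])"
    unfolding count_main_def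
  proof (intro run_seq run_result)
    let ?s = "result (setvar ''tot'' (NConst 0)) s"
    show "run (For ''v'' (var ''n'') count_vertex) ?s (n * (?K + ncost (var ''n'') + 10) + ncost (var ''n'') + 10)
      (\<lambda>s'. run (Output (NSub (var ''tot'') (var ''m''))) s' (max_time (Output (NSub (var ''tot'') (var ''m''))))
        (\<lambda>t. out t = [(\<Sum>v<n. length (walks v D v)) - m]))"
    proof (rule run_weaken[OF loop])
      fix t assume "?I n t"
      then show "run (Output (NSub (var ''tot'') (var ''m''))) t (max_time (Output (NSub (var ''tot'') (var ''m''))))
        (\<lambda>t. out t = [(\<Sum>v<n. length (walks v D v)) - m])"
        by (intro run_result) (auto simp: ready_def)
    qed (use s o in auto)
  qed simp
  then show ?thesis by (rule run_weaken) (auto simp: algebra_simps)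
qed

section \<open>Sorting the directed edges\<close>

definition input_ok :: "point list \<Rightarrow> (nat \<times> nat) list \<Rightarrow> state \<Rightarrow> bool" where
  "input_ok ps es s \<longleftrightarrow> nat_mem s ''n'' 0 = length ps \<and> nat_mem s ''m'' 0 = length es \<and>
     (\<forall>j<length es. nat_mem s ''src'' j = fst (es ! j) \<and> nat_mem s ''dst'' j = snd (es ! j)) \<and>
     (\<forall>j<length ps. real_mem s ''x'' j = fst (ps ! j) \<and> real_mem s ''y'' j = snd (ps ! j))"

lemma input_ok_nwrite [simp]:
  "a \<notin> {''n'', ''m'', ''src'', ''dst''} \<Longrightarrow> input_ok ps es (nwrite a i v s) = input_ok ps es s"
  by (auto simp: input_ok_def)

lemma input_ok_rwrite [simp]:
  "a \<notin> {''x'', ''y''} \<Longrightarrow> input_ok ps es (rwrite a i v s) = input_ok ps es s"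
  by (auto simp: input_ok_def)

text \<open>Both orientations of an edge are handled at once, in cells \<open>i\<close> and
  \<open>m + i\<close>: they share the quotient \<open>q\<close> up to sign, and their keys differ
  by 2. The last test decides \<open>upper\<close>.\<close>

definition angle_step :: com where
  "angle_step =
     setvar ''a'' (NRead ''src'' (var ''i'')) ;;
     setvar ''b'' (NRead ''dst'' (var ''i'')) ;;
     setvar ''j'' (NAdd (var ''m'') (var ''i'')) ;;
     NWrite ''A'' (var ''i'') (var ''a'') ;; NWrite ''B'' (var ''i'') (var ''b'') ;;
     NWrite ''A'' (var ''j'') (var ''b'') ;; NWrite ''B'' (var ''j'') (var ''a'') ;;
     setrvar ''dx'' (RSub (RRead ''x'' (var ''b'')) (RRead ''x'' (var ''a''))) ;;
     setrvar ''dy'' (RSub (RRead ''y'' (var ''b'')) (RRead ''y'' (var ''a''))) ;;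
     Cond (RLess (rvar ''dx'') (RConst 0))
       (setrvar ''ax'' (RSub (RConst 0) (rvar ''dx''))) (setrvar ''ax'' (rvar ''dx'')) ;;
     Cond (RLess (rvar ''dy'') (RConst 0))
       (setrvar ''ay'' (RSub (RConst 0) (rvar ''dy''))) (setrvar ''ay'' (rvar ''dy'')) ;;
     setrvar ''q'' (RDiv (rvar ''dx'') (RAdd (rvar ''ax'') (rvar ''ay''))) ;;
     Cond (bor (RLess (RConst 0) (rvar ''dy'')) (BAnd (REq (rvar ''dy'') (RConst 0)) (RLess (RConst 0) (rvar ''dx''))))
       (RWrite ''K'' (var ''i'') (RSub (RConst 1) (rvar ''q'')) ;;
        RWrite ''K'' (var ''j'') (RSub (RConst 3) (rvar ''q'')))
       (RWrite ''K'' (var ''i'') (RAdd (RConst 3) (rvar ''q'')) ;;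
        RWrite ''K'' (var ''j'') (RAdd (RConst 1) (rvar ''q'')))"

lemma ang_cases:
  assumes "d \<noteq> 0"
  shows "upper d \<Longrightarrow> ang d = 1 - fst d / (\<bar>fst d\<bar> + \<bar>snd d\<bar>)"
    "upper d \<Longrightarrow> ang (- d) = 3 - fst d / (\<bar>fst d\<bar> + \<bar>snd d\<bar>)"
    "\<not> upper d \<Longrightarrow> ang d = 3 + fst d / (\<bar>fst d\<bar> + \<bar>snd d\<bar>)"
    "\<not> upper d \<Longrightarrow> ang (- d) = 1 + fst d / (\<bar>fst d\<bar> + \<bar>snd d\<bar>)"
  using upper_uminus[OF assms] by (simp_all add: ang_def)

definition direction :: "point list \<Rightarrow> nat \<times> nat \<Rightarrow> point" where
  "direction ps e = ps ! snd e - ps ! fst e"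

definition arc_at :: "point list \<Rightarrow> state \<Rightarrow> nat \<Rightarrow> nat \<times> nat \<Rightarrow> bool" where
  "arc_at ps s i e \<longleftrightarrow> nat_mem s ''A'' i = fst e \<and> nat_mem s ''B'' i = snd e \<and>
     real_mem s ''K'' i = ang (direction ps e)"

lemma arc_at_nwrite [simp]:
  "a \<notin> {''A'', ''B''} \<Longrightarrow> arc_at ps (nwrite a i v s) j e = arc_at ps s j e"
  by (auto simp: arc_at_def)

lemma result_angle_step:
  assumes ok: "input_ok ps es s" and i: "nat_mem s ''i'' 0 = i" "i < length es"
    and e: "e = es ! i" "fst e < length ps" "snd e < length ps" "ps ! fst e \<noteq> ps ! snd e"
  defines "t \<equiv> result angle_step s"
  shows "input_ok ps es t" "nat_mem t ''i'' 0 = i" "out t = out s"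
    "arc_at ps t i e" "arc_at ps t (length es + i) (prod.swap e)"
    "\<And>j f. j \<noteq> i \<Longrightarrow> j \<noteq> length es + i \<Longrightarrow> arc_at ps s j f \<Longrightarrow> arc_at ps t j f"
proof -
  let ?d = "direction ps e"
  have d: "?d \<noteq> 0" using e by (simp add: direction_def)
  have d': "direction ps (prod.swap e) = - ?d" by (simp add: direction_def)
  have up: "upper ?d \<longleftrightarrow> 0 < snd (ps ! snd e) - snd (ps ! fst e) \<or>
     snd (ps ! snd e) - snd (ps ! fst e) = 0 \<and> 0 < fst (ps ! snd e) - fst (ps ! fst e)"
    by (simp add: upper_def direction_def)
  note ang = ang_cases[OF d, unfolded direction_def fst_diff snd_diff, folded direction_def]
  have r: "nat_mem s ''m'' 0 = length es" "nat_mem s ''src'' i = fst e" "nat_mem s ''dst'' i = snd e"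
    "real_mem s ''x'' (fst e) = fst (ps ! fst e)" "real_mem s ''x'' (snd e) = fst (ps ! snd e)"
    "real_mem s ''y'' (fst e) = snd (ps ! fst e)" "real_mem s ''y'' (snd e) = snd (ps ! snd e)"
    using ok i e by (auto simp: input_ok_def)
  \<comment> \<open>Hence the cells \<open>i\<close> and \<open>length es + i\<close>
    differ.\<close>
  have m: "length es \<noteq> 0" using i by auto
  show "input_ok ps es t" "nat_mem t ''i'' 0 = i" "out t = out s"
    using ok i by (auto simp: t_def angle_step_def)
  show "arc_at ps t i e" "arc_at ps t (length es + i) (prod.swap e)"
    using m i by (auto simp: t_def angle_step_def arc_at_def r d' up ang abs_if)
  show "arc_at ps t j f" if "j \<noteq> i" "j \<noteq> length es + i" "arc_at ps s j f" for j f
    using that i by (auto simp: t_def angle_step_def arc_at_def r)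
qed

text \<open>The rank of a key, with ties broken by index so that ranks form a permutation. Ranking
  by one scan per arc is quadratic, which the time bound permits.\<close>

definition place :: "(nat \<Rightarrow> real) \<Rightarrow> nat \<Rightarrow> nat \<Rightarrow> nat" where
  "place K M i = card {j. j < M \<and> (K j < K i \<or> K j = K i \<and> j < i)}"

lemma place_less:
  assumes "K j < K i \<or> K j = K i \<and> j < i" "j < M"
  shows "place K M j < place K M i"
  unfolding place_def using assms by (intro psubset_card_mono psubsetI) auto

lemma place_bound: "i < M \<Longrightarrow> place K M i < M"
proof -
  assume "i < M"
  then have "place K M i < card {..<M}"
    unfolding place_def by (intro psubset_card_mono psubsetI) auto
  then show ?thesis by simp
qed

lemma place_bij: "bij_betw (place K M) {..<M} {..<M}"
proof -
  have "inj_on (place K M) {..<M}"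
  proof (rule inj_onI)
    fix i j assume ij: "i \<in> {..<M}" "j \<in> {..<M}" "place K M i = place K M j"
    then have "\<not> (K j < K i \<or> K j = K i \<and> j < i)" "\<not> (K i < K j \<or> K i = K j \<and> i < j)"
      using place_less[of K j i M] place_less[of K i j M] by auto
    then show "i = j" by auto
  qed
  moreover have "place K M ` {..<M} \<subseteq> {..<M}" using place_bound by auto
  ultimately show ?thesis unfolding bij_betw_def by (simp add: endo_inj_surj)
qed

definition rank_loop :: com where
  "rank_loop =
     setvar ''r'' (NConst 0) ;;
     For ''j'' (var ''M'')
       (Cond (bor (RLess (RRead ''K'' (var ''j'')) (RRead ''K'' (var ''i'')))
          (BAnd (REq (RRead ''K'' (var ''j'')) (RRead ''K'' (var ''i''))) (NLess (var ''j'') (var ''i''))))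
        (setvar ''r'' (NAdd (var ''r'') (NConst 1))) Skip) ;;
     NWrite ''S'' (var ''r'') (NRead ''A'' (var ''i'')) ;; NWrite ''T'' (var ''r'') (NRead ''B'' (var ''i''))"

definition prepare :: com where
  "prepare = For ''i'' (var ''m'') angle_step ;;
     setvar ''M'' (NAdd (var ''m'') (var ''m'')) ;; For ''i'' (var ''M'') rank_loop"

lemma run_angles:
  assumes ok: "input_ok ps es s" and rng: "in_range (length ps) es"
    and ne: "\<And>e. e \<in> set es \<Longrightarrow> ps ! fst e \<noteq> ps ! snd e"
  shows "run (For ''i'' (var ''m'') angle_step) s (length es * 300 + 100)
    (\<lambda>t. input_ok ps es t \<and> out t = out s \<and>
      (\<forall>i<length es. arc_at ps t i (es ! i) \<and> arc_at ps t (length es + i) (prod.swap (es ! i))))"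
proof -
  let ?I = "\<lambda>i t. nat_mem t ''i'' 0 = i \<and> i \<le> length es \<and> input_ok ps es t \<and> out t = out s \<and>
      (\<forall>j<i. arc_at ps t j (es ! j) \<and> arc_at ps t (length es + j) (prod.swap (es ! j)))"
  have "run (For ''i'' (var ''m'') angle_step) s
     (length es * (max_time angle_step + ncost (var ''m'') + 10) + ncost (var ''m'') + 10) (?I (length es))"
  proof (rule run_for[where I = ?I])
    show "?I 0 (nwrite ''i'' 0 0 s)" using ok by simp
  next
    fix j t assume "?I j t"
    then show "nat_mem t ''i'' 0 = j \<and> nval (var ''m'') t = length es" by (simp add: input_ok_def)
  next
    fix j t assume j: "j < length es" and I: "?I j t"
    let ?t = "result angle_step t"
    have e: "fst (es ! j) < length ps" "snd (es ! j) < length ps" "ps ! fst (es ! j) \<noteq> ps ! snd (es ! j)"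
      using rng ne j by (auto simp: in_range_def)
    have ij: "input_ok ps es t" "nat_mem t ''i'' 0 = j" using I by auto
    note R = result_angle_step[OF ij(1) ij(2) j refl e]
    have old: "arc_at ps ?t l (es ! l) \<and> arc_at ps ?t (length es + l) (prod.swap (es ! l))" if "l < j" for l
      using I that j by (intro conjI R(6)) auto
    show "run angle_step t (max_time angle_step) (\<lambda>t. nat_mem t ''i'' 0 = j \<and> ?I (Suc j) (nwrite ''i'' 0 (Suc j) t))"
    proof (rule run_result)
      show "loop_free angle_step" by (simp add: angle_step_def)
      show "nat_mem ?t ''i'' 0 = j \<and> ?I (Suc j) (nwrite ''i'' 0 (Suc j) ?t)"
        using R(1-5) old I j by (auto simp: less_Suc_eq)
    qed
  qed
  then show ?thesis by (rule run_weaken) (auto simp: angle_step_def)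
qed

text \<open>The final state is given exactly, so that no separate statement about unchanged arrays
  is needed.\<close>

lemma run_rank_loop:
  assumes s: "nat_mem s ''M'' 0 = M" "nat_mem s ''i'' 0 = i" "i < M" "K = real_mem s ''K''"
  shows "run rank_loop s (M * 60 + 60)
     (\<lambda>t. t = nwrite ''T'' (place K M i) (nat_mem s ''B'' i) (nwrite ''S'' (place K M i) (nat_mem s ''A'' i)
        (nwrite ''j'' 0 M (nwrite ''r'' 0 (place K M i) s))))"
proof -
  let ?S = "\<lambda>j. {l. l < j \<and> (K l < K i \<or> K l = K i \<and> l < i)}"
  let ?c = "Cond (bor (RLess (RRead ''K'' (var ''j'')) (RRead ''K'' (var ''i'')))
          (BAnd (REq (RRead ''K'' (var ''j'')) (RRead ''K'' (var ''i''))) (NLess (var ''j'') (var ''i''))))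
        (setvar ''r'' (NAdd (var ''r'') (NConst 1))) Skip"
  let ?I = "\<lambda>j t. t = nwrite ''j'' 0 j (nwrite ''r'' 0 (card (?S j)) s)"
  have nw: "nwrite a k v (nwrite a k w t) = nwrite a k v t" for a k v w t by (simp add: nwrite_def)
  have nwc: "a \<noteq> b \<Longrightarrow> nwrite a k v (nwrite b l w t) = nwrite b l w (nwrite a k v t)" for a b k l v w t
    by (simp add: nwrite_def fun_upd_twist)
  have loop: "run (For ''j'' (var ''M'') ?c) (nwrite ''r'' 0 0 s) (M * (max_time ?c + ncost (var ''M'') + 10) + ncost (var ''M'') + 10) (?I M)"
  proof (rule run_for[where I = ?I])
    show "?I 0 (nwrite ''j'' 0 0 (nwrite ''r'' 0 0 s))" by simp
  next
    fix j t assume "?I j t"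
    then show "nat_mem t ''j'' 0 = j \<and> nval (var ''M'') t = M" using s by simp
  next
    fix j t assume j: "j < M" and I: "?I j t"
    have "?S (Suc j) = (if K j < K i \<or> K j = K i \<and> j < i then insert j (?S j) else ?S j)"
      by (auto simp: less_Suc_eq)
    then have c: "card (?S (Suc j)) = (if K j < K i \<or> K j = K i \<and> j < i then Suc (card (?S j)) else card (?S j))"
      by simp
    show "run ?c t (max_time ?c) (\<lambda>t. nat_mem t ''j'' 0 = j \<and> ?I (Suc j) (nwrite ''j'' 0 (Suc j) t))"
      unfolding c using I s
      by (intro run_result) (auto simp: nw nwc[of "''r''" "''j''"])
  qed
  let ?w = "NWrite ''S'' (var ''r'') (NRead ''A'' (var ''i'')) ;; NWrite ''T'' (var ''r'') (NRead ''B'' (var ''i''))"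
  have "run rank_loop s (max_time (setvar ''r'' (NConst 0)) +
     ((M * (max_time ?c + ncost (var ''M'') + 10) + ncost (var ''M'') + 10) + max_time ?w))
     (\<lambda>t. t = nwrite ''T'' (place K M i) (nat_mem s ''B'' i) (nwrite ''S'' (place K M i) (nat_mem s ''A'' i)
        (nwrite ''j'' 0 M (nwrite ''r'' 0 (place K M i) s))))"
    unfolding rank_loop_def
  proof (intro run_seq run_result)
    show "run (For ''j'' (var ''M'') ?c) (result (setvar ''r'' (NConst 0)) s)
      (M * (max_time ?c + ncost (var ''M'') + 10) + ncost (var ''M'') + 10)
      (\<lambda>s'. run ?w s' (max_time ?w) (\<lambda>t. t = nwrite ''T'' (place K M i) (nat_mem s ''B'' i) (nwrite ''S'' (place K M i) (nat_mem s ''A'' i)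
        (nwrite ''j'' 0 M (nwrite ''r'' 0 (place K M i) s)))))"
      unfolding result.simps nval.simps
      by (rule run_weaken[OF loop order_refl], rule run_result) (use s in \<open>simp_all add: place_def\<close>)
  qed simp
  then show ?thesis by (rule run_weaken) auto
qed

lemma run_ranks:
  assumes s: "nat_mem s ''M'' 0 = M" "nat_mem s ''n'' 0 = n" "nat_mem s ''m'' 0 = m"
    "K = real_mem s ''K''" "A = nat_mem s ''A''" "B = nat_mem s ''B''"
  shows "run (For ''i'' (var ''M'') rank_loop) s (M * (M * 60 + 80) + 40)
    (\<lambda>t. nat_mem t ''M'' 0 = M \<and> nat_mem t ''n'' 0 = n \<and> nat_mem t ''m'' 0 = m \<and> out t = out s \<and>
       (\<forall>i<M. nat_mem t ''S'' (place K M i) = A i \<and> nat_mem t ''T'' (place K M i) = B i))"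
proof -
  let ?I = "\<lambda>i (t :: state). nat_mem t ''i'' 0 = i \<and> i \<le> M \<and> nat_mem t ''M'' 0 = M \<and> nat_mem t ''n'' 0 = n \<and> nat_mem t ''m'' 0 = m \<and>
     K = real_mem t ''K'' \<and> A = nat_mem t ''A'' \<and> B = nat_mem t ''B'' \<and> out t = out s \<and>
     (\<forall>j<i. nat_mem t ''S'' (place K M j) = A j \<and> nat_mem t ''T'' (place K M j) = B j)"
  have "run (For ''i'' (var ''M'') rank_loop) s (M * ((M * 60 + 60) + ncost (var ''M'') + 10) + ncost (var ''M'') + 10) (?I M)"
  proof (rule run_for[where I = ?I])
    show "?I 0 (nwrite ''i'' 0 0 s)" using s by simp
  next
    fix j t assume "?I j t"
    then show "nat_mem t ''i'' 0 = j \<and> nval (var ''M'') t = M" by simp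
  next
    fix j t assume j: "j < M" and I: "?I j t"
    \<comment> \<open>Ranks are distinct, so earlier entries of \<open>S\<close> and
      \<open>T\<close> are not overwritten.\<close>
    have inj: "place K M j \<noteq> place K M l" if "l < j" for l
      using place_bij[of K M] j that unfolding bij_betw_def inj_on_def by fastforce
    show "run rank_loop t (M * 60 + 60) (\<lambda>t. nat_mem t ''i'' 0 = j \<and> ?I (Suc j) (nwrite ''i'' 0 (Suc j) t))"
    proof (rule run_weaken[OF run_rank_loop[of t M j K]])
      show "nat_mem t ''M'' 0 = M" "nat_mem t ''i'' 0 = j" "j < M" "K = real_mem t ''K''" using I j by auto
      fix t' assume t': "t' = nwrite ''T'' (place K M j) (nat_mem t ''B'' j) (nwrite ''S'' (place K M j) (nat_mem t ''A'' j)
        (nwrite ''j'' 0 M (nwrite ''r'' 0 (place K M j) t)))"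
      show "nat_mem t' ''i'' 0 = j \<and> ?I (Suc j) (nwrite ''i'' 0 (Suc j) t')"
        unfolding t' using I j inj by (auto simp: less_Suc_eq)
    qed simp
  qed
  then show ?thesis by (rule run_weaken) (auto simp: algebra_simps)
qed

section \<open>The sorted list of arcs\<close>

definition both_directions :: "(nat \<times> nat) list \<Rightarrow> (nat \<times> nat) list" where
  "both_directions es = es @ map prod.swap es"

definition arc_place :: "point list \<Rightarrow> (nat \<times> nat) list \<Rightarrow> nat \<Rightarrow> nat" where
  "arc_place ps D = place (\<lambda>i. ang (direction ps (D ! i))) (length D)"

text \<open>The program scatters arc \<open>i\<close> to cell \<open>arc_place ps D i\<close>; as a
  list, the result is read off through the inverse permutation.\<close>

definition sorted_arcs :: "point list \<Rightarrow> (nat \<times> nat) list \<Rightarrow> (nat \<times> nat) list" where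
  "sorted_arcs ps es = (let D = both_directions es in
     map (\<lambda>p. D ! inv_into {..<length D} (arc_place ps D) p) [0..<length D])"

lemma length_sorted_arcs [simp]: "length (sorted_arcs ps es) = 2 * length es"
  by (simp add: sorted_arcs_def both_directions_def Let_def)

lemma sorted_arcs_place:
  assumes "i < 2 * length es"
  shows "sorted_arcs ps es ! arc_place ps (both_directions es) i = both_directions es ! i"
    "arc_place ps (both_directions es) i < 2 * length es"
proof -
  have l: "length (both_directions es) = 2 * length es" by (simp add: both_directions_def)
  have b: "bij_betw (arc_place ps (both_directions es)) {..<2 * length es} {..<2 * length es}"
    unfolding arc_place_def l by (rule place_bij)
  show lt: "arc_place ps (both_directions es) i < 2 * length es"
    using b assms by (auto simp: bij_betw_def)
  show "sorted_arcs ps es ! arc_place ps (both_directions es) i = both_directions es ! i"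
    using lt b assms by (simp add: sorted_arcs_def Let_def l bij_betw_def inv_into_f_f)
qed

lemma sorted_arcs_obtain:
  assumes "p < 2 * length es"
  obtains i where "i < 2 * length es" "p = arc_place ps (both_directions es) i"
proof -
  have "bij_betw (arc_place ps (both_directions es)) {..<2 * length es} {..<2 * length es}"
    unfolding arc_place_def by (simp add: both_directions_def place_bij flip: mult_2)
  then have "p \<in> arc_place ps (both_directions es) ` {..<2 * length es}" using assms by (simp add: bij_betw_def)
  then show ?thesis using that by auto
qed

lemma set_sorted_arcs: "set (sorted_arcs ps es) = set es \<union> prod.swap ` set es"
proof -
  have l: "length (both_directions es) = 2 * length es" by (simp add: both_directions_def)
  have "set (sorted_arcs ps es) = set (both_directions es)"
  proof
    show "set (sorted_arcs ps es) \<subseteq> set (both_directions es)"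
    proof
      fix e assume "e \<in> set (sorted_arcs ps es)"
      then obtain p where p: "p < 2 * length es" "e = sorted_arcs ps es ! p" by (auto simp: in_set_conv_nth)
      from sorted_arcs_obtain[OF p(1), of ps] obtain i
        where i: "i < 2 * length es" "p = arc_place ps (both_directions es) i" .
      then show "e \<in> set (both_directions es)" using p sorted_arcs_place(1)[OF i(1), of ps] l by auto
    qed
    show "set (both_directions es) \<subseteq> set (sorted_arcs ps es)"
    proof
      fix e assume "e \<in> set (both_directions es)"
      then obtain i where i: "i < 2 * length es" "e = both_directions es ! i" by (auto simp: in_set_conv_nth l)
      then show "e \<in> set (sorted_arcs ps es)"
        using sorted_arcs_place[OF i(1), of ps] by (metis length_sorted_arcs nth_mem)
    qed
  qed
  then show ?thesis by (simp add: both_directions_def)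
qed

lemma sorted_sorted_arcs:
  "sorted_wrt (\<lambda>e f. ang (direction ps e) \<le> ang (direction ps f)) (sorted_arcs ps es)"
  unfolding sorted_wrt_iff_nth_less length_sorted_arcs
proof (intro allI impI)
  fix p q assume pq: "p < q" "q < 2 * length es"
  have l: "length (both_directions es) = 2 * length es" by (simp add: both_directions_def)
  have "p < 2 * length es" using pq by simp
  from sorted_arcs_obtain[OF this, of ps] obtain i
    where i: "i < 2 * length es" "p = arc_place ps (both_directions es) i" .
  from sorted_arcs_obtain[OF pq(2), of ps] obtain j
    where j: "j < 2 * length es" "q = arc_place ps (both_directions es) j" .
  have "\<not> ang (direction ps (both_directions es ! j)) < ang (direction ps (both_directions es ! i))"
    using place_less[of "\<lambda>i. ang (direction ps (both_directions es ! i))" j i "2 * length es"] pq(1) i j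
    unfolding arc_place_def l by auto
  then show "ang (direction ps (sorted_arcs ps es ! p)) \<le> ang (direction ps (sorted_arcs ps es ! q))"
    unfolding i(2) j(2) using sorted_arcs_place(1)[OF i(1)] sorted_arcs_place(1)[OF j(1)] by simp
qed

lemma distinct_sorted_arcs:
  assumes "distinct (both_directions es)" shows "distinct (sorted_arcs ps es)"
  unfolding distinct_conv_nth length_sorted_arcs
proof (intro allI impI)
  fix p q assume pq: "p < 2 * length es" "q < 2 * length es" "p \<noteq> q"
  have l: "length (both_directions es) = 2 * length es" by (simp add: both_directions_def)
  from sorted_arcs_obtain[OF pq(1), of ps] obtain i
    where i: "i < 2 * length es" "p = arc_place ps (both_directions es) i" .
  from sorted_arcs_obtain[OF pq(2), of ps] obtain j
    where j: "j < 2 * length es" "q = arc_place ps (both_directions es) j" .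
  have "i \<noteq> j" using pq i j by auto
  then have "both_directions es ! i \<noteq> both_directions es ! j"
    using assms i j l by (simp add: nth_eq_iff_index_eq)
  then show "sorted_arcs ps es ! p \<noteq> sorted_arcs ps es ! q"
    unfolding i(2) j(2) using sorted_arcs_place(1)[OF i(1)] sorted_arcs_place(1)[OF j(1)] by simp
qed

lemma run_prepare:
  assumes ok: "input_ok ps es s" and rng: "in_range (length ps) es"
    and ne: "\<And>e. e \<in> set es \<Longrightarrow> ps ! fst e \<noteq> ps ! snd e"
  shows "run prepare s (length es * 300 + 2 * length es * (2 * length es * 60 + 80) + 200)
    (\<lambda>t. ready (length ps) (length es) (sorted_arcs ps es) t \<and> out t = out s)"
proof -
  let ?M = "2 * length es"
  let ?post = "\<lambda>t. ready (length ps) (length es) (sorted_arcs ps es) t \<and> out t = out s"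
  have l: "length (both_directions es) = ?M" by (simp add: both_directions_def)
  have "run prepare s ((length es * 300 + 100) + (max_time (setvar ''M'' (NAdd (var ''m'') (var ''m''))) +
      (?M * (?M * 60 + 80) + 40))) ?post"
    unfolding prepare_def
  proof (rule run_seqI[OF run_angles[OF ok rng ne]])
    fix t assume t: "input_ok ps es t \<and> out t = out s \<and>
      (\<forall>i<length es. arc_at ps t i (es ! i) \<and> arc_at ps t (length es + i) (prod.swap (es ! i)))"
    have arcs: "arc_at ps t i (both_directions es ! i)" if "i < ?M" for i
    proof (cases "i < length es")
      case False
      then show ?thesis using t[THEN conjunct2, THEN conjunct2, rule_format, of "i - length es"] that
        by (simp add: both_directions_def nth_append)
    qed (use t in \<open>simp add: both_directions_def nth_append\<close>)
    let ?t = "nwrite ''M'' 0 ?M t"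
    \<comment> \<open>The memory agrees with the angles only below \<open>?M\<close>, and
      \<open>place\<close> inspects only these cells when \<open>i < ?M\<close>.\<close>
    have pl: "place (real_mem t ''K'') ?M i = arc_place ps (both_directions es) i" if "i < ?M" for i
    proof -
      have "real_mem t ''K'' j = ang (direction ps (both_directions es ! j))" if "j < ?M" for j
        using arcs[OF that] by (simp add: arc_at_def)
      then show ?thesis unfolding arc_place_def place_def l using that by (intro arg_cong[of _ _ card]) auto
    qed
    have "run (For ''i'' (var ''M'') rank_loop) ?t (?M * (?M * 60 + 80) + 40) ?post"
    proof (rule run_weaken[OF run_ranks[of ?t ?M "length ps" "length es" "real_mem t ''K''" "nat_mem t ''A''" "nat_mem t ''B''"]])
      fix u :: state assume u: "nat_mem u ''M'' 0 = ?M \<and> nat_mem u ''n'' 0 = length ps \<and> nat_mem u ''m'' 0 = length es \<and>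
        out u = out ?t \<and> (\<forall>i<?M. nat_mem u ''S'' (place (real_mem t ''K'') ?M i) = nat_mem t ''A'' i \<and>
          nat_mem u ''T'' (place (real_mem t ''K'') ?M i) = nat_mem t ''B'' i)"
      have "nat_mem u ''S'' p = fst (sorted_arcs ps es ! p) \<and> nat_mem u ''T'' p = snd (sorted_arcs ps es ! p)"
        if p: "p < ?M" for p
      proof -
        from sorted_arcs_obtain[OF p, of ps] obtain i
          where i: "i < ?M" "p = arc_place ps (both_directions es) i" .
        then show ?thesis
          using u arcs[OF i(1)] pl[OF i(1)] sorted_arcs_place(1)[OF i(1), of ps] by (auto simp: arc_at_def)
      qed
      then show "?post u" using u t by (simp add: ready_def)
    qed (use t in \<open>simp_all add: input_ok_def\<close>)
    then show "run (setvar ''M'' (NAdd (var ''m'') (var ''m'')) ;; For ''i'' (var ''M'') rank_loop) t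
        (max_time (setvar ''M'' (NAdd (var ''m'') (var ''m''))) + (?M * (?M * 60 + 80) + 40)) ?post"
      using t by (intro run_seq run_result) (simp_all add: input_ok_def mult_2)
  qed simp
  then show ?thesis by (rule run_weaken) auto
qed

section \<open>The enumeration program\<close>

text \<open>\<open>linked Ch Nx v D lo c L\<close>: following the pointers \<open>Nx\<close> (next sibling) and \<open>Ch\<close> (first child)
  from \<open>c\<close>, where the pointer to the \<open>p\<close>-th arc of \<open>D\<close> is \<open>Suc p\<close> and 0 is the null pointer,
  yields exactly the walks \<open>L\<close>, through cells above \<open>lo\<close> only. Dead ends do not occur, as
  \<open>L1 \<noteq> []\<close>; hence the traversal is paid for by the walks that it finds.\<close>

inductive linked :: "(nat \<Rightarrow> nat) \<Rightarrow> (nat \<Rightarrow> nat) \<Rightarrow> nat \<Rightarrow> (nat \<times> nat) list \<Rightarrow> nat \<Rightarrow> nat \<Rightarrow>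
    (nat \<times> nat) list list \<Rightarrow> bool" for Ch Nx v D lo where
  linked_null: "linked Ch Nx v D lo 0 []"
| linked_leaf: "lo < c \<Longrightarrow> c \<le> length D \<Longrightarrow> snd (D ! (c - 1)) = v \<Longrightarrow> Ch c = 0 \<Longrightarrow>
    linked Ch Nx v D lo (Nx c) L \<Longrightarrow> linked Ch Nx v D lo c ([D ! (c - 1)] # L)"
| linked_node: "lo < c \<Longrightarrow> c \<le> length D \<Longrightarrow> snd (D ! (c - 1)) \<noteq> v \<Longrightarrow>
    linked Ch Nx v D lo (Ch c) L1 \<Longrightarrow> L1 \<noteq> [] \<Longrightarrow> linked Ch Nx v D lo (Nx c) L2 \<Longrightarrow>
    linked Ch Nx v D lo c (map ((#) (D ! (c - 1))) L1 @ L2)"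

lemma linked_eq_0_iff: "linked Ch Nx v D lo c L \<Longrightarrow> c = 0 \<longleftrightarrow> L = []"
  by (cases rule: linked.cases) auto

text \<open>A step of the backward pass writes \<open>Ch\<close> and \<open>Nx\<close> only in a
  cell below all those in use, so every list built before remains valid. This is the purpose of
  \<open>lo\<close>.\<close>

lemma linked_mono:
  assumes "linked Ch Nx v D lo c L" "lo' \<le> lo" "\<And>j. lo < j \<Longrightarrow> Ch' j = Ch j \<and> Nx' j = Nx j"
  shows "linked Ch' Nx' v D lo' c L"
  using assms(1)
proof induction
  case (linked_leaf c L)
  then show ?case using assms(2,3) by (intro linked.linked_leaf) auto
next
  case (linked_node c L1 L2)
  then show ?case using assms(2,3) by (intro linked.linked_node) auto
qed (rule linked.linked_null)

text \<open>\<open>H u\<close> heads the list of usable arcs leaving \<open>u\<close>. An arc saves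
  the current head at its target as its children and is prepended to the list at its source. Arcs
  prepended later do not enter the saved list, so children always come later in the order, and lists
  are shared instead of copied. An arc whose target has an empty list is dropped, unless it enters
  \<open>v\<close>.\<close>

definition link_step :: com where
  "link_step =
     setvar ''p'' (NSub (var ''M'') (NAdd (var ''i'') (NConst 1))) ;;
     setvar ''a'' (NRead ''S'' (var ''p'')) ;;
     setvar ''b'' (NRead ''T'' (var ''p'')) ;;
     setvar ''r'' (NAdd (var ''p'') (NConst 1)) ;;
     Cond (NEq (var ''b'') (var ''v''))
       (NWrite ''Ch'' (var ''r'') (NConst 0) ;; NWrite ''Nx'' (var ''r'') (NRead ''H'' (var ''a'')) ;;
        NWrite ''H'' (var ''a'') (var ''r''))
       (Cond (NEq (NRead ''H'' (var ''b'')) (NConst 0)) Skip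
         (NWrite ''Ch'' (var ''r'') (NRead ''H'' (var ''b'')) ;; NWrite ''Nx'' (var ''r'') (NRead ''H'' (var ''a'')) ;;
          NWrite ''H'' (var ''a'') (var ''r'')))"

definition linked_heads :: "nat \<Rightarrow> nat \<Rightarrow> (nat \<times> nat) list \<Rightarrow> nat \<Rightarrow> state \<Rightarrow> bool" where
  "linked_heads n v D k s \<longleftrightarrow>
     (\<forall>u<n. linked (nat_mem s ''Ch'') (nat_mem s ''Nx'') v D k (nat_mem s ''H'' u) (walks v (drop k D) u))"

lemma linked_heads_nwrite [simp]:
  "a \<notin> {''Ch'', ''Nx'', ''H''} \<Longrightarrow> linked_heads n v D k (nwrite a i w s) = linked_heads n v D k s"
  by (simp add: linked_heads_def)

lemma result_link_step:
  assumes r: "ready n m D s" and D: "in_range n D" and i: "nat_mem s ''i'' 0 = i" "i < length D"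
    and v: "nat_mem s ''v'' 0 = v" and h: "linked_heads n v D (length D - i) s"
  defines "t \<equiv> result link_step s"
  shows "ready n m D t" "nat_mem t ''i'' 0 = i" "nat_mem t ''v'' 0 = v" "out t = out s"
    "linked_heads n v D (length D - Suc i) t"
proof -
  let ?p = "length D - Suc i"
  have p: "?p < length D" "length D - i = Suc ?p" using i by simp_all
  have e: "nat_mem s ''S'' ?p = fst (D ! ?p)" "nat_mem s ''T'' ?p = snd (D ! ?p)" "nat_mem s ''M'' 0 = length D"
    using r p by (auto simp: ready_def)
  have b: "fst (D ! ?p) < n" "snd (D ! ?p) < n" using D p by (auto simp: in_range_def)
  show "ready n m D t" "nat_mem t ''i'' 0 = i" "nat_mem t ''v'' 0 = v" "out t = out s"
    using r i v by (auto simp: t_def link_step_def)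
  have dr: "drop ?p D = D ! ?p # drop (Suc ?p) D" using drop_last_step[OF i(2)] p by simp
  note hd = h[unfolded linked_heads_def p(2), rule_format]
  define Ch where "Ch = nat_mem s ''Ch''"
  define Nx where "Nx = nat_mem s ''Nx''"
  define H where "H = nat_mem s ''H''"
  let ?a = "fst (D ! ?p)" and ?b = "snd (D ! ?p)"
  have old: "linked (Ch(Suc ?p := x)) (Nx(Suc ?p := y)) v D ?p (H u) (walks v (drop (Suc ?p) D) u)" if "u < n" for u x y
    using hd[OF that] unfolding Ch_def Nx_def H_def by (rule linked_mono) auto
  have old': "linked Ch Nx v D ?p (H u) (walks v (drop (Suc ?p) D) u)" if "u < n" for u
    using hd[OF that] unfolding Ch_def Nx_def H_def by (rule linked_mono) auto
  consider (leaf) "?b = v" | (dead) "?b \<noteq> v" "H ?b = 0" | (node) "?b \<noteq> v" "H ?b \<noteq> 0" by blast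
  then show "linked_heads n v D ?p t"
  proof cases
    case leaf
    have t: "nat_mem t ''Ch'' = Ch(Suc ?p := 0)" "nat_mem t ''Nx'' = Nx(Suc ?p := H ?a)" "nat_mem t ''H'' = H(?a := Suc ?p)"
      using leaf i v by (auto simp: t_def link_step_def e Ch_def Nx_def H_def)
    have "linked (Ch(Suc ?p := 0)) (Nx(Suc ?p := H ?a)) v D ?p (Suc ?p) ([D ! (Suc ?p - 1)] # walks v (drop (Suc ?p) D) ?a)"
      using leaf p old[OF b(1)] by (intro linked.linked_leaf) auto
    then show ?thesis
      unfolding linked_heads_def t dr using leaf old by auto
  next
    case dead
    have t: "nat_mem t ''Ch'' = Ch" "nat_mem t ''Nx'' = Nx" "nat_mem t ''H'' = H"
      using dead i v by (auto simp: t_def link_step_def e Ch_def Nx_def H_def)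
    have "walks v (drop (Suc ?p) D) ?b = []" using linked_eq_0_iff[OF old'[OF b(2)]] dead by simp
    then show ?thesis
      unfolding linked_heads_def t dr using dead old' by auto
  next
    case node
    have t: "nat_mem t ''Ch'' = Ch(Suc ?p := H ?b)" "nat_mem t ''Nx'' = Nx(Suc ?p := H ?a)" "nat_mem t ''H'' = H(?a := Suc ?p)"
      using node i v by (auto simp: t_def link_step_def e Ch_def Nx_def H_def)
    have "walks v (drop (Suc ?p) D) ?b \<noteq> []" using linked_eq_0_iff[OF old'[OF b(2)]] node by simp
    then have "linked (Ch(Suc ?p := H ?b)) (Nx(Suc ?p := H ?a)) v D ?p (Suc ?p)
       (map ((#) (D ! (Suc ?p - 1))) (walks v (drop (Suc ?p) D) ?b) @ walks v (drop (Suc ?p) D) ?a)"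
      using node p old[OF b(1)] old[OF b(2)] by (intro linked.linked_node) auto
    then show ?thesis
      unfolding linked_heads_def t dr using node old by auto
  qed
qed

section \<open>Depth-first traversal of the linked walks\<close>

definition report :: com where
  "report = Output (var ''d'') ;;
     For ''j'' (var ''d'') (Output (NRead ''S'' (NSub (NRead ''st'' (var ''j'')) (NConst 1))))"

definition dfs_guard :: bexp where
  "dfs_guard = BNot (BAnd (NEq (var ''c'') (NConst 0)) (NEq (var ''d'') (NConst 0)))"

text \<open>\<open>c\<close> is the current pointer and \<open>st\<close> the path above it. A null
  pointer pops and moves to the sibling; any other pointer is pushed and the search descends. Having
  fewer than three arcs on the stack suppresses the walks back and forth along an edge.\<close>

definition dfs_body :: com where
  "dfs_body =
     Cond (NEq (var ''c'') (NConst 0))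
       (setvar ''d'' (NSub (var ''d'') (NConst 1)) ;; setvar ''c'' (NRead ''Nx'' (NRead ''st'' (var ''d''))))
       (NWrite ''st'' (var ''d'') (var ''c'') ;; setvar ''d'' (NAdd (var ''d'') (NConst 1)) ;;
        Cond (BAnd (NEq (NRead ''T'' (NSub (var ''c'') (NConst 1))) (var ''v'')) (BNot (NLess (var ''d'') (NConst 3))))
          report Skip ;;
        setvar ''c'' (NRead ''Ch'' (var ''c'')))"

definition dfs :: "nat \<Rightarrow> nat \<Rightarrow> (nat \<times> nat) list \<Rightarrow> nat \<Rightarrow> (nat \<Rightarrow> nat) \<Rightarrow> (nat \<Rightarrow> nat) \<Rightarrow> nat list \<Rightarrow> state \<Rightarrow> bool" where
  "dfs n m D v Ch Nx ks s \<longleftrightarrow> ready n m D s \<and> nat_mem s ''v'' 0 = v \<and>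
     nat_mem s ''Ch'' = Ch \<and> nat_mem s ''Nx'' = Nx \<and>
     nat_mem s ''d'' 0 = length ks \<and> (\<forall>j<length ks. nat_mem s ''st'' j = ks ! j \<and> 0 < ks ! j \<and> ks ! j \<le> length D)"

lemma dfs_nwrite [simp]:
  "a \<in> {''c'', ''j''} \<Longrightarrow> dfs n m D v Ch Nx ks (nwrite a i w s) = dfs n m D v Ch Nx ks s"
  by (elim insertE emptyE) (simp_all add: dfs_def)

lemma dfs_emit [simp]: "dfs n m D v Ch Nx ks (emit w s) = dfs n m D v Ch Nx ks s"
  by (simp add: dfs_def)

definition path_of :: "(nat \<times> nat) list \<Rightarrow> nat list \<Rightarrow> (nat \<times> nat) list" where
  "path_of D ks = map (\<lambda>k. D ! (k - 1)) ks"

text \<open>The output of the subtree that completes a path \<open>q\<close> on the stack by the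
  walks \<open>L\<close>; the length test applies to the whole walk.\<close>

definition reports :: "(nat \<times> nat) list \<Rightarrow> (nat \<times> nat) list list \<Rightarrow> nat list" where
  "reports q L = concat (map (\<lambda>w. if 3 \<le> length (q @ w) then length (q @ w) # map fst (q @ w) else []) L)"

lemma reports_simps:
  "reports q [] = []" "reports q (L @ L') = reports q L @ reports q L'"
  "reports q (map ((#) e) L) = reports (q @ [e]) L"
  by (simp_all add: reports_def comp_def cong: if_cong)

lemma run_report:
  assumes s: "dfs n m D v Ch Nx ks s"
  shows "run report s (length ks * 30 + 30) (\<lambda>t. dfs n m D v Ch Nx ks t \<and> nat_mem t ''c'' 0 = nat_mem s ''c'' 0 \<and>
     out t = out s @ length ks # map fst (path_of D ks))"
proof -
  let ?c = "Output (NRead ''S'' (NSub (NRead ''st'' (var ''j'')) (NConst 1)))"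
  let ?I = "\<lambda>j t. nat_mem t ''j'' 0 = j \<and> dfs n m D v Ch Nx ks t \<and> nat_mem t ''c'' 0 = nat_mem s ''c'' 0 \<and>
     out t = out s @ length ks # map fst (path_of D (take j ks))"
  let ?o = "Output (var ''d'')"
  have loop: "run (For ''j'' (var ''d'') ?c) (result ?o s) (length ks * (max_time ?c + ncost (var ''d'') + 10) + ncost (var ''d'') + 10) (?I (length ks))"
  proof (rule run_for[where I = ?I])
    show "?I 0 (nwrite ''j'' 0 0 (result ?o s))" using s by (auto simp: path_of_def dfs_def)
  next
    fix j t assume "?I j t"
    then show "nat_mem t ''j'' 0 = j \<and> nval (var ''d'') t = length ks" by (simp add: dfs_def)
  next
    fix j t assume j: "j < length ks" and I: "?I j t"
    have k: "nat_mem t ''st'' j = ks ! j" "ks ! j - 1 < length D" using I j by (auto simp: dfs_def)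
    then have S: "nat_mem t ''S'' (ks ! j - 1) = fst (D ! (ks ! j - 1))" using I by (auto simp: dfs_def ready_def)
    show "run ?c t (max_time ?c) (\<lambda>t. nat_mem t ''j'' 0 = j \<and> ?I (Suc j) (nwrite ''j'' 0 (Suc j) t))"
      using I k S j by (intro run_result) (auto simp: path_of_def take_Suc_conv_app_nth)
  qed
  have "run report s (max_time ?o + (length ks * (max_time ?c + ncost (var ''d'') + 10) + ncost (var ''d'') + 10)) (?I (length ks))"
    unfolding report_def by (intro run_seq run_result loop) simp
  then show ?thesis by (rule run_weaken) auto
qed

lemma run_pop:
  assumes "dfs n m D v Ch Nx (ks @ [k]) s" "nat_mem s ''c'' 0 = 0"
  shows "run dfs_body s 50 (\<lambda>t. dfs n m D v Ch Nx ks t \<and> nat_mem t ''c'' 0 = Nx k \<and> out t = out s)"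
proof -
  let ?pop = "setvar ''d'' (NSub (var ''d'') (NConst 1)) ;; setvar ''c'' (NRead ''Nx'' (NRead ''st'' (var ''d'')))"
  have "run ?pop s (max_time ?pop) (\<lambda>t. dfs n m D v Ch Nx ks t \<and> nat_mem t ''c'' 0 = Nx k \<and> out t = out s)"
    using assms by (intro run_result) (auto simp: dfs_def nth_append less_Suc_eq)
  then show ?thesis
    unfolding dfs_body_def
    by (rule run_weaken[OF run_cond_True, rotated]) (use assms in auto)
qed

text \<open>The time proportional to the depth arises only at an arc into \<open>v\<close>, where a
  walk is complete; other pushes take constant time.\<close>

lemma run_push:
  assumes s: "dfs n m D v Ch Nx ks s" and c: "nat_mem s ''c'' 0 = c" "0 < c" "c \<le> length D"
    and leaf: "snd (D ! (c - 1)) = v \<Longrightarrow> Ch c = 0"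
  shows "run dfs_body s (if snd (D ! (c - 1)) = v then length ks * 30 + 200 else 200)
    (\<lambda>t. dfs n m D v Ch Nx (ks @ [c]) t \<and> nat_mem t ''c'' 0 = Ch c \<and>
       out t = out s @ (if snd (D ! (c - 1)) = v then reports (path_of D ks) [[D ! (c - 1)]] else []))"
    (is "run _ _ _ ?Q")
proof -
  let ?e = "D ! (c - 1)"
  let ?w1 = "NWrite ''st'' (var ''d'') (var ''c'')" and ?w2 = "setvar ''d'' (NAdd (var ''d'') (NConst 1))"
  let ?g = "BAnd (NEq (NRead ''T'' (NSub (var ''c'') (NConst 1))) (var ''v'')) (BNot (NLess (var ''d'') (NConst 3)))"
  let ?r = "Cond ?g report Skip" and ?n = "setvar ''c'' (NRead ''Ch'' (var ''c''))"
  let ?t = "result ?w2 (result ?w1 s)"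
  let ?K = "if snd ?e = v then length ks * 30 + 80 else 20"
  have t: "dfs n m D v Ch Nx (ks @ [c]) ?t" "nat_mem ?t ''c'' 0 = c" "out ?t = out s"
    using s c by (auto simp: dfs_def nth_append less_Suc_eq)
  have T: "nat_mem ?t ''T'' (c - 1) = snd ?e" "nat_mem ?t ''v'' 0 = v" "nat_mem ?t ''d'' 0 = Suc (length ks)"
    using t(1) c by (auto simp: dfs_def ready_def)
  have g: "bval ?g ?t \<longleftrightarrow> snd ?e = v \<and> 3 \<le> Suc (length ks)" using T t(2) by auto
  have path: "path_of D (ks @ [c]) = path_of D ks @ [?e]" "length (path_of D ks) = length ks"
    by (simp_all add: path_of_def)
  have fin: "run ?n u (max_time ?n) ?Q" if "dfs n m D v Ch Nx (ks @ [c]) u" "nat_mem u ''c'' 0 = c"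
      "out u = out s @ (if snd ?e = v then reports (path_of D ks) [[?e]] else [])" for u
    using that by (intro run_result) (auto simp: dfs_def)
  have mid: "run ?r ?t (1 + bcost ?g + ?K) (\<lambda>u. run ?n u (max_time ?n) ?Q)"
  proof (cases "bval ?g ?t")
    case True
    have "run report ?t (length (ks @ [c]) * 30 + 30) (\<lambda>u. run ?n u (max_time ?n) ?Q)"
      by (rule run_weaken[OF run_report[OF t(1)] order_refl], rule fin)
        (use True g t path in \<open>auto simp: reports_def\<close>)
    then have "run report ?t ?K (\<lambda>u. run ?n u (max_time ?n) ?Q)"
      by (rule run_weaken) (use True g in auto)
    then show ?thesis by (rule run_cond_True[OF True])
  next
    case False
    have "run Skip ?t (max_time Skip) (\<lambda>u. run ?n u (max_time ?n) ?Q)"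
      by (rule run_result) (use fin[of ?t] t False g path in \<open>auto simp: reports_def\<close>)
    then have "run Skip ?t ?K (\<lambda>u. run ?n u (max_time ?n) ?Q)" by (rule run_weaken) auto
    then show ?thesis by (rule run_cond_False[OF False])
  qed
  have "run dfs_body s (1 + bcost (NEq (var ''c'') (NConst 0)) +
     (max_time ?w1 + (max_time ?w2 + ((1 + bcost ?g + ?K) + max_time ?n)))) ?Q"
    unfolding dfs_body_def
    by (intro run_cond_False run_seq run_result mid) (use c in auto)
  then show ?thesis by (rule run_weaken) auto
qed

text \<open>The budget of the walks completing a path of length \<open>d\<close>: each pays 30 per
  arc of the full path for its report, and 400 for each of its own arcs to cover pushing and
  popping. At depth 0 this is 430 per arc.\<close>

definition dfs_time :: "nat \<Rightarrow> (nat \<times> nat) list list \<Rightarrow> nat" where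
  "dfs_time d L = (\<Sum>w\<leftarrow>L. 30 * (d + length w) + 400 * length w)"

lemma dfs_time_simps:
  "dfs_time d [] = 0" "dfs_time d ([e] # L) = 30 * d + 430 + dfs_time d L"
  "dfs_time d (L @ L') = dfs_time d L + dfs_time d L'"
  "dfs_time d (map ((#) e) L) = dfs_time (Suc d) L + 400 * length L"
proof -
  show "dfs_time d (map ((#) e) L) = dfs_time (Suc d) L + 400 * length L"
    by (induction L) (auto simp: dfs_time_def)
qed (simp_all add: dfs_time_def)

text \<open>Induction along \<open>linked\<close>, for an arbitrary stack. The traversal below a
  node is a run of loop iterations that ends with a null pointer and the stack restored, so the runs
  for children and siblings concatenate.\<close>

lemma iters_dfs:
  assumes "linked Ch Nx v D lo c L" "dfs n m D v Ch Nx ks s" "nat_mem s ''c'' 0 = c"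
  shows "iters dfs_guard dfs_body s (dfs_time (length ks) L)
    (\<lambda>t. dfs n m D v Ch Nx ks t \<and> nat_mem t ''c'' 0 = 0 \<and> out t = out s @ reports (path_of D ks) L)"
  using assms
proof (induction arbitrary: ks s)
  case linked_null
  then show ?case by (intro iters_refl) (simp add: reports_simps)
next
  case (linked_leaf c L)
  let ?e = "D ! (c - 1)"
  let ?Q = "\<lambda>t. dfs n m D v Ch Nx ks t \<and> nat_mem t ''c'' 0 = 0 \<and> out t = out s @ reports (path_of D ks) ([?e] # L)"
  have r: "reports (path_of D ks) ([?e] # L) = reports (path_of D ks) [[?e]] @ reports (path_of D ks) L"
    by (simp add: reports_def)
  have "iters dfs_guard dfs_body s (1 + bcost dfs_guard + (length ks * 30 + 200) +
      (1 + bcost dfs_guard + 50 + dfs_time (length ks) L)) ?Q"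
  proof (rule iters_step)
    show "bval dfs_guard s" using linked_leaf by (simp add: dfs_guard_def)
    have push: "run dfs_body s (length ks * 30 + 200)
      (\<lambda>t. dfs n m D v Ch Nx (ks @ [c]) t \<and> nat_mem t ''c'' 0 = Ch c \<and>
       out t = out s @ reports (path_of D ks) [[?e]])"
      using run_push[OF linked_leaf.prems] linked_leaf.hyps by simp
    show "run dfs_body s (length ks * 30 + 200)
      (\<lambda>t. iters dfs_guard dfs_body t (1 + bcost dfs_guard + 50 + dfs_time (length ks) L) ?Q)"
    proof (rule run_weaken[OF push order_refl])
      fix t assume t: "dfs n m D v Ch Nx (ks @ [c]) t \<and> nat_mem t ''c'' 0 = Ch c \<and>
       out t = out s @ reports (path_of D ks) [[?e]]"
      show "iters dfs_guard dfs_body t (1 + bcost dfs_guard + 50 + dfs_time (length ks) L) ?Q"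
      proof (rule iters_step)
        show "bval dfs_guard t" using t by (simp add: dfs_guard_def dfs_def)
        have "nat_mem t ''c'' 0 = 0" using t linked_leaf.hyps by simp
        from run_pop[OF conjunct1[OF t] this]
        show "run dfs_body t 50 (\<lambda>t. iters dfs_guard dfs_body t (dfs_time (length ks) L) ?Q)"
        proof (rule run_weaken)
          fix u assume u: "dfs n m D v Ch Nx ks u \<and> nat_mem u ''c'' 0 = Nx c \<and> out u = out t"
          show "iters dfs_guard dfs_body u (dfs_time (length ks) L) ?Q"
            by (rule iters_weaken[OF linked_leaf.IH[of ks u]]) (use u t r in auto)
        qed simp
      qed
    qed
  qed
  then show ?case by (rule iters_weaken) (auto simp: dfs_time_simps dfs_guard_def)
next
  case (linked_node c L1 L2)
  let ?e = "D ! (c - 1)"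
  let ?L = "map ((#) ?e) L1 @ L2"
  let ?Q = "\<lambda>t. dfs n m D v Ch Nx ks t \<and> nat_mem t ''c'' 0 = 0 \<and> out t = out s @ reports (path_of D ks) ?L"
  have r: "reports (path_of D ks) ?L = reports (path_of D (ks @ [c])) L1 @ reports (path_of D ks) L2"
    by (simp add: reports_simps path_of_def)
  have "iters dfs_guard dfs_body s (1 + bcost dfs_guard + 200 + (dfs_time (length (ks @ [c])) L1 +
      (1 + bcost dfs_guard + 50 + dfs_time (length ks) L2))) ?Q"
  proof (rule iters_step)
    show "bval dfs_guard s" using linked_node by (simp add: dfs_guard_def)
    have push: "run dfs_body s 200
      (\<lambda>t. dfs n m D v Ch Nx (ks @ [c]) t \<and> nat_mem t ''c'' 0 = Ch c \<and> out t = out s)"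
      using run_push[OF linked_node.prems] linked_node.hyps by simp
    show "run dfs_body s 200 (\<lambda>t. iters dfs_guard dfs_body t (dfs_time (length (ks @ [c])) L1 +
      (1 + bcost dfs_guard + 50 + dfs_time (length ks) L2)) ?Q)"
    proof (rule run_weaken[OF push order_refl])
      fix t assume t: "dfs n m D v Ch Nx (ks @ [c]) t \<and> nat_mem t ''c'' 0 = Ch c \<and> out t = out s"
      show "iters dfs_guard dfs_body t (dfs_time (length (ks @ [c])) L1 +
        (1 + bcost dfs_guard + 50 + dfs_time (length ks) L2)) ?Q"
      proof (rule iters_trans[OF linked_node.IH(1)])
        show "dfs n m D v Ch Nx (ks @ [c]) t" "nat_mem t ''c'' 0 = Ch c" using t by auto
        fix u assume u: "dfs n m D v Ch Nx (ks @ [c]) u \<and> nat_mem u ''c'' 0 = 0 \<and>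
           out u = out t @ reports (path_of D (ks @ [c])) L1"
        show "iters dfs_guard dfs_body u (1 + bcost dfs_guard + 50 + dfs_time (length ks) L2) ?Q"
        proof (rule iters_step)
          show "bval dfs_guard u" using u by (simp add: dfs_guard_def dfs_def)
          from run_pop[OF conjunct1[OF u]] u
          have "run dfs_body u 50 (\<lambda>t. dfs n m D v Ch Nx ks t \<and> nat_mem t ''c'' 0 = Nx c \<and> out t = out u)" by simp
          then show "run dfs_body u 50 (\<lambda>t. iters dfs_guard dfs_body t (dfs_time (length ks) L2) ?Q)"
          proof (rule run_weaken)
            fix x assume x: "dfs n m D v Ch Nx ks x \<and> nat_mem x ''c'' 0 = Nx c \<and> out x = out u"
            show "iters dfs_guard dfs_body x (dfs_time (length ks) L2) ?Q"
              by (rule iters_weaken[OF linked_node.IH(2)[of ks x]]) (use x u t r in auto)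
          qed simp
        qed
      qed
    qed
  qed
  \<comment> \<open>Some walk passes through this node, and its 400 units pay for the push and the
    pop.\<close>
  moreover have "1 \<le> length L1" using linked_node.hyps by (cases L1) auto
  ultimately show ?case by (elim iters_weaken) (auto simp: dfs_time_simps dfs_guard_def)
qed

definition enum_vertex :: com where
  "enum_vertex =
     For ''u'' (var ''n'') (NWrite ''H'' (var ''u'') (NConst 0)) ;;
     For ''i'' (var ''M'') link_step ;;
     (setvar ''c'' (NRead ''H'' (var ''v'')) ;; setvar ''d'' (NConst 0)) ;;
     While dfs_guard dfs_body"

definition enum_main :: com where
  "enum_main = For ''v'' (var ''n'') enum_vertex"

lemma run_enum_vertex:
  assumes s: "ready n m D s" and v: "nat_mem s ''v'' 0 = v" "v < n" and D: "in_range n D"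
  shows "run enum_vertex s (n * 20 + length D * 100 + 100 + dfs_time 0 (walks v D v))
    (\<lambda>t. ready n m D t \<and> nat_mem t ''v'' 0 = v \<and> out t = out s @ reports [] (walks v D v))"
    (is "run _ _ _ ?Q")
proof -
  let ?I = "\<lambda>i t. nat_mem t ''i'' 0 = i \<and> i \<le> length D \<and> ready n m D t \<and> nat_mem t ''v'' 0 = v \<and> out t = out s \<and>
       linked_heads n v D (length D - i) t"
  let ?K = "length D * (max_time link_step + ncost (var ''M'') + 10) + ncost (var ''M'') + 10"
  have loop: "run (For ''i'' (var ''M'') link_step) t ?K (?I (length D))"
    if t: "ready n m D t" "\<forall>u<n. nat_mem t ''H'' u = 0" "out t = out s" "nat_mem t ''v'' 0 = v" for t
  proof (rule run_for[where I = ?I])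
    show "?I 0 (nwrite ''i'' 0 0 t)" using t by (auto simp: linked_heads_def linked.linked_null)
  next
    fix j t assume "?I j t"
    then show "nat_mem t ''i'' 0 = j \<and> nval (var ''M'') t = length D" by (simp add: ready_def)
  next
    fix j t assume j: "j < length D" and I: "?I j t"
    show "run link_step t (max_time link_step)
      (\<lambda>t. nat_mem t ''i'' 0 = j \<and> ?I (Suc j) (nwrite ''i'' 0 (Suc j) t))"
    proof (rule run_result)
      show "loop_free link_step" by (simp add: link_step_def)
      show "nat_mem (result link_step t) ''i'' 0 = j \<and> ?I (Suc j) (nwrite ''i'' 0 (Suc j) (result link_step t))"
        using result_link_step[of n m D t j v] I j D by simp
    qed
  qed
  let ?w = "setvar ''c'' (NRead ''H'' (var ''v'')) ;; setvar ''d'' (NConst 0)"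
  let ?T = "dfs_time 0 (walks v D v) + (1 + bcost dfs_guard)"
  have search: "run (While dfs_guard dfs_body) t ?T ?Q" if I: "?I (length D) u" and t: "t = result ?w u" for t u
  proof -
    have l: "linked (nat_mem t ''Ch'') (nat_mem t ''Nx'') v D 0 (nat_mem t ''c'' 0) (walks v D v)"
      using I v by (simp add: t linked_heads_def)
    have "dfs n m D v (nat_mem t ''Ch'') (nat_mem t ''Nx'') [] t"
      using I by (simp add: t dfs_def)
    from iters_dfs[OF l this refl]
    have "run (While dfs_guard dfs_body) t ?T (\<lambda>x. dfs n m D v (nat_mem t ''Ch'') (nat_mem t ''Nx'') [] x \<and>
       nat_mem x ''c'' 0 = 0 \<and> out x = out t @ reports (path_of D []) (walks v D v))"
      by (intro run_while) (auto simp: dfs_guard_def dfs_def)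
    then show ?thesis
      by (rule run_weaken) (use I t in \<open>auto simp: dfs_def path_of_def\<close>)
  qed
  have "run enum_vertex s ((n * 20 + 20) + (?K + (max_time ?w + ?T))) ?Q"
    unfolding enum_vertex_def
  proof (rule run_seqI[OF run_fill[OF s]])
    fix t assume t: "ready n m D t \<and> (\<forall>u<n. nat_mem t ''H'' u = 0) \<and> out t = out s \<and>
       (\<forall>a. a \<noteq> ''H'' \<longrightarrow> a \<noteq> ''u'' \<longrightarrow> nat_mem t a = nat_mem s a)"
    have t': "ready n m D t" "\<forall>u<n. nat_mem t ''H'' u = 0" "out t = out s" "nat_mem t ''v'' 0 = v"
      using t v by auto
    show "run (For ''i'' (var ''M'') link_step ;; ?w ;; While dfs_guard dfs_body) t (?K + (max_time ?w + ?T)) ?Q"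
    proof (rule run_seqI[OF loop[OF t']])
      fix u assume u: "?I (length D) u"
      show "run (?w ;; While dfs_guard dfs_body) u (max_time ?w + ?T) ?Q"
        by (intro run_seq run_result search[OF u]) auto
    qed
  qed simp
  then show ?thesis by (rule run_weaken) (auto simp: link_step_def dfs_guard_def)
qed

lemma run_enum_main:
  assumes s: "ready n m D s" and D: "in_range n D" and o: "out s = []"
  shows "run enum_main s (n * (n * 20 + length D * 100 + 120) + 20 + (\<Sum>v<n. dfs_time 0 (walks v D v)))
    (\<lambda>t. out t = concat (map (\<lambda>v. reports [] (walks v D v)) [0..<n]))"
proof -
  let ?K = "\<lambda>v. n * 20 + length D * 100 + 100 + dfs_time 0 (walks v D v)"
  let ?I = "\<lambda>v t. nat_mem t ''v'' 0 = v \<and> ready n m D t \<and> out t = concat (map (\<lambda>v. reports [] (walks v D v)) [0..<v])"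
  have "run enum_main s ((\<Sum>v<n. ?K v + ncost (var ''n'') + 10) + ncost (var ''n'') + 10) (?I n)"
    unfolding enum_main_def
  proof (rule run_for_sum[where I = ?I])
    show "?I 0 (nwrite ''v'' 0 0 s)" using s o by simp
  next
    fix j t assume "?I j t"
    then show "nat_mem t ''v'' 0 = j \<and> nval (var ''n'') t = n" by (simp add: ready_def)
  next
    fix j t assume j: "j < n" and I: "?I j t"
    show "run enum_vertex t (?K j) (\<lambda>t. nat_mem t ''v'' 0 = j \<and> ?I (Suc j) (nwrite ''v'' 0 (Suc j) t))"
      by (rule run_weaken[OF run_enum_vertex[of n m D t j]]) (use I j D in auto)
  qed
  then show ?thesis by (rule run_weaken) (auto simp: sum.distrib algebra_simps)
qed

section \<open>Correctness and running time\<close>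

lemma input_ok_input_state: "input_ok ps es (input_state ps es)" "out (input_state ps es) = []"
  by (auto simp: input_ok_def input_state_def array_of_def)

lemma length_concat_upt: "length (concat (map f [0..<n])) = (\<Sum>v<n. length (f v))"
  by (induction n) auto

lemma dfs_time_concat_upt: "(\<Sum>v<n. dfs_time 0 (f v)) = dfs_time 0 (concat (map f [0..<n]))"
  by (induction n) (auto simp: dfs_time_simps)

lemma reports_concat_upt: "concat (map (\<lambda>v. reports [] (f v)) [0..<n]) = reports [] (concat (map f [0..<n]))"
  by (induction n) (auto simp: reports_simps)

lemma dfs_time_0: "dfs_time 0 L = 430 * (\<Sum>w\<leftarrow>L. length w)"
  by (induction L) (auto simp: dfs_time_def)

lemma reports_Nil:
  "reports [] L = concat (map (\<lambda>w. length w # map fst w) (filter (\<lambda>w. 3 \<le> length w) L))"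
  by (induction L) (auto simp: reports_def)

lemma represents_nonloop:
  assumes "pslg V E" "represents ps es V E" "e \<in> set es"
  shows "ps ! fst e \<noteq> ps ! snd e"
proof -
  have "{ps ! fst e, ps ! snd e} \<in> E"
    using assms(2,3) by (force simp: represents_def case_prod_unfold)
  then have "card {ps ! fst e, ps ! snd e} = 2" using assms(1) by (simp add: pslg_def)
  then show ?thesis by auto
qed

text \<open>Each undirected edge is listed once and has two different ends, so its reverse is not in
  the list.\<close>

lemma distinct_both_directions:
  assumes "pslg V E" "represents ps es V E" shows "distinct (both_directions es)"
proof -
  have d: "distinct (map (\<lambda>e. {ps ! fst e, ps ! snd e}) es)"
    using assms(2) by (simp add: represents_def case_prod_unfold)
  have "e \<notin> prod.swap ` set es" if e: "e \<in> set es" for e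
  proof
    assume "e \<in> prod.swap ` set es"
    then have sw: "prod.swap e \<in> set es" by auto
    have "inj_on (\<lambda>e. {ps ! fst e, ps ! snd e}) (set es)" using d by (simp add: distinct_map)
    from inj_onD[OF this _ e sw] have "e = prod.swap e" by (simp add: insert_commute)
    then have "fst e = snd e" by (metis fst_swap)
    then show False using represents_nonloop[OF assms e] by simp
  qed
  then show ?thesis
    using d by (auto simp: both_directions_def distinct_map intro: inj_on_subset[OF inj_swap])
qed

definition count_program :: com where "count_program = prepare ;; count_main"
definition enum_program :: com where "enum_program = prepare ;; enum_main"

text \<open>With \<open>m \<le> 3 * n\<close>: ranking costs \<open>240 * m * m\<close> and the
  enumeration passes \<open>20 * n * n + 200 * n * m\<close>, so 2160 + 20 + 600 = 2780. The terms
  \<open>(300 + 160 + 860) * m + 120 * n\<close> give 4080, where \<open>860 * m\<close> pays for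
  the walks of two arcs. The constants of both programs stay below 400.\<close>

definition time_bound :: "nat \<Rightarrow> nat" where
  "time_bound n = 2780 * (n * n) + 4080 * n + 400"

lemma time_bound_quadratic: "(\<lambda>n. real (time_bound n)) \<in> O(\<lambda>n. real n ^ 2)"
proof (rule bigoI)
  \<comment> \<open>7260 is the sum of the three coefficients, which suffices as soon as
    \<open>1 \<le> n\<close>.\<close>
  show "\<forall>\<^sub>F n in at_top. norm (real (time_bound n)) \<le> 7260 * norm (real n ^ 2)"
    using eventually_ge_at_top[of "1::nat"]
  proof eventually_elim
    case (elim n)
    then have "1 \<le> n * n" "n \<le> n * n" by simp_all
    then have "time_bound n \<le> 7260 * (n * n)" unfolding time_bound_def by linarith
    then have "real (time_bound n) \<le> real (7260 * (n * n))" by (simp only: of_nat_le_iff)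
    then show ?case by (simp add: power2_eq_square)
  qed
qed

lemma time_bounds:
  assumes "m \<le> 3 * n"
  shows "(m * 300 + 2 * m * (2 * m * 60 + 80) + 200) + (n * (n * 20 + 2 * m * 80 + 100) + 100) \<le> time_bound n"
    and "(m * 300 + 2 * m * (2 * m * 60 + 80) + 200) + (n * (n * 20 + 2 * m * 100 + 120) + 20 + 430 * (s + 2 * m))
       \<le> time_bound n + 430 * s"
proof -
  have le: "n * m \<le> 3 * (n * n)" "m * m \<le> 9 * (n * n)"
    using mult_le_mono2[OF assms, of n] mult_le_mono[OF assms assms] by simp_all
  have eq: "2 * m * (2 * m * 60 + 80) = 240 * (m * m) + 160 * m"
    "n * (n * 20 + 2 * m * 80 + 100) = 20 * (n * n) + 160 * (n * m) + 100 * n"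
    "n * (n * 20 + 2 * m * 100 + 120) = 20 * (n * n) + 200 * (n * m) + 120 * n"
    "430 * (s + 2 * m) = 430 * s + 860 * m"
    by (simp_all add: algebra_simps)
  show
    "(m * 300 + 2 * m * (2 * m * 60 + 80) + 200) + (n * (n * 20 + 2 * m * 80 + 100) + 100) \<le> time_bound n"
    "(m * 300 + 2 * m * (2 * m * 60 + 80) + 200) + (n * (n * 20 + 2 * m * 100 + 120) + 20 + 430 * (s + 2 * m))
       \<le> time_bound n + 430 * s"
    unfolding eq time_bound_def using le assms by linarith+
qed

lemma programs_correct:
  assumes G: "pslg V E" "no_three_collinear V" and rep: "represents ps es V E"
  shows "run count_program (input_state ps es) (time_bound (card V)) (\<lambda>s. out s = [card (convex_polygons E)])"
    and "run enum_program (input_state ps es) (time_bound (card V) + 430 * (\<Sum>P\<in>convex_polygons E. card P))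
      (\<lambda>s. enumerates_convex_polygons ps E (out s))"
proof -
  let ?D = "sorted_arcs ps es" and ?n = "length ps" and ?m = "length es"
  interpret sorted_graph ps es V E ?D
    using G rep distinct_sorted_arcs[OF distinct_both_directions[OF G(1) rep]] set_sorted_arcs sorted_sorted_arcs
    by unfold_locales (auto simp: direction_def)
  have n: "?n = card V" using dist_ps set_ps distinct_card by metis
  have m: "?m \<le> 3 * ?n" using pslg_card_edges[OF G] card_E n by simp
  have rng: "in_range ?n es" "in_range ?n ?D"
    using es_bound D_bound by (auto simp: in_range_def)
  have prep: "run prepare (input_state ps es) (?m * 300 + 2 * ?m * (2 * ?m * 60 + 80) + 200)
    (\<lambda>t. ready ?n ?m ?D t \<and> out t = [])"
    using run_prepare[OF input_ok_input_state(1) rng(1)] represents_nonloop[OF G(1) rep] input_ok_input_state(2)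
    by simp
  have "run count_program (input_state ps es)
    ((?m * 300 + 2 * ?m * (2 * ?m * 60 + 80) + 200) + (?n * (?n * 20 + 2 * ?m * 80 + 100) + 100))
    (\<lambda>s. out s = [card (convex_polygons E)])"
    unfolding count_program_def
  proof (rule run_seqI[OF prep])
    fix t assume t: "ready ?n ?m ?D t \<and> out t = []"
    \<comment> \<open>The truncated subtraction is exact, because the total is the number of
      polygons plus \<open>?m\<close>.\<close>
    have "(\<Sum>v<?n. length (walks v ?D v)) - ?m = card (convex_polygons E)"
      using length_all_walks by (simp add: all_walks_def length_concat_upt)
    then show "run count_main t (?n * (?n * 20 + 2 * ?m * 80 + 100) + 100) (\<lambda>s. out s = [card (convex_polygons E)])"
      using run_count_main[of ?n ?m ?D t] t rng(2) by simp
  qed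
  then show "run count_program (input_state ps es) (time_bound (card V)) (\<lambda>s. out s = [card (convex_polygons E)])"
    by (rule run_weaken) (use time_bounds(1)[OF m] n in simp_all)
  have "run enum_program (input_state ps es)
    ((?m * 300 + 2 * ?m * (2 * ?m * 60 + 80) + 200) + (?n * (?n * 20 + 2 * ?m * 100 + 120) + 20 +
       430 * ((\<Sum>P\<in>convex_polygons E. card P) + 2 * ?m)))
    (\<lambda>s. enumerates_convex_polygons ps E (out s))"
    unfolding enum_program_def
  proof (rule run_seqI[OF prep])
    fix t assume t: "ready ?n ?m ?D t \<and> out t = []"
    \<comment> \<open>The budgets of all start vertices add up to 430 per arc of all walks,
      including those that are not reported.\<close>
    have "(\<Sum>v<?n. dfs_time 0 (walks v ?D v)) \<le> 430 * ((\<Sum>P\<in>convex_polygons E. card P) + 2 * ?m)"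
      using mult_le_mono2[OF sum_length_all_walks, of 430]
      unfolding dfs_time_concat_upt unfolding all_walks_def[symmetric] unfolding dfs_time_0 .
    moreover have "enumerates_convex_polygons ps E (concat (map (\<lambda>v. reports [] (walks v ?D v)) [0..<?n]))"
      using enumerates_long_walks unfolding reports_concat_upt unfolding all_walks_def[symmetric] unfolding reports_Nil long_walks_def .
    ultimately show "run enum_main t (?n * (?n * 20 + 2 * ?m * 100 + 120) + 20 +
       430 * ((\<Sum>P\<in>convex_polygons E. card P) + 2 * ?m)) (\<lambda>s. enumerates_convex_polygons ps E (out s))"
      by (intro run_weaken[OF run_enum_main[of ?n ?m ?D t]]) (use t rng(2) in simp_all)
  qed
  then show "run enum_program (input_state ps es) (time_bound (card V) + 430 * (\<Sum>P\<in>convex_polygons E. card P))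
      (\<lambda>s. enumerates_convex_polygons ps E (out s))"
    by (rule run_weaken) (use time_bounds(2)[OF m] n in simp_all)
qed

theorem theorem2:
  "\<exists>(count :: com) (enum :: com) (T :: nat \<Rightarrow> nat) (C :: nat).
     (\<lambda>n. real (T n)) \<in> O(\<lambda>n. real n ^ 2) \<and>
     (\<forall>V E ps es. pslg V E \<longrightarrow> no_three_collinear V \<longrightarrow> represents ps es V E \<longrightarrow>
        (\<exists>k s. exec count (input_state ps es) k s \<and>
           out s = [card (convex_polygons E)] \<and>
           k \<le> T (card V)) \<and>
        (\<exists>k s. exec enum (input_state ps es) k s \<and>
           enumerates_convex_polygons ps E (out s) \<and>
           k \<le> T (card V) + C * (\<Sum>P\<in>convex_polygons E. card P)))"
proof (rule exI[of _ count_program], rule exI[of _ enum_program], rule exI[of _ time_bound],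
    rule exI[of _ 430], intro conjI allI impI)
  show "(\<lambda>n. real (time_bound n)) \<in> O(\<lambda>n. real n ^ 2)" by (rule time_bound_quadratic)
  fix V E ps es assume G: "pslg V E" "no_three_collinear V" "represents ps es V E"
  show "\<exists>k s. exec count_program (input_state ps es) k s \<and> out s = [card (convex_polygons E)] \<and>
      k \<le> time_bound (card V)"
    using programs_correct(1)[OF G] unfolding run_def by blast
  show "\<exists>k s. exec enum_program (input_state ps es) k s \<and> enumerates_convex_polygons ps E (out s) \<and>
      k \<le> time_bound (card V) + 430 * (\<Sum>P\<in>convex_polygons E. card P)"
    using programs_correct(2)[OF G] unfolding run_def by blast
qed

end
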